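(* There exists a number $f(k,t)$, depending only on the positive integers $k$ and $t$, such that the following holds: if $n \geq f(k,t)$ and $\mathcal{F} \subset \binom{[n]}{k}$ is $t$-intersecting, then \[|\mathcal{I}(\mathcal{F})| \leq |\mathcal{I}(\mathcal{A}_t)|,\] where \[\mathcal{A}_t = \left\{ A \in \binom{[n]}{k} : |A \cap \{1,2,\ldots,t+2\}| \geq t+1\right\}.\] Moreover, $f(k,t)$ can be taken to satisfy the following (asymptotics as $k \to \infty$): 1. if $t = \mathcal{O}(1)$, then $f(k,t) = \Theta(k^{3/2+\epsilon})$, where $\epsilon = \frac{10+t}{2(k-t-2)}$; 2. if $t = o(k)$, then (a) if $t = \Theta(k^{\epsilon'})$ with $\epsilon' \leq 1/4$, then $f(k,t) = \Theta(k^{3/2+\epsilon'})$; (b) if $t = \Theta(k^{\epsilon'})$ with $\epsilon' > 1/4$, then $f(k,t) = \Theta(k^{1+2\epsilon'})$; 3. if $t = \Theta(k)$, then $f(k,t) = \Theta(k^3)$.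
   Context: $[n]=\{1,2,\ldots,n\}$ and $\binom{[n]}{k}$ denotes the family of all $k$-element subsets of $[n]$. A family $\mathcal{F}$ of subsets of $[n]$ is $t$-intersecting ($t$ a positive integer) if $|F \cap G| \geq t$ for all $F, G \in \mathcal{F}$. For a family $\mathcal{F}$, $\mathcal{I}(\mathcal{F}) = \{F \cap G : F, G \in \mathcal{F},\ F \neq G\}$ is the collection of all distinct pairwise intersections of distinct members of $\mathcal{F}$. For non-negative functions $g,h$: $g=\mathcal{O}(h)$ means $g \le c\,h$ for some positive constant $c$; $g=o(h)$ means $g/h \to 0$; $g=\Theta(h)$ means $g=\mathcal{O}(h)$ and $h=\mathcal{O}(g)$. *)

theory Defs
  imports Complex_Main "HOL-Library.Ramsey" "HOL-Library.Landau_Symbols"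
begin

text \<open>The pair \<open>F = G\<close> is not excluded, so every member has at least \<open>t\<close> elements.\<close>

definition t_intersecting :: "nat \<Rightarrow> 'a set set \<Rightarrow> bool" where
  "t_intersecting t \<F> \<longleftrightarrow> (\<forall>F\<in>\<F>. \<forall>G\<in>\<F>. t \<le> card (F \<inter> G))"

definition distinct_intersections :: "'a set set \<Rightarrow> 'a set set" where
  "distinct_intersections \<F> = {F \<inter> G | F G. F \<in> \<F> \<and> G \<in> \<F> \<and> F \<noteq> G}"

definition frankl_family :: "nat \<Rightarrow> nat \<Rightarrow> nat \<Rightarrow> nat set set" where
  "frankl_family n k t = {A \<in> nsets {1..n} k. t + 1 \<le> card (A \<inter> {1..t + 2})}"

end

theory Submission imports Defs begin

text \<open>Write \<open>v = n / k\<close>, \<open>m = k - t - 1\<close>; the proof works whenever \<open>v\<close> exceeds a large constant times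
  both \<open>sqrt k\<close> and \<open>t\<^sup>2\<close>. Two families that are spread at scale \<open>c * sqrt k\<close> contain disjoint
  members (two rounds of the minimal-fragment argument), so up to a negligible remainder every
  member of \<open>\<F>\<close> contains a member of a \<open>t\<close>-intersecting family \<open>S\<close> of sets of size at most
  \<open>q\<close>, a small multiple of \<open>v\<close>. Peeling \<open>S\<close> from the top leaves a \<open>t\<close>-intersecting family
  \<open>T\<close> of sets of size \<open>t\<close> or \<open>t + 1\<close>; the intersections that involve a peeled layer or the
  remainder number at most a small fraction of \<open>(t + 2 choose 2) * (n choose m)\<close>. If all members
  of \<open>T\<close> share \<open>t\<close> points, all other intersections contain these points, and there are only
  about \<open>n choose m\<close> of them. Otherwise the members of \<open>T\<close> are \<open>(t + 1)\<close>-subsets of a set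
  \<open>Y\<close> of size \<open>t + 2\<close>, and \<open>\<F>\<close> is compared with the Frankl family on \<open>Y\<close>: each member \<open>G\<close>
  of \<open>\<F>\<close> outside that family destroys, for every \<open>m\<close>-set \<open>P\<close> disjoint from \<open>G\<close>, all but one of
  the intersections \<open>P \<union> T'\<close> with \<open>T'\<close> a \<open>t\<close>-subset of \<open>Y\<close>. If a fraction \<open>d\<close> of all
  \<open>m\<close>-sets arises in this way, the outside members have density at most \<open>d ^ M\<close> with \<open>M\<close> of
  order \<open>v\<close>, so they gain less than they destroy.\<close>

section \<open>Spread families contain disjoint members\<close>

text \<open>Each half of the hypothesis on \<open>v\<close> answers an obstacle. At a constant scale
  \<open>y\<close>, shrinking fragments of \<open>k\<close>-sets to nothing would take about
  \<open>log k\<close> rounds; once \<open>k * y^2\<close> is small, the fragments of size about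
  \<open>k * y\<close> die in the second round, and with \<open>y\<close> of order
  \<open>1 / v\<close> this is the condition on \<open>sqrt k\<close>. The condition on
  \<open>t^2\<close> comes from peeling: up to constants, layer \<open>d\<close> costs
  \<open>(t^2 + d)^d\<close> and gains only \<open>v^(d - 1)\<close>, so \<open>v\<close> must
  dominate both \<open>t^2\<close> and the largest \<open>d\<close>, which keeps \<open>q\<close>
  below a small multiple of \<open>v\<close>. In the other direction, \<open>q\<close> must have
  order \<open>v\<close> for \<open>2^q\<close> to beat the powers of \<open>n\<close> with exponent
  of order \<open>t\<close> that the crude counts lose. The peeling error is a fixed fraction of the
  main term, so it cannot settle the case of a family that differs little from the Frankl family.
  There the outside members are weighed directly against the intersections that they themselves
  destroy. Since \<open>f\<close> may be any valid bound, its order of growth is adjusted by adding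
  terms to the sufficient condition.\<close>

lemma sum_Pow_weight:
  fixes a b :: real
  assumes "finite X"
  shows "(\<Sum>W\<in>Pow X. a ^ card W * b ^ card (X - W)) = (a + b) ^ card X"
proof -
  have "(\<Prod>x\<in>X. a + b) = (\<Sum>W\<in>Pow X. (\<Prod>x\<in>W. a) * (\<Prod>x\<in>X - W. b))"
    by (rule prod_add[OF assms])
  thus ?thesis by simp
qed

lemma sum_subsets_card:
  fixes r :: real
  assumes "finite H" "card H \<le> w" "r \<ge> 0"
  shows "(\<Sum>T | T \<subseteq> H \<and> l0 < card T. r ^ card T) \<le> (\<Sum>l\<in>{l0<..w}. real (w choose l) * r ^ l)"
proof -
  have fin: "finite {T. T \<subseteq> H \<and> l0 < card T}"
    using assms(1) by (auto intro: finite_subset[of _ "Pow H"])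
  have "(\<Sum>T | T \<subseteq> H \<and> l0 < card T. r ^ card T)
      = (\<Sum>l\<in>{l0<..w}. \<Sum>T\<in>{T. T \<in> {T. T \<subseteq> H \<and> l0 < card T} \<and> card T = l}. r ^ card T)"
    using fin assms(1,2) by (intro sum.group[symmetric]) (auto dest: card_mono)
  also have "\<dots> \<le> (\<Sum>l\<in>{l0<..w}. real (w choose l) * r ^ l)"
  proof (rule sum_mono)
    fix l assume l: "l \<in> {l0<..w}"
    have "(\<Sum>T\<in>{T. T \<in> {T. T \<subseteq> H \<and> l0 < card T} \<and> card T = l}. r ^ card T)
        = (\<Sum>T\<in>{T. T \<subseteq> H \<and> card T = l}. r ^ l)"
      using l by (intro sum.cong) auto
    also have "\<dots> = real (card H choose l) * r ^ l"
      using n_subsets[OF assms(1)] by simp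
    also have "\<dots> \<le> real (w choose l) * r ^ l"
      using assms(2,3) by (intro mult_right_mono) (auto intro: binomial_right_mono)
    finally show "(\<Sum>T\<in>{T. T \<in> {T. T \<subseteq> H \<and> l0 < card T} \<and> card T = l}. r ^ card T)
       \<le> real (w choose l) * r ^ l" .
  qed
  finally show ?thesis .
qed

text \<open>\<open>a\<close> and \<open>b\<close> are unnormalised odds for a point to lie in
  \<open>W\<close> or outside it, and \<open>\<chi> W i\<close> is a smallest \<open>h j - W\<close>
  among the \<open>j\<close> with \<open>h j \<subseteq> W \<union> h i\<close>. Large fragments are
  rare by double counting: a fragment \<open>T\<close> lies in at most \<open>K * y ^ card T\<close>
  of the \<open>h i\<close>; reading the weight at \<open>Z = W \<union> T\<close> instead of
  \<open>W\<close> costs \<open>(b / a) ^ card T\<close>; and given \<open>Z\<close>, all possible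
  \<open>T\<close> are subsets of one set of size at most \<open>w\<close>. Members are indexed
  because distinct members may share a fragment when the bound is applied a second time.\<close>

lemma fragment_bound:
  fixes h :: "'i \<Rightarrow> 'a set" and a b y K :: real
  assumes fX: "finite X" and fO: "finite \<Omega>"
    and h: "\<And>i. i \<in> \<Omega> \<Longrightarrow> h i \<subseteq> X" "\<And>i. i \<in> \<Omega> \<Longrightarrow> card (h i) \<le> w"
    and spread: "\<And>C. C \<subseteq> X \<Longrightarrow> real (card {i \<in> \<Omega>. C \<subseteq> h i}) \<le> K * y ^ card C"
    and pos: "0 < a" "0 < b" "0 \<le> y" "0 \<le> K"
  obtains \<chi> :: "'a set \<Rightarrow> 'i \<Rightarrow> 'a set" where
    "\<And>W i. i \<in> \<Omega> \<Longrightarrow> \<chi> W i \<subseteq> h i - W"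
    "\<And>W i. i \<in> \<Omega> \<Longrightarrow> \<exists>j\<in>\<Omega>. h j - W = \<chi> W i"
    "(\<Sum>W\<in>Pow X. a ^ card W * b ^ card (X - W) * real (card {i \<in> \<Omega>. l0 < card (\<chi> W i)}))
       \<le> K * (a + b) ^ card X * (\<Sum>l\<in>{l0<..w}. real (w choose l) * (y * (b / a)) ^ l)"
proof -
  define good where "good = (\<lambda>W i j. j \<in> \<Omega> \<and> h j \<subseteq> W \<union> h i)"
  define jj where "jj = (\<lambda>W i. SOME j. good W i j \<and> (\<forall>j'. good W i j' \<longrightarrow> card (h j - W) \<le> card (h j' - W)))"
  define \<chi> where "\<chi> = (\<lambda>W i. h (jj W i) - W)"
  have jj: "good W i (jj W i)" "\<And>j'. good W i j' \<Longrightarrow> card (h (jj W i) - W) \<le> card (h j' - W)"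
    if "i \<in> \<Omega>" for W i
  proof -
    have "good W i i" using that by (auto simp: good_def)
    hence "\<exists>j. good W i j \<and> (\<forall>j'. good W i j' \<longrightarrow> card (h j - W) \<le> card (h j' - W))"
      using ex_has_least_nat[of "good W i" i "\<lambda>j. card (h j - W)"] by blast
    hence "good W i (jj W i) \<and> (\<forall>j'. good W i j' \<longrightarrow> card (h (jj W i) - W) \<le> card (h j' - W))"
      unfolding jj_def by (rule someI_ex)
    thus "good W i (jj W i)" "\<And>j'. good W i j' \<Longrightarrow> card (h (jj W i) - W) \<le> card (h j' - W)" by auto
  qed
  have chi1: "\<chi> W i \<subseteq> h i - W" if "i \<in> \<Omega>" for W i
    using jj(1)[OF that, of W] by (auto simp: good_def \<chi>_def)
  have chi2: "\<exists>j\<in>\<Omega>. h j - W = \<chi> W i" if "i \<in> \<Omega>" for W i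
    using jj(1)[OF that, of W] by (auto simp: good_def \<chi>_def)
  define wt where "wt = (\<lambda>W. a ^ card W * b ^ card (X - W))"
  have wte: "a ^ card W * b ^ card (X - W) = wt W" for W by (simp add: wt_def)
  have wt0: "0 \<le> wt W" for W using pos by (simp add: wt_def)
  define r where "r = y * (b / a)"
  have r0: "r \<ge> 0" using pos by (simp add: r_def)
  define Fr where "Fr = (\<lambda>W. {T \<in> \<chi> W ` \<Omega>. l0 < card T})"
  have finFr: "finite (Fr W)" for W using fO by (simp add: Fr_def)
  have FrX: "T \<subseteq> X - W" if "T \<in> Fr W" for T W
    using that chi1 h(1) by (fastforce simp: Fr_def)
  have step1: "real (card {i \<in> \<Omega>. l0 < card (\<chi> W i)}) \<le> (\<Sum>T\<in>Fr W. K * y ^ card T)" for W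
  proof -
    have sub: "{i \<in> \<Omega>. l0 < card (\<chi> W i)} \<subseteq> (\<Union>T\<in>Fr W. {i \<in> \<Omega>. T \<subseteq> h i})"
      using chi1 by (fastforce simp: Fr_def)
    have "card {i \<in> \<Omega>. l0 < card (\<chi> W i)} \<le> card (\<Union>T\<in>Fr W. {i \<in> \<Omega>. T \<subseteq> h i})"
      using sub fO finFr by (intro card_mono) auto
    also have "\<dots> \<le> (\<Sum>T\<in>Fr W. card {i \<in> \<Omega>. T \<subseteq> h i})"
      by (rule card_UN_le[OF finFr])
    finally have "real (card {i \<in> \<Omega>. l0 < card (\<chi> W i)}) \<le> (\<Sum>T\<in>Fr W. real (card {i \<in> \<Omega>. T \<subseteq> h i}))"
      using of_nat_mono by fastforce
    also have "\<dots> \<le> (\<Sum>T\<in>Fr W. K * y ^ card T)"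
      using spread FrX by (intro sum_mono) blast
    finally show ?thesis .
  qed
  \<comment> \<open>The set \<open>g Z\<close> depends on \<open>Z\<close> alone. The default
    \<open>{}\<close> contributes nothing, having no subset with more than \<open>l0\<close>
    elements.\<close>
  define g where "g = (\<lambda>Z. if \<exists>j\<in>\<Omega>. h j \<subseteq> Z then h (SOME j. j \<in> \<Omega> \<and> h j \<subseteq> Z) else {})"
  have gfin: "finite (g Z) \<and> card (g Z) \<le> w" for Z
  proof (cases "\<exists>j\<in>\<Omega>. h j \<subseteq> Z")
    case True
    hence "(SOME j. j \<in> \<Omega> \<and> h j \<subseteq> Z) \<in> \<Omega>" using someI_ex[of "\<lambda>j. j \<in> \<Omega> \<and> h j \<subseteq> Z"] by blast
    thus ?thesis using True h fX by (auto simp: g_def intro: finite_subset)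
  qed (simp add: g_def)
  \<comment> \<open>A minimal fragment can be recovered from \<open>W \<union> T\<close>: it lies in any member inside that set.\<close>
  have key: "T \<subseteq> g (W \<union> T)" if T: "T \<in> Fr W" for W T
  proof -
    obtain i where i: "i \<in> \<Omega>" "T = \<chi> W i" using T by (auto simp: Fr_def)
    obtain j0 where j0: "j0 \<in> \<Omega>" "h j0 - W = T" using chi2[OF i(1)] i(2) by auto
    have ex: "\<exists>j\<in>\<Omega>. h j \<subseteq> W \<union> T" using j0 by blast
    define j where "j = (SOME j. j \<in> \<Omega> \<and> h j \<subseteq> W \<union> T)"
    have j: "j \<in> \<Omega>" "h j \<subseteq> W \<union> T" using someI_ex[of "\<lambda>j. j \<in> \<Omega> \<and> h j \<subseteq> W \<union> T"] ex
      unfolding j_def by blast+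
    have "good W i j" using j chi1[OF i(1), of W] i(2) by (auto simp: good_def)
    hence le: "card T \<le> card (h j - W)" using jj(2)[OF i(1), of W j] i(2) by (simp add: \<chi>_def)
    have "h j - W \<subseteq> T" using j by blast
    moreover have "finite T" using FrX[OF T] fX by (meson finite_Diff finite_subset)
    ultimately have "h j - W = T" using le by (metis card_seteq)
    moreover have "g (W \<union> T) = h j" using ex by (simp add: g_def j_def)
    ultimately show ?thesis by blast
  qed
  have inj: "inj_on (\<lambda>(W, T). (W \<union> T, T)) (Sigma (Pow X) Fr)"
  proof (rule inj_onI)
    fix p q
    assume A: "p \<in> Sigma (Pow X) Fr" "q \<in> Sigma (Pow X) Fr"
      "(\<lambda>(W, T). (W \<union> T, T)) p = (\<lambda>(W, T). (W \<union> T, T)) q"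
    obtain W T W' T' where pq: "p = (W, T)" "q = (W', T')" by (cases p, cases q) auto
    have "W \<inter> T = {}" "W' \<inter> T' = {}" using FrX A(1,2) pq by blast+
    thus "p = q" using A(3) pq by auto
  qed
  have "(\<Sum>W\<in>Pow X. a ^ card W * b ^ card (X - W) * real (card {i \<in> \<Omega>. l0 < card (\<chi> W i)}))
      \<le> (\<Sum>W\<in>Pow X. wt W * (\<Sum>T\<in>Fr W. K * y ^ card T))"
    unfolding wte by (intro sum_mono mult_left_mono[OF step1 wt0])
  also have "\<dots> = (\<Sum>(W,T)\<in>Sigma (Pow X) Fr. wt W * (K * y ^ card T))"
    using fX finFr by (simp add: sum_distrib_left sum.Sigma)
  also have "\<dots> = (\<Sum>(W,T)\<in>Sigma (Pow X) Fr. wt (W \<union> T) * (K * r ^ card T))"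
  proof (rule sum.cong[OF refl], clarify)
    fix W T assume WT: "W \<subseteq> X" "T \<in> Fr W"
    have TX: "T \<subseteq> X - W" using FrX WT by blast
    have fT: "finite T" "finite W" using TX WT fX by (meson finite_Diff finite_subset)+
    have c1: "card (W \<union> T) = card W + card T" using fT TX by (intro card_Un_disjoint) auto
    have "X - W = (X - (W \<union> T)) \<union> T" using TX by blast
    hence c2: "card (X - W) = card (X - (W \<union> T)) + card T"
      using fT fX card_Un_disjoint[of "X - (W \<union> T)" T] by auto
    show "wt W * (K * y ^ card T) = wt (W \<union> T) * (K * r ^ card T)"
      using pos unfolding wt_def c1 c2 r_def power_add power_mult_distrib power_divide by simp
  qed
  also have "\<dots> = (\<Sum>(Z,T)\<in>(\<lambda>(W,T). (W \<union> T, T)) ` Sigma (Pow X) Fr. wt Z * (K * r ^ card T))"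
    by (subst sum.reindex[OF inj]) (auto simp: case_prod_unfold)
  also have "\<dots> \<le> (\<Sum>(Z,T)\<in>Sigma (Pow X) (\<lambda>Z. {T. T \<subseteq> g Z \<and> l0 < card T}). wt Z * (K * r ^ card T))"
  proof (rule sum_mono2)
    show "finite (Sigma (Pow X) (\<lambda>Z. {T. T \<subseteq> g Z \<and> l0 < card T}))"
      using fX gfin by (intro finite_SigmaI) (auto intro: finite_subset[OF _ finite_Pow_iff[THEN iffD2]])
    show "(\<lambda>(W,T). (W \<union> T, T)) ` Sigma (Pow X) Fr \<subseteq> Sigma (Pow X) (\<lambda>Z. {T. T \<subseteq> g Z \<and> l0 < card T})"
    proof (rule image_subsetI)
      fix p assume "p \<in> Sigma (Pow X) Fr"
      then obtain W T where WT: "p = (W, T)" "W \<subseteq> X" "T \<in> Fr W" by auto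
      have "l0 < card T" using WT by (simp add: Fr_def)
      thus "(\<lambda>(W,T). (W \<union> T, T)) p \<in> Sigma (Pow X) (\<lambda>Z. {T. T \<subseteq> g Z \<and> l0 < card T})"
        using WT FrX[OF WT(3)] key[OF WT(3)] by auto
    qed
  qed (use wt0 pos r0 in auto)
  also have "\<dots> = (\<Sum>Z\<in>Pow X. wt Z * K * (\<Sum>T | T \<subseteq> g Z \<and> l0 < card T. r ^ card T))"
    using fX gfin by (subst sum.Sigma[symmetric])
      (auto simp: sum_distrib_left mult.assoc intro: finite_subset[OF _ finite_Pow_iff[THEN iffD2]])
  also have "\<dots> \<le> (\<Sum>Z\<in>Pow X. wt Z * K * (\<Sum>l\<in>{l0<..w}. real (w choose l) * r ^ l))"
    using gfin r0 wt0 pos by (intro sum_mono mult_left_mono sum_subsets_card) auto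
  also have "\<dots> = K * (a + b) ^ card X * (\<Sum>l\<in>{l0<..w}. real (w choose l) * r ^ l)"
    unfolding sum_distrib_right[symmetric] wt_def sum_Pow_weight[OF fX] by simp
  finally show ?thesis using that[of \<chi>] chi1 chi2 unfolding r_def by blast
qed

section \<open>Exponential bounds for binomial sums\<close>

lemma exp_le_one_plus_double:
  fixes x :: real
  assumes "0 \<le> x" "x \<le> 1"
  shows "exp x \<le> 1 + 2 * x"
proof -
  have "x\<^sup>2 \<le> x" using assms by (simp add: power2_eq_square mult_left_le)
  thus ?thesis using exp_bound[OF assms] by simp
qed

lemma one_plus_power_le_exp:
  fixes x :: real
  assumes "0 \<le> x"
  shows "(1 + x) ^ n \<le> exp (x * real n)"
proof -
  have "(1 + x) ^ n \<le> exp x ^ n" using assms by (intro power_mono) auto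
  thus ?thesis by (metis exp_of_nat_mult mult.commute)
qed

lemma binomial_sum_power:
  fixes r :: real
  shows "(\<Sum>l\<le>w. real (w choose l) * r ^ l) = (1 + r) ^ w"
  using binomial_ring[of r 1 w] by (simp add: add.commute)

text \<open>Exponential-moment argument: for \<open>l > l0\<close> the factor
  \<open>exp (l - l0) \<le> 3 ^ l * exp (- l0)\<close> is at least 1, and inserting it turns the
  tail into a full binomial sum at \<open>3 * r\<close>.\<close>

lemma binomial_tail_exp:
  fixes r :: real
  assumes "0 \<le> r"
  shows "(\<Sum>l\<in>{l0<..w}. real (w choose l) * r ^ l) \<le> exp (3 * r * real w - real l0)"
proof -
  have "(\<Sum>l\<in>{l0<..w}. real (w choose l) * r ^ l)
      \<le> (\<Sum>l\<in>{l0<..w}. exp (- real l0) * (real (w choose l) * (3 * r) ^ l))"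
  proof (rule sum_mono)
    fix l assume l: "l \<in> {l0<..w}"
    have "exp (real l0) \<le> exp (real l)" using l by simp
    also have "\<dots> = exp 1 ^ l" by (simp add: exp_of_nat_mult[symmetric])
    also have "\<dots> \<le> 3 ^ l" by (intro power_mono exp_le) auto
    finally have "1 \<le> exp (- real l0) * 3 ^ l" by (simp add: exp_minus field_simps)
    hence "real (w choose l) * r ^ l * 1 \<le> real (w choose l) * r ^ l * (exp (- real l0) * 3 ^ l)"
      using assms by (intro mult_left_mono) auto
    thus "real (w choose l) * r ^ l \<le> exp (- real l0) * (real (w choose l) * (3 * r) ^ l)"
      by (simp add: power_mult_distrib mult_ac)
  qed
  also have "\<dots> \<le> exp (- real l0) * (\<Sum>l\<le>w. real (w choose l) * (3 * r) ^ l)"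
    unfolding sum_distrib_left[symmetric] using assms
    by (intro mult_left_mono sum_mono2) auto
  also have "\<dots> = exp (- real l0) * (1 + 3 * r) ^ w" by (simp only: binomial_sum_power)
  also have "\<dots> \<le> exp (- real l0) * exp (3 * r * real w)"
    using assms by (intro mult_left_mono one_plus_power_le_exp) auto
  also have "\<dots> = exp (3 * r * real w - real l0)" by (simp add: exp_add[symmetric])
  finally show ?thesis .
qed

lemma binomial_positive_part_exp:
  fixes r :: real
  assumes "0 \<le> r"
  shows "(\<Sum>l\<in>{0<..w}. real (w choose l) * r ^ l) \<le> exp (r * real w) - 1"
proof -
  have "{..w} = insert 0 {0<..w}" by auto
  hence "(\<Sum>l\<le>w. real (w choose l) * r ^ l) = 1 + (\<Sum>l\<in>{0<..w}. real (w choose l) * r ^ l)" by simp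
  thus ?thesis using one_plus_power_le_exp[OF assms, of w] by (simp add: binomial_sum_power)
qed

text \<open>Two rounds of exposure: each element is put into the first round with probability 1/4 and,
  failing that, into the second with probability 1/3. The first round shrinks the members to
  fragments of size at most \<open>w1\<close>, of order \<open>k y\<close>; the second leaves an empty fragment.\<close>

lemma spread_random:
  fixes y :: real and P :: "'a set set"
  assumes fX: "finite X" and P: "P \<subseteq> Pow X" "P \<noteq> {}" and k: "\<And>F. F \<in> P \<Longrightarrow> card F \<le> k"
    and spread: "\<And>C. C \<subseteq> X \<Longrightarrow> real (card {F \<in> P. C \<subseteq> F}) \<le> real (card P) * y ^ card C"
    and y: "0 \<le> y" "y \<le> 1/1000" "real k * y\<^sup>2 \<le> 1/10000"
  shows "2 * card {W \<in> Pow X. \<forall>F\<in>P. \<not> F \<subseteq> W} < 2 ^ card X"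
proof -
  have fP: "finite P" using P fX finite_subset by blast
  have cP: "card P > 0" using fP P by (simp add: card_gt_0_iff)
  define K where "K = real (card P)"
  have K0: "K > 0" using cP by (simp add: K_def)
  \<comment> \<open>The first round has odds \<open>3 : 1\<close>, so the tail bound has exponent
    \<open>3 * (3 * y) * k - w1\<close>. The extra 2 makes it at most \<open>-2\<close>, whence
    \<open>B1 \<le> 1 / 3\<close>.\<close>
  define w1 where "w1 = nat \<lceil>9 * y * real k\<rceil> + 2"
  have w1: "9 * y * real k + 2 \<le> real w1" "real w1 \<le> 9 * y * real k + 3"
    using y unfolding w1_def by (auto simp: of_nat_nat) linarith+
  have h1: "id F \<subseteq> X" "card (id F) \<le> k" if "F \<in> P" for F using that P k by auto
  have h2: "real (card {F \<in> P. C \<subseteq> id F}) \<le> K * y ^ card C" if "C \<subseteq> X" for C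
    using spread[OF that] by (simp add: K_def)
  obtain c1 where c1: "\<And>W F. F \<in> P \<Longrightarrow> c1 W F \<subseteq> id F - W"
    "\<And>W F. F \<in> P \<Longrightarrow> \<exists>G\<in>P. id G - W = c1 W F"
    "(\<Sum>W\<in>Pow X. 1 ^ card W * 3 ^ card (X - W) * real (card {F \<in> P. w1 < card (c1 W F)}))
       \<le> K * (1 + 3) ^ card X * (\<Sum>l\<in>{w1<..k}. real (k choose l) * (y * (3 / 1)) ^ l)"
    by (rule fragment_bound[where a = 1 and b = 3 and ?l0.0 = w1 and K = K and y = y, OF fX fP h1 h2 zero_less_one zero_less_numeral y(1) less_imp_le[OF K0]])
      (assumption+, rule that, assumption+)
  define G where "G = (\<lambda>W. {F \<in> P. card (c1 W F) \<le> w1})"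
  define good2 where "good2 = (\<lambda>W c2. (\<forall>V. \<forall>F\<in>G W. \<exists>F'\<in>G W. c1 W F' - V = c2 V F) \<and>
    (\<Sum>V\<in>Pow (X - W). 1 ^ card V * 2 ^ card (X - W - V) * real (card {F \<in> G W. 0 < card (c2 V F)}))
       \<le> K * (1 + 2) ^ card (X - W) * (\<Sum>l\<in>{0<..w1}. real (w1 choose l) * (y * (2 / 1)) ^ l))"
  have "\<exists>c2. good2 W c2" for W
  proof -
    \<comment> \<open>Fragments lie inside their members, so the spread bound of \<open>P\<close>
      passes to them. The normalisation stays \<open>K = card P\<close>, however few members survive
      in \<open>G W\<close>.\<close>
    have sp: "real (card {F \<in> G W. C \<subseteq> c1 W F}) \<le> K * y ^ card C" if "C \<subseteq> X - W" for C
    proof -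
      have "card {F \<in> G W. C \<subseteq> c1 W F} \<le> card {F \<in> P. C \<subseteq> F}"
        using c1(1) fP by (intro card_mono) (fastforce simp: G_def)+
      thus ?thesis using spread[of C] that unfolding K_def by force
    qed
    have sub: "c1 W F \<subseteq> X - W" if "F \<in> G W" for F using that c1(1)[of F W] P by (auto simp: G_def)
    have f: "finite (X - W)" "finite (G W)" using fX fP by (auto simp: G_def)
    have cd: "card (c1 W F) \<le> w1" if "F \<in> G W" for F using that by (simp add: G_def)
    obtain c2 where "\<And>V F. F \<in> G W \<Longrightarrow> \<exists>F'\<in>G W. c1 W F' - V = c2 V F"
      "(\<Sum>V\<in>Pow (X - W). 1 ^ card V * 2 ^ card (X - W - V) * real (card {F \<in> G W. 0 < card (c2 V F)}))
       \<le> K * (1 + 2) ^ card (X - W) * (\<Sum>l\<in>{0<..w1}. real (w1 choose l) * (y * (2 / 1)) ^ l)"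
      by (rule fragment_bound[where a = 1 and b = 2 and ?l0.0 = 0 and K = K and y = y, OF f sub cd sp zero_less_one zero_less_numeral y(1) less_imp_le[OF K0]])
        (assumption+, rule that, assumption+)
    thus ?thesis unfolding good2_def by blast
  qed
  then obtain c2' where "\<And>W. good2 W (c2' W)" by metis
  then obtain c2 where c2: "\<And>W V F. F \<in> G W \<Longrightarrow> \<exists>F'\<in>G W. c1 W F' - V = c2 W V F"
    "\<And>W. (\<Sum>V\<in>Pow (X - W). 1 ^ card V * 2 ^ card (X - W - V) * real (card {F \<in> G W. 0 < card (c2 W V F)}))
       \<le> K * (1 + 2) ^ card (X - W) * (\<Sum>l\<in>{0<..w1}. real (w1 choose l) * (y * (2 / 1)) ^ l)"
    unfolding good2_def by blast
  define B1 where "B1 = (\<Sum>l\<in>{w1<..k}. real (k choose l) * (y * (3 / 1)) ^ l)"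
  define B2 where "B2 = (\<Sum>l\<in>{0<..w1}. real (w1 choose l) * (y * (2 / 1)) ^ l)"
  have "B1 \<le> exp (3 * (y * (3/1)) * real k - real w1)"
    unfolding B1_def using y by (intro binomial_tail_exp) auto
  also have "\<dots> \<le> exp (- 2)" using w1 by simp
  also have "\<dots> \<le> 1 / 3"
    using exp_ge_add_one_self[of 2] by (simp add: exp_minus field_simps)
  finally have B1: "B1 \<le> 1 / 3" .
  \<comment> \<open>Here the smallness of \<open>k * y^2\<close> enters: the expected number of
    subfragments is governed by \<open>y * w1\<close>, which is about
    \<open>9 * k * y^2\<close>.\<close>
  have z: "y * (2/1) * real w1 \<le> 1/100"
  proof -
    have "y * real w1 \<le> y * (9 * y * real k + 3)" using w1 y by (intro mult_left_mono) auto
    also have "\<dots> = 9 * (real k * y\<^sup>2) + 3 * y" by (simp add: power2_eq_square algebra_simps)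
    finally show ?thesis using y by simp
  qed
  have "B2 \<le> exp (y * (2/1) * real w1) - 1"
    unfolding B2_def using y by (intro binomial_positive_part_exp) auto
  also have "\<dots> \<le> 1 / 50" using exp_le_one_plus_double[of "y * (2/1) * real w1"] z y by simp
  finally have B2: "B2 \<le> 1 / 50" .
  define fail where "fail = (\<lambda>W. if \<forall>F\<in>P. \<not> F \<subseteq> W then 1 else 0 :: real)"
  \<comment> \<open>A second-round fragment equals \<open>F'' - (W \<union> V)\<close> for some
    member \<open>F''\<close>. If no member fits into \<open>W \<union> V\<close>, it is nonempty,
    so each of the \<open>K\<close> members fails in the first or in the second round.\<close>
  have fail_le: "K * fail (W \<union> V) \<le> real (card {F \<in> P. w1 < card (c1 W F)}) + real (card {F \<in> G W. 0 < card (c2 W V F)})"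
    if WV: "W \<subseteq> X" "V \<subseteq> X - W" for W V
  proof (cases "\<forall>F\<in>P. \<not> F \<subseteq> W \<union> V")
    case True
    have "P \<subseteq> {F \<in> P. w1 < card (c1 W F)} \<union> {F \<in> G W. 0 < card (c2 W V F)}"
    proof
      fix F assume F: "F \<in> P"
      show "F \<in> {F \<in> P. w1 < card (c1 W F)} \<union> {F \<in> G W. 0 < card (c2 W V F)}"
      proof (cases "F \<in> G W")
        case FG: True
        obtain F' where F': "F' \<in> G W" "c1 W F' - V = c2 W V F" using c2(1)[OF FG] by blast
        obtain F'' where F'': "F'' \<in> P" "F'' - W = c1 W F'" using c1(2)[of F' W] F' by (auto simp: G_def)
        have "c2 W V F = F'' - (W \<union> V)" using F' F'' by auto
        moreover have "finite F''" using F'' P fX finite_subset by blast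
        ultimately have "0 < card (c2 W V F)" using True F'' by (auto simp: card_gt_0_iff)
        thus ?thesis using FG by auto
      qed (use F in \<open>auto simp: G_def\<close>)
    qed
    hence "card P \<le> card ({F \<in> P. w1 < card (c1 W F)} \<union> {F \<in> G W. 0 < card (c2 W V F)})"
      using fP by (intro card_mono) (auto simp: G_def)
    also have "\<dots> \<le> card {F \<in> P. w1 < card (c1 W F)} + card {F \<in> G W. 0 < card (c2 W V F)}"
      by (rule card_Un_le)
    finally show ?thesis using True by (simp add: fail_def K_def)
  next
    case False
    hence "fail (W \<union> V) = 0" unfolding fail_def by (rule if_not_P)
    thus ?thesis by simp
  qed
  \<comment> \<open>Relative to the total mass \<open>4 ^ card X\<close>, a point is in
    \<open>W\<close>, in \<open>V\<close> or in neither with probability 1/4, 1/4, 1/2. Hence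
    \<open>W \<union> V\<close> is a uniform subset: each \<open>Z\<close> splits in
    \<open>2 ^ card Z\<close> ways and carries the weight \<open>2 ^ card (X - Z)\<close>.\<close>
  have "K * (2 ^ card X * real (card {W \<in> Pow X. \<forall>F\<in>P. \<not> F \<subseteq> W}))
      = K * (2 ^ card X * (\<Sum>W\<in>Pow X. fail W))"
    using fX by (simp add: fail_def sum.If_cases Int_def)
  also have "\<dots> = K * (\<Sum>Z\<in>Pow X. \<Sum>W\<in>Pow Z. 2 ^ card (X - Z) * fail Z)"
  proof -
    have eq: "2 ^ card X * fail Z = (\<Sum>W\<in>Pow Z. 2 ^ card (X - Z) * fail Z)" if "Z \<in> Pow X" for Z
    proof -
      have "finite Z" using that fX finite_subset by auto
      moreover have "card X = card Z + card (X - Z)"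
        using that fX \<open>finite Z\<close> by (simp add: card_Diff_subset card_mono)
      ultimately show ?thesis by (simp add: card_Pow power_add)
    qed
    have "2 ^ card X * (\<Sum>W\<in>Pow X. fail W) = (\<Sum>Z\<in>Pow X. \<Sum>W\<in>Pow Z. 2 ^ card (X - Z) * fail Z)"
      unfolding sum_distrib_left[of _ fail] by (rule sum.cong[OF refl eq])
    thus ?thesis by (rule arg_cong)
  qed
  also have "\<dots> = K * (\<Sum>(Z,W)\<in>Sigma (Pow X) Pow. 2 ^ card (X - Z) * fail Z)"
    using fX by (subst sum.Sigma) (auto intro: finite_subset)
  also have "\<dots> = K * (\<Sum>(W,V)\<in>Sigma (Pow X) (\<lambda>W. Pow (X - W)). 2 ^ card (X - W - V) * fail (W \<union> V))"
  proof -
    have e1: "X - W - (Z - W) = X - Z" and e2: "W \<union> (Z - W) = Z" if "W \<subseteq> Z" for Z W :: "'a set"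
      using that by auto
    have "(\<Sum>(Z,W)\<in>Sigma (Pow X) Pow. 2 ^ card (X - Z) * fail Z)
      = (\<Sum>(W,V)\<in>Sigma (Pow X) (\<lambda>W. Pow (X - W)). 2 ^ card (X - W - V) * fail (W \<union> V))"
      by (rule sum.reindex_bij_witness[of _ "\<lambda>(W,V). (W \<union> V, W)" "\<lambda>(Z,W). (W, Z - W)"])
        (auto simp: e1 e2 Un_absorb1)
    thus ?thesis by simp
  qed
  also have "\<dots> = (\<Sum>W\<in>Pow X. \<Sum>V\<in>Pow (X - W). 2 ^ card (X - W - V) * (K * fail (W \<union> V)))"
    using fX by (subst sum.Sigma) (auto simp: sum_distrib_left intro: finite_subset intro!: sum.cong)
  also have "\<dots> \<le> (\<Sum>W\<in>Pow X. \<Sum>V\<in>Pow (X - W). 2 ^ card (X - W - V) *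
      (real (card {F \<in> P. w1 < card (c1 W F)}) + real (card {F \<in> G W. 0 < card (c2 W V F)})))"
    using fail_le by (intro sum_mono mult_left_mono) auto
  also have "\<dots> = (\<Sum>W\<in>Pow X. 3 ^ card (X - W) * real (card {F \<in> P. w1 < card (c1 W F)}) +
      (\<Sum>V\<in>Pow (X - W). 2 ^ card (X - W - V) * real (card {F \<in> G W. 0 < card (c2 W V F)})))"
  proof (rule sum.cong[OF refl])
    fix W assume "W \<in> Pow X"
    have "(\<Sum>V\<in>Pow (X - W). 2 ^ card (X - W - V)) = (3 :: real) ^ card (X - W)"
      using sum_Pow_weight[of "X - W" 1 2] fX by simp
    thus "(\<Sum>V\<in>Pow (X - W). 2 ^ card (X - W - V) *
      (real (card {F \<in> P. w1 < card (c1 W F)}) + real (card {F \<in> G W. 0 < card (c2 W V F)})))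
      = 3 ^ card (X - W) * real (card {F \<in> P. w1 < card (c1 W F)}) +
      (\<Sum>V\<in>Pow (X - W). 2 ^ card (X - W - V) * real (card {F \<in> G W. 0 < card (c2 W V F)}))"
      by (simp add: distrib_left sum.distrib sum_distrib_right[symmetric])
  qed
  also have "\<dots> \<le> K * 4 ^ card X * B1 + (\<Sum>W\<in>Pow X. K * 3 ^ card (X - W) * B2)"
    unfolding sum.distrib using c1(3) c2(2) by (intro add_mono sum_mono) (auto simp: B1_def B2_def)
  also have "\<dots> = K * 4 ^ card X * B1 + K * B2 * (\<Sum>W\<in>Pow X. 3 ^ card (X - W))"
    by (simp add: sum_distrib_left mult_ac)
  also have "\<dots> = K * (4 ^ card X * (B1 + B2))"
    using sum_Pow_weight[OF fX, of 1 3] by (simp add: algebra_simps)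
  finally have "2 ^ card X * real (card {W \<in> Pow X. \<forall>F\<in>P. \<not> F \<subseteq> W}) \<le> 4 ^ card X * (B1 + B2)"
    using K0 by simp
  also have "(4::real) ^ card X = 2 ^ card X * 2 ^ card X" by (simp add: power_mult_distrib[symmetric])
  finally have "real (card {W \<in> Pow X. \<forall>F\<in>P. \<not> F \<subseteq> W}) \<le> 2 ^ card X * (B1 + B2)" by simp
  also have "\<dots> \<le> 2 ^ card X * (2 / 5)" using B1 B2 by (intro mult_left_mono) auto
  also have "\<dots> < 2 ^ card X / 2" by simp
  finally have "2 * real (card {W \<in> Pow X. \<forall>F\<in>P. \<not> F \<subseteq> W}) < 2 ^ card X" by simp
  hence "real (2 * card {W \<in> Pow X. \<forall>F\<in>P. \<not> F \<subseteq> W}) < real (2 ^ card X)" by simp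
  thus ?thesis by (simp only: of_nat_less_iff)
qed

text \<open>A uniform set \<open>W\<close> contains a member of \<open>P\<close> with probability
  above 1/2. Its complement is uniform too, so it contains a member of \<open>Q\<close> with
  probability above 1/2. Some \<open>W\<close> does both.\<close>

lemma spread_disjoint_members:
  fixes y :: real and P Q :: "'a set set"
  assumes fX: "finite X" and P: "P \<subseteq> Pow X" "P \<noteq> {}" and kP: "\<And>F. F \<in> P \<Longrightarrow> card F \<le> k"
    and sP: "\<And>C. C \<subseteq> X \<Longrightarrow> real (card {F \<in> P. C \<subseteq> F}) \<le> real (card P) * y ^ card C"
    and Q: "Q \<subseteq> Pow X" "Q \<noteq> {}" and kQ: "\<And>F. F \<in> Q \<Longrightarrow> card F \<le> k"
    and sQ: "\<And>C. C \<subseteq> X \<Longrightarrow> real (card {F \<in> Q. C \<subseteq> F}) \<le> real (card Q) * y ^ card C"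
    and y: "0 \<le> y" "y \<le> 1/1000" "real k * y\<^sup>2 \<le> 1/10000"
  obtains F G where "F \<in> P" "G \<in> Q" "F \<inter> G = {}"
proof -
  let ?A = "{W \<in> Pow X. \<forall>F\<in>P. \<not> F \<subseteq> W}"
  let ?B = "{W \<in> Pow X. \<forall>F\<in>Q. \<not> F \<subseteq> W}"
  have a: "2 * card ?A < 2 ^ card X" by (rule spread_random[OF fX P kP sP y])
  have b: "2 * card ?B < 2 ^ card X" by (rule spread_random[OF fX Q kQ sQ y])
  have "card (?A \<union> (\<lambda>W. X - W) ` ?B) \<le> card ?A + card ?B"
    using fX by (intro order_trans[OF card_Un_le] add_mono card_image_le) auto
  also have "\<dots> < card (Pow X)" using a b fX by (simp add: card_Pow)
  finally have lt: "card (?A \<union> (\<lambda>W. X - W) ` ?B) < card (Pow X)" .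
  have "finite (?A \<union> (\<lambda>W. X - W) ` ?B)" using fX by auto
  hence "\<not> Pow X \<subseteq> ?A \<union> (\<lambda>W. X - W) ` ?B" using lt by (meson card_mono leD)
  then obtain W where W: "W \<in> Pow X" "W \<notin> ?A" "W \<notin> (\<lambda>W. X - W) ` ?B" by blast
  obtain F where F: "F \<in> P" "F \<subseteq> W" using W by auto
  have "X - W \<notin> ?B" using W by (metis (no_types, lifting) PowD double_diff image_eqI order_refl)
  then obtain G where "G \<in> Q" "G \<subseteq> X - W" by auto
  thus ?thesis using that[OF F(1)] F by blast
qed

section \<open>Spread approximation\<close>

text \<open>A random member of \<open>H\<close>, with \<open>A\<close> removed, contains a given set
  \<open>C\<close> with probability at most \<open>y ^ card C\<close>. The subfamily
  \<open>H\<close> is existential, so a kernel of a subfamily is a kernel of the whole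
  family.\<close>

definition spread_kernel :: "real \<Rightarrow> 'a set set \<Rightarrow> 'a set \<Rightarrow> bool" where
  "spread_kernel y \<F> A \<longleftrightarrow> (\<exists>H\<subseteq>\<F>. H \<noteq> {} \<and> (\<forall>F\<in>H. A \<subseteq> F) \<and>
     (\<forall>C. C \<inter> A = {} \<longrightarrow> real (card {F \<in> H. C \<subseteq> F}) \<le> real (card H) * y ^ card C))"

section \<open>Kernels in families of \<open>k\<close>-sets\<close>

lemma finite_nsets: "finite X \<Longrightarrow> finite (nsets X k)"
  by (rule finite_subset[of _ "Pow X"]) (auto simp: nsets_def)

lemma card_nsets: "finite X \<Longrightarrow> card (nsets X k) = card X choose k"
  using n_subsets[of X k] by (simp add: nsets_def) (metis (no_types, lifting) Collect_cong finite_subset)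

lemma card_nsets_superset:
  assumes "finite X" "A \<subseteq> X"
  shows "card {F \<in> nsets X k. A \<subseteq> F} \<le> (card X - card A) choose (k - card A)"
proof -
  have fA: "finite A" using assms finite_subset by blast
  have "inj_on (\<lambda>F. F - A) {F \<in> nsets X k. A \<subseteq> F}" by (rule inj_onI) blast
  moreover have "(\<lambda>F. F - A) ` {F \<in> nsets X k. A \<subseteq> F} \<subseteq> nsets (X - A) (k - card A)"
    using fA by (auto simp: nsets_def card_Diff_subset)
  ultimately have "card {F \<in> nsets X k. A \<subseteq> F} \<le> card (nsets (X - A) (k - card A))"
    using assms by (intro card_inj_on_le[of "\<lambda>F. F - A"]) (auto intro: finite_nsets)
  thus ?thesis using assms fA by (simp add: card_nsets card_Diff_subset)
qed

text \<open>Each further prescribed point costs a factor \<open>(k - a) / (n - a)\<close>, which is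
  at most \<open>k / n\<close>.\<close>

lemma binomial_diff_le:
  assumes "a \<le> k" "k \<le> n"
  shows "real ((n - a) choose (k - a)) * real n ^ a \<le> real k ^ a * real (n choose k)"
  using assms
proof (induction a)
  case (Suc a)
  have IH: "real ((n - a) choose (k - a)) * real n ^ a \<le> real k ^ a * real (n choose k)"
    using Suc by simp
  have "(k - a) * ((n - a) choose (k - a)) = (n - a) * ((n - Suc a) choose (k - Suc a))"
    using Suc.prems times_binomial_minus1_eq[of "k - a" "n - a"] by simp
  hence e: "real (k - a) * real ((n - a) choose (k - a)) = real (n - a) * real ((n - Suc a) choose (k - Suc a))"
    by (metis of_nat_mult)
  have "real (n - a) * (real ((n - Suc a) choose (k - Suc a)) * real n ^ Suc a)
      = real n * real (k - a) * (real ((n - a) choose (k - a)) * real n ^ a)"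
    using e by (simp add: mult_ac)
  also have "\<dots> \<le> (real k * real (n - a)) * (real k ^ a * real (n choose k))"
  proof (rule mult_mono[OF _ IH])
    have "real k * real a \<le> real n * real a" using Suc.prems by (intro mult_right_mono) auto
    thus "real n * real (k - a) \<le> real k * real (n - a)"
      using Suc.prems by (simp add: of_nat_diff algebra_simps)
  qed auto
  finally have "real (n - a) * (real ((n - Suc a) choose (k - Suc a)) * real n ^ Suc a)
      \<le> real (n - a) * (real k ^ Suc a * real (n choose k))" by (simp add: mult_ac)
  thus ?case using Suc.prems by (subst (asm) mult_le_cancel_left_pos) auto
qed simp

text \<open>Let \<open>A\<close> be a largest set contained in at least a fraction
  \<open>y ^ card A\<close> of the members; maximality makes the members through \<open>A\<close>
  spread. Only a fraction \<open>(k / n) ^ card A \<le> (y / 2) ^ card A\<close> of all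
  \<open>k\<close>-sets contain \<open>A\<close>, so a large \<open>A\<close> would force the family
  to be smaller than \<open>big\<close> allows.\<close>

lemma spread_kernel_exists:
  assumes fX: "finite X" and F: "\<F> \<subseteq> nsets X k" and y: "0 < y" "2 * real k \<le> y * real (card X)"
    and big: "real (card X choose k) < 2 ^ q * real (card \<F>)"
  obtains A where "card A \<le> q" "spread_kernel y \<F> A"
proof -
  let ?n = "card X"
  have fF: "finite \<F>" using F fX finite_nsets finite_subset by blast
  have FX: "F \<subseteq> X" if "F \<in> \<F>" for F using that F by (auto simp: nsets_def)
  have cF: "card \<F> > 0" using big by (metis gr0I mult_zero_right not_less of_nat_0 of_nat_0_le_iff)
  define good where "good = (\<lambda>A. A \<subseteq> X \<and> y ^ card A * real (card \<F>) \<le> real (card {F \<in> \<F>. A \<subseteq> F}))"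
  have "good {}" by (simp add: good_def)
  moreover have "\<forall>A. good A \<longrightarrow> card A < Suc ?n" using fX by (auto simp: good_def less_Suc_eq_le card_mono)
  ultimately obtain A where A: "good A" "\<And>B. good B \<Longrightarrow> card B \<le> card A"
    using ex_has_greatest_nat[of good "{}" card "Suc ?n"] by blast
  have fA: "finite A" using A fX finite_subset unfolding good_def by blast
  let ?H = "{F \<in> \<F>. A \<subseteq> F}"
  have cH: "card ?H > 0"
  proof -
    have "0 < y ^ card A * real (card \<F>)" using y cF by simp
    thus ?thesis using A(1) unfolding good_def by linarith
  qed
  then obtain F0 where F0: "F0 \<in> \<F>" "A \<subseteq> F0" by (metis (no_types, lifting) card_gt_0_iff ex_in_conv mem_Collect_eq)
  have F0k: "finite F0" "card F0 = k" "F0 \<subseteq> X" using F0 F by (auto simp: nsets_def)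
  have ak: "card A \<le> k" using F0 F0k card_mono by metis
  have kn: "k \<le> ?n" using F0k fX card_mono by metis
  have "spread_kernel y \<F> A" unfolding spread_kernel_def
  proof (intro exI[of _ ?H] conjI allI impI)
    show "?H \<noteq> {}" using F0 by blast
    fix C assume C: "C \<inter> A = {}"
    show "real (card {F \<in> ?H. C \<subseteq> F}) \<le> real (card ?H) * y ^ card C"
    proof (cases "C = {} \<or> \<not> C \<subseteq> X")
      case True
      thus ?thesis
      proof
        assume "\<not> C \<subseteq> X"
        hence e: "{F \<in> ?H. C \<subseteq> F} = {}" using FX by blast
        show ?thesis using y unfolding e by simp
      qed simp
    next
      case False
      hence fC: "finite C" using fX finite_subset by blast
      have c: "card (A \<union> C) = card A + card C" using C fA fC by (intro card_Un_disjoint) auto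
      have "card C > 0" using False fC by (simp add: card_gt_0_iff)
      hence "\<not> good (A \<union> C)" using A(2)[of "A \<union> C"] c by auto
      hence "real (card {F \<in> \<F>. A \<union> C \<subseteq> F}) \<le> y ^ card (A \<union> C) * real (card \<F>)"
        using A(1) False unfolding good_def by auto
      also have "\<dots> = y ^ card C * (y ^ card A * real (card \<F>))" by (simp add: c power_add mult_ac)
      also have "\<dots> \<le> y ^ card C * real (card ?H)"
        using A(1) y unfolding good_def by (intro mult_left_mono) auto
      finally have "real (card {F \<in> \<F>. A \<union> C \<subseteq> F}) \<le> real (card ?H) * y ^ card C" by (simp add: mult.commute)
      moreover have "{F \<in> \<F>. A \<union> C \<subseteq> F} = {F \<in> ?H. C \<subseteq> F}" by auto
      ultimately show ?thesis by simp
    qed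
  qed auto
  moreover have "card A \<le> q"
  proof -
    let ?a = "card A"
    have "card ?H \<le> card {F \<in> nsets X k. A \<subseteq> F}"
      using F by (intro card_mono finite_subset[OF _ finite_nsets[OF fX]]) auto
    also have "\<dots> \<le> (?n - ?a) choose (k - ?a)"
      using A(1) fX unfolding good_def by (intro card_nsets_superset) auto
    finally have "real (card ?H) * real ?n ^ ?a \<le> real ((?n - ?a) choose (k - ?a)) * real ?n ^ ?a"
      by (intro mult_right_mono) auto
    also have "\<dots> \<le> real k ^ ?a * real (?n choose k)" by (rule binomial_diff_le[OF ak kn])
    finally have 1: "real (card ?H) * real ?n ^ ?a \<le> real k ^ ?a * real (?n choose k)" .
    have "(2 * real k) ^ ?a * real (card \<F>) \<le> (y * real ?n) ^ ?a * real (card \<F>)"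
      using y by (intro mult_right_mono power_mono) auto
    also have "\<dots> = (y ^ ?a * real (card \<F>)) * real ?n ^ ?a" by (simp add: power_mult_distrib mult_ac)
    also have "\<dots> \<le> real (card ?H) * real ?n ^ ?a"
      using A(1) unfolding good_def by (intro mult_right_mono) auto
    also note 1
    finally have "real k ^ ?a * (2 ^ ?a * real (card \<F>)) \<le> real k ^ ?a * real (?n choose k)"
      by (simp add: power_mult_distrib mult_ac)
    moreover have "k = 0 \<Longrightarrow> ?a = 0" using ak by simp
    hence "real k ^ ?a > 0" by (cases "k = 0") auto
    ultimately have "2 ^ ?a * real (card \<F>) \<le> real (?n choose k)" by simp
    also note big
    finally have "(2::real) ^ ?a < 2 ^ q" using cF by simp
    thus ?thesis by simp
  qed
  ultimately show ?thesis using that by blast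
qed

text \<open>By the union bound at most \<open>card B * y \<le> 1 / 2\<close> of the members of
  \<open>H\<close> meet \<open>B - A\<close>. Discarding them at most doubles the spread bound, and
  for nonempty \<open>C\<close> the factor 2 is absorbed into
  \<open>(2 * y) ^ card C\<close>.\<close>

lemma spread_kernel_avoiding:
  assumes fX: "finite X" and F: "\<F> \<subseteq> nsets X k" and A: "spread_kernel y \<F> A" and fB: "finite B"
    and y: "0 \<le> y" "2 * (real (card B) * y) \<le> 1"
  obtains P where "P \<subseteq> Pow X" "P \<noteq> {}" "\<And>F. F \<in> P \<Longrightarrow> card F \<le> k"
    "\<And>C. real (card {F \<in> P. C \<subseteq> F}) \<le> real (card P) * (2 * y) ^ card C"
    "\<And>F. F \<in> P \<Longrightarrow> A \<union> F \<in> \<F> \<and> F \<inter> A = {} \<and> F \<inter> B = {}"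
proof -
  obtain H where H: "H \<subseteq> \<F>" "H \<noteq> {}" "\<forall>F\<in>H. A \<subseteq> F"
    and H4: "\<forall>C. C \<inter> A = {} \<longrightarrow> real (card {F \<in> H. C \<subseteq> F}) \<le> real (card H) * y ^ card C"
    using A unfolding spread_kernel_def by - (elim exE conjE, rule that)
  have H4: "real (card {F \<in> H. C \<subseteq> F}) \<le> real (card H) * y ^ card C" if "C \<inter> A = {}" for C
    using H4 that by simp
  have fH: "finite H" by (rule finite_subset[OF order_trans[OF H(1) F] finite_nsets[OF fX]])
  have FX: "F \<subseteq> X \<and> finite F \<and> card F = k" if "F \<in> H" for F
    using subsetD[OF F subsetD[OF H(1) that]] by (simp add: nsets_def)
  obtain F0 where "F0 \<in> H" using H(2) by blast
  hence fA: "finite A" using H(3) FX finite_subset by metis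
  define G where "G = {F \<in> H. F \<inter> (B - A) = {}}"
  have "H - G \<subseteq> (\<Union>x\<in>B - A. {F \<in> H. {x} \<subseteq> F})" by (auto simp: G_def)
  hence "card (H - G) \<le> card (\<Union>x\<in>B - A. {F \<in> H. {x} \<subseteq> F})"
    using fH fB by (intro card_mono) auto
  also have "\<dots> \<le> (\<Sum>x\<in>B - A. card {F \<in> H. {x} \<subseteq> F})" using fB by (intro card_UN_le) auto
  finally have "real (card (H - G)) \<le> (\<Sum>x\<in>B - A. real (card {F \<in> H. {x} \<subseteq> F}))"
    using of_nat_mono by fastforce
  also have "\<dots> \<le> (\<Sum>x\<in>B - A. real (card H) * y)"
  proof (rule sum_mono)
    fix x assume "x \<in> B - A"
    thus "real (card {F \<in> H. {x} \<subseteq> F}) \<le> real (card H) * y" using H4[of "{x}"] by simp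
  qed
  also have "\<dots> = real (card (B - A)) * (real (card H) * y)" by simp
  also have "\<dots> \<le> real (card B) * (real (card H) * y)"
    using fB y by (intro mult_right_mono) (auto intro: card_mono)
  also have "\<dots> = (real (card B) * y) * real (card H)" by simp
  also have "\<dots> \<le> (1/2) * real (card H)" using y by (intro mult_right_mono) auto
  finally have "2 * real (card (H - G)) \<le> real (card H)" by simp
  moreover have GH: "G \<subseteq> H" "finite G" using fH by (auto simp: G_def)
  moreover have "card (H - G) = card H - card G" "card G \<le> card H"
    using GH fH by (auto simp: card_Diff_subset card_mono)
  ultimately have half: "real (card H) \<le> 2 * real (card G)" by (simp add: of_nat_diff)
  have "card H > 0" using H fH by (simp add: card_gt_0_iff)
  hence G0: "card G > 0" using half by linarith
  define P where "P = (\<lambda>F. F - A) ` G"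
  have inj: "inj_on (\<lambda>F. F - A) G" using H GH by (intro inj_onI) blast
  have cP: "card P = card G" unfolding P_def by (rule card_image[OF inj])
  have sp: "real (card {F \<in> P. C \<subseteq> F}) \<le> real (card P) * (2 * y) ^ card C" for C
  proof (cases "C = {} \<or> C \<inter> A \<noteq> {} \<or> \<not> C \<subseteq> X")
    case True
    thus ?thesis
    proof (elim disjE)
      assume "C \<inter> A \<noteq> {}"
      hence e: "{F \<in> P. C \<subseteq> F} = {}" by (auto simp: P_def)
      show ?thesis unfolding e using y by simp
    next
      assume "\<not> C \<subseteq> X"
      hence e: "{F \<in> P. C \<subseteq> F} = {}" using GH FX unfolding P_def by blast
      show ?thesis unfolding e using y by simp
    qed simp
  next
    case False
    hence "finite C" using fX finite_subset by blast
    hence c1: "card C \<ge> 1" using False by (simp add: Suc_le_eq card_gt_0_iff)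
    have "{F \<in> P. C \<subseteq> F} \<subseteq> (\<lambda>F. F - A) ` {F \<in> H. C \<subseteq> F}" using GH(1) unfolding P_def by blast
    hence "card {F \<in> P. C \<subseteq> F} \<le> card {F \<in> H. C \<subseteq> F}" by (rule surj_card_le[rotated]) (simp add: fH)
    hence "real (card {F \<in> P. C \<subseteq> F}) \<le> real (card {F \<in> H. C \<subseteq> F})" by simp
    also have "\<dots> \<le> real (card H) * y ^ card C" using H4[of C] False by simp
    also have "\<dots> \<le> (2 * real (card G)) * y ^ card C" using half y by (intro mult_right_mono) auto
    also have "\<dots> = real (card P) * (2 ^ 1 * y ^ card C)" by (simp add: cP)
    also have "\<dots> \<le> real (card P) * (2 ^ card C * y ^ card C)"
      using c1 y by (intro mult_left_mono mult_right_mono power_increasing) auto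
    finally show ?thesis by (simp add: power_mult_distrib)
  qed
  have P0: "P \<noteq> {}" using G0 by (auto simp: P_def)
  have PX: "P \<subseteq> Pow X" using FX GH unfolding P_def by blast
  have Pk: "card F \<le> k" if F: "F \<in> P" for F
  proof -
    obtain F' where F': "F' \<in> G" "F = F' - A" using F by (auto simp: P_def)
    have "card (F' - A) \<le> card F'" using FX[of F'] F' GH by (intro card_mono) auto
    thus ?thesis using FX[of F'] F' GH by auto
  qed
  have Pu: "A \<union> F \<in> \<F> \<and> F \<inter> A = {} \<and> F \<inter> B = {}" if F: "F \<in> P" for F
  proof -
    obtain F' where F': "F' \<in> G" "F = F' - A" using F by (auto simp: P_def)
    have "A \<subseteq> F'" using H(3) F' GH by blast
    hence "A \<union> F = F'" using F' by auto
    thus ?thesis using F' GH H(1) by (auto simp: G_def)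
  qed
  show ?thesis by (rule that[OF PX P0 Pk sp Pu])
qed

text \<open>Thin the two links so that each avoids the other kernel, and choose disjoint
  \<open>F\<close>, \<open>G\<close> in them. Then \<open>A \<union> F\<close> and
  \<open>B \<union> G\<close> are members of \<open>\<F>\<close> that meet exactly in
  \<open>A \<inter> B\<close>.\<close>

lemma spread_kernels_intersect:
  assumes fX: "finite X" and F: "\<F> \<subseteq> nsets X k" and int: "t_intersecting t \<F>"
    and A: "spread_kernel y \<F> A" "finite A" "card A \<le> q"
    and B: "spread_kernel y \<F> B" "finite B" "card B \<le> q"
    and y: "0 \<le> y" "2 * y \<le> 1/1000" "real k * (2 * y)\<^sup>2 \<le> 1/10000" "2 * (real q * y) \<le> 1"
  shows "t \<le> card (A \<inter> B)"
proof -
  have qy: "2 * (real (card C) * y) \<le> 1" if "card C \<le> q" for C :: "'a set"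
    using mult_right_mono[of "real (card C)" "real q" y] that y by simp
  obtain P where P: "P \<subseteq> Pow X" "P \<noteq> {}" "\<And>F. F \<in> P \<Longrightarrow> card F \<le> k"
    "\<And>C. real (card {F \<in> P. C \<subseteq> F}) \<le> real (card P) * (2 * y) ^ card C"
    "\<And>F. F \<in> P \<Longrightarrow> A \<union> F \<in> \<F> \<and> F \<inter> A = {} \<and> F \<inter> B = {}"
    by (rule spread_kernel_avoiding[OF fX F A(1) B(2) y(1) qy[OF B(3)]], rule that)
  obtain Q where Q: "Q \<subseteq> Pow X" "Q \<noteq> {}" "\<And>F. F \<in> Q \<Longrightarrow> card F \<le> k"
    "\<And>C. real (card {F \<in> Q. C \<subseteq> F}) \<le> real (card Q) * (2 * y) ^ card C"
    "\<And>F. F \<in> Q \<Longrightarrow> B \<union> F \<in> \<F> \<and> F \<inter> B = {} \<and> F \<inter> A = {}"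
    by (rule spread_kernel_avoiding[OF fX F B(1) A(2) y(1) qy[OF A(3)]], rule that)
  have y0: "0 \<le> 2 * y" using y by simp
  obtain F G where FG: "F \<in> P" "G \<in> Q" "F \<inter> G = {}"
    by (rule spread_disjoint_members[OF fX P(1-4) Q(1-4) y0 y(2,3)])
  have "(A \<union> F) \<inter> (B \<union> G) = A \<inter> B" using FG P(5)[OF FG(1)] Q(5)[OF FG(2)] by blast
  moreover have "t \<le> card ((A \<union> F) \<inter> (B \<union> G))"
    using int P(5)[OF FG(1)] Q(5)[OF FG(2)] unfolding t_intersecting_def by blast
  ultimately show ?thesis by simp
qed

text \<open>\<open>S\<close> consists of all kernels of size at most \<open>q\<close>. If the
  members containing no element of \<open>S\<close> were too many, they would have a kernel of their
  own; it is also a kernel of \<open>\<F>\<close>, hence in \<open>S\<close>, yet members of the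
  remainder contain it.\<close>

lemma spread_approximation:
  assumes fX: "finite X" and F: "\<F> \<subseteq> nsets X k" and int: "t_intersecting t \<F>"
    and y: "0 < y" "2 * real k \<le> y * real (card X)" "2 * y \<le> 1/1000" "real k * (2 * y)\<^sup>2 \<le> 1/10000"
      "2 * (real q * y) \<le> 1"
  obtains S where "t_intersecting t S" "\<And>A. A \<in> S \<Longrightarrow> \<exists>F\<in>\<F>. A \<subseteq> F" "\<And>A. A \<in> S \<Longrightarrow> card A \<le> q"
    "2 ^ q * real (card {F \<in> \<F>. \<forall>A\<in>S. \<not> A \<subseteq> F}) \<le> real (card X choose k)"
proof -
  define S where "S = {A. card A \<le> q \<and> spread_kernel y \<F> A}"
  have sub: "\<exists>F\<in>\<F>. A \<subseteq> F" if "A \<in> S" for A using that unfolding S_def spread_kernel_def by blast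
  have fin: "finite A" if "A \<in> S" for A using sub[OF that] F by (auto simp: nsets_def intro: finite_subset)
  have "t_intersecting t S"
    unfolding t_intersecting_def
  proof (intro ballI)
    fix A B assume AB: "A \<in> S" "B \<in> S"
    show "t \<le> card (A \<inter> B)"
      by (rule spread_kernels_intersect[OF fX F int _ fin[OF AB(1)] _ _ fin[OF AB(2)]])
        (use AB y in \<open>auto simp: S_def\<close>)
  qed
  moreover have "2 ^ q * real (card {F \<in> \<F>. \<forall>A\<in>S. \<not> A \<subseteq> F}) \<le> real (card X choose k)"
  proof (rule ccontr)
    let ?R = "{F \<in> \<F>. \<forall>A\<in>S. \<not> A \<subseteq> F}"
    assume "\<not> ?thesis"
    hence lt: "real (card X choose k) < 2 ^ q * real (card ?R)" by simp
    have R: "?R \<subseteq> nsets X k" using F by blast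
    obtain A where A: "card A \<le> q" "spread_kernel y ?R A"
      by (rule spread_kernel_exists[OF fX R y(1,2) lt])
    obtain H where H: "H \<subseteq> ?R" "H \<noteq> {}" "\<forall>F\<in>H. A \<subseteq> F"
      "\<forall>C. C \<inter> A = {} \<longrightarrow> real (card {F \<in> H. C \<subseteq> F}) \<le> real (card H) * y ^ card C"
      using A(2) unfolding spread_kernel_def by - (elim exE conjE, rule that)
    have "H \<subseteq> \<F>" using H(1) by blast
    hence "spread_kernel y \<F> A" unfolding spread_kernel_def
      by (intro exI[of _ H] conjI H(2-4))
    hence "A \<in> S" using A by (simp add: S_def)
    thus False using H(1-3) by blast
  qed
  moreover have "card A \<le> q" if "A \<in> S" for A using that by (simp add: S_def)
  ultimately show ?thesis using sub by (intro that[of S])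
qed

section \<open>Peeling\<close>

text \<open>Minimality: no member can shrink without spoiling the \<open>t\<close>-intersecting
  property. The witness \<open>C\<close> may be \<open>A\<close> itself, so shrinking below
  \<open>t\<close> elements counts as spoiling.\<close>

definition reduced :: "nat \<Rightarrow> 'a set set \<Rightarrow> bool" where
  "reduced t T \<longleftrightarrow> (\<forall>A\<in>T. \<forall>B. B \<subset> A \<longrightarrow> (\<exists>C\<in>T. card (B \<inter> C) < t))"

text \<open>As long as some \<open>A\<close> can shrink to a proper subset \<open>B\<close>, replace
  it; the total size of the members drops. If \<open>B\<close> is already a member, the two
  merge.\<close>

lemma t_intersecting_reduce:
  assumes "finite T" "t_intersecting t T" "\<And>A. A \<in> T \<Longrightarrow> finite A"
  obtains T' where "finite T'" "t_intersecting t T'" "reduced t T'"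
    "\<And>A. A \<in> T' \<Longrightarrow> \<exists>B\<in>T. A \<subseteq> B" "\<And>A. A \<in> T \<Longrightarrow> \<exists>B\<in>T'. B \<subseteq> A"
proof -
  have "\<exists>T'. finite T' \<and> t_intersecting t T' \<and> reduced t T' \<and>
    (\<forall>A\<in>T'. \<exists>B\<in>T. A \<subseteq> B) \<and> (\<forall>A\<in>T. \<exists>B\<in>T'. B \<subseteq> A)"
    using assms
  proof (induction "sum card T" arbitrary: T rule: less_induct)
    case less
    show ?case
    proof (cases "reduced t T")
      case True
      thus ?thesis using less.prems by (intro exI[of _ T]) auto
    next
      case False
      then obtain A B where AB: "A \<in> T" "B \<subset> A" "\<And>C. C \<in> T \<Longrightarrow> t \<le> card (B \<inter> C)"
        by (auto simp: reduced_def not_less)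
      define T1 where "T1 = insert B (T - {A})"
      have fin: "finite T1" "\<And>C. C \<in> T1 \<Longrightarrow> finite C"
        using less.prems(1,3) AB unfolding T1_def by (auto intro: finite_subset[of B A])
      have "B \<inter> A = B" using AB by auto
      hence "t \<le> card B" using AB(3)[OF AB(1)] by simp
      hence int: "t_intersecting t T1"
        using less.prems(2) AB(3) unfolding t_intersecting_def T1_def by (auto simp: Int_commute)
      have "sum card T1 \<le> card B + sum card (T - {A})"
        using less.prems(1) unfolding T1_def by (simp add: sum.insert_if)
      also have "\<dots> < card A + sum card (T - {A})"
        using AB less.prems(3) by (simp add: psubset_card_mono)
      also have "\<dots> = sum card T" using less.prems(1) AB(1) by (simp add: sum.remove)
      finally have "sum card T1 < sum card T" .
      from less.hyps[OF this fin(1) int fin(2)] obtain T' where T':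
        "finite T'" "t_intersecting t T'" "reduced t T'"
        "\<forall>A\<in>T'. \<exists>B\<in>T1. A \<subseteq> B" "\<forall>A\<in>T1. \<exists>B\<in>T'. B \<subseteq> A" by blast
      have BA: "B \<subseteq> A" using AB(2) by blast
      have "\<exists>D\<in>T. C \<subseteq> D" if C: "C \<in> T'" for C
      proof -
        obtain D where D: "D \<in> T1" "C \<subseteq> D" using T'(4) C by blast
        show ?thesis
        proof (cases "D = B")
          case True
          thus ?thesis using D(2) BA AB(1) by (intro bexI[of _ A]) auto
        qed (use D in \<open>auto simp: T1_def\<close>)
      qed
      moreover have "\<exists>D\<in>T'. D \<subseteq> C" if C: "C \<in> T" for C
      proof (cases "C = A")
        case True
        obtain D where "D \<in> T'" "D \<subseteq> B" using T'(5) unfolding T1_def by blast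
        thus ?thesis using True BA by (intro bexI[of _ D]) auto
      next
        case False
        thus ?thesis using T'(5) C unfolding T1_def by simp
      qed
      ultimately show ?thesis using T'(1-3) by (intro exI[of _ T'] conjI ballI) simp_all
    qed
  qed
  then obtain T' where T': "finite T'" "t_intersecting t T'" "reduced t T'"
    "\<forall>A\<in>T'. \<exists>B\<in>T. A \<subseteq> B" "\<forall>A\<in>T. \<exists>B\<in>T'. B \<subseteq> A"
    by - (elim exE conjE, rule that)
  show ?thesis by (rule that[OF T'(1-3) bspec[OF T'(4)] bspec[OF T'(5)]])
qed

text \<open>Every factor \<open>(d + i) / i = 1 + d / i\<close> of the binomial coefficient is at
  most \<open>d + 1\<close>.\<close>

lemma binomial_add_le_power: "(d + u choose u) \<le> (d + 1) ^ u"
proof (induction u)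
  case (Suc u)
  have "Suc u * (d + Suc u choose Suc u) = Suc (d + u) * (d + u choose u)"
    using Suc_times_binomial[of u "d + u"] by simp
  also have "\<dots> \<le> (Suc u * (d + 1)) * (d + 1) ^ u"
    using Suc by (intro mult_mono) auto
  finally show ?case by (simp add: mult.assoc del: mult_Suc mult_Suc_right binomial_Suc_Suc)
qed simp

text \<open>Branching: a proper subset \<open>X\<close> of a member has, by minimality, a witness
  \<open>C\<close> with \<open>card (X \<inter> C) = t - u\<close> and \<open>u > 0\<close>. Every
  member through \<open>X\<close> needs \<open>u\<close> more points of \<open>C\<close>, and
  \<open>C - X\<close> has at most \<open>d + u\<close> points, so there are at most
  \<open>(d + u choose u) \<le> (d + 1) ^ u\<close> ways to enlarge \<open>X\<close> by
  \<open>u\<close>. Each added point thus costs a factor \<open>d + 1\<close>.\<close>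

lemma card_supersets_reduced:
  assumes fin: "finite T" "\<And>A. A \<in> T \<Longrightarrow> finite A"
    and int: "t_intersecting t T" and red: "reduced t T"
    and small: "\<And>A. A \<in> T \<Longrightarrow> card A \<le> t + d"
    and X: "t \<le> card X"
  shows "card {A \<in> T. card A = t + d \<and> X \<subseteq> A} \<le> (d + 1) ^ (t + d - card X)"
  using X
proof (induction "t + d - card X" arbitrary: X rule: less_induct)
  case less
  let ?S = "{A \<in> T. card A = t + d \<and> X \<subseteq> A}"
  show ?case
  proof (cases "?S = {}")
    case False
    then obtain A0 where A0: "A0 \<in> T" "card A0 = t + d" "X \<subseteq> A0" by blast
    have finX: "finite X" using A0 fin(2) finite_subset by blast
    have cX: "card X \<le> t + d" using A0 fin(2) card_mono by metis
    show ?thesis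
    proof (cases "X = A0")
      case True
      have "A = X" if "A \<in> ?S" for A
        using that A0 True fin(2) card_subset_eq[of A X] by auto
      hence "?S \<subseteq> {X}" by blast
      hence "card ?S \<le> card {X}" by (intro card_mono) auto
      thus ?thesis using A0 True by simp
    next
      case ne: False
      then obtain C where C: "C \<in> T" "card (X \<inter> C) < t" using red A0 unfolding reduced_def by blast
      define u where "u = t - card (X \<inter> C)"
      have u: "0 < u" "card (X \<inter> C) + u = t" using C by (auto simp: u_def)
      have finC: "finite C" using C fin by blast
      have "card (C - X) = card C - card (X \<inter> C)"
        using finC by (simp add: card_Diff_subset_Int Int_commute)
      hence cC: "card (C - X) \<le> d + u" using small[OF C(1)] u by simp
      have ex: "\<exists>U. U \<subseteq> C - X \<and> card U = u \<and> X \<union> U \<subseteq> A" if A: "A \<in> ?S" for A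
      proof -
        have "t \<le> card (A \<inter> C)" using int A C unfolding t_intersecting_def by auto
        also have "A \<inter> C = (X \<inter> C) \<union> (A \<inter> (C - X))" using A by auto
        also have "card \<dots> \<le> card (X \<inter> C) + card (A \<inter> (C - X))" by (rule card_Un_le)
        finally have "u \<le> card (A \<inter> (C - X))" using u by simp
        then obtain U where "U \<subseteq> A \<inter> (C - X)" "card U = u" by (meson obtain_subset_with_card_n)
        thus ?thesis using A by (intro exI[of _ U]) auto
      qed
      have cU: "card (X \<union> U) = card X + u" if "U \<subseteq> C - X" "card U = u" for U
        using that finX finC by (subst card_Un_disjoint) (auto intro: finite_subset)
      have ule: "card X + u \<le> t + d"
      proof -
        obtain U where "U \<subseteq> C - X" "card U = u" "X \<union> U \<subseteq> A0" using ex[of A0] A0 by blast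
        thus ?thesis using cU A0 fin(2) card_mono by metis
      qed
      let ?U = "{U. U \<subseteq> C - X \<and> card U = u}"
      have fU: "finite ?U" using finC by auto
      have "?S \<subseteq> (\<Union>U\<in>?U. {A \<in> T. card A = t + d \<and> X \<union> U \<subseteq> A})" using ex by blast
      hence "card ?S \<le> card (\<Union>U\<in>?U. {A \<in> T. card A = t + d \<and> X \<union> U \<subseteq> A})"
        using fU fin by (intro card_mono) auto
      also have "\<dots> \<le> (\<Sum>U\<in>?U. card {A \<in> T. card A = t + d \<and> X \<union> U \<subseteq> A})"
        by (rule card_UN_le[OF fU])
      also have "\<dots> \<le> (\<Sum>U\<in>?U. (d + 1) ^ (t + d - card X - u))"
      proof (rule sum_mono)
        fix U assume U: "U \<in> ?U"
        have "card {A \<in> T. card A = t + d \<and> X \<union> U \<subseteq> A} \<le> (d + 1) ^ (t + d - card (X \<union> U))"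
          using U cU[of U] u ule less.prems by (intro less.hyps) auto
        thus "card {A \<in> T. card A = t + d \<and> X \<union> U \<subseteq> A} \<le> (d + 1) ^ (t + d - card X - u)"
          using U cU[of U] by auto
      qed
      also have "\<dots> = (card (C - X) choose u) * (d + 1) ^ (t + d - card X - u)"
        using n_subsets[of "C - X" u] finC by simp
      also have "\<dots> \<le> (d + u choose u) * (d + 1) ^ (t + d - card X - u)"
        using cC by (intro mult_right_mono binomial_right_mono) auto
      also have "\<dots> \<le> (d + 1) ^ u * (d + 1) ^ (t + d - card X - u)"
        by (intro mult_right_mono binomial_add_le_power) auto
      also have "\<dots> = (d + 1) ^ (t + d - card X)" using ule by (simp flip: power_add)
      finally show ?thesis .
    qed
  next
    case True
    show ?thesis unfolding True by simp
  qed
qed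

text \<open>All members of the top layer share \<open>t\<close> points with a fixed one; once such a
  \<open>t\<close>-set is chosen, \<open>d\<close> points remain to be added.\<close>

lemma card_top_reduced:
  assumes fin: "finite T" "\<And>A. A \<in> T \<Longrightarrow> finite A"
    and int: "t_intersecting t T" and red: "reduced t T"
    and small: "\<And>A. A \<in> T \<Longrightarrow> card A \<le> t + d"
  shows "card {A \<in> T. card A = t + d} \<le> (t + d choose t) * (d + 1) ^ d"
proof (cases "{A \<in> T. card A = t + d} = {}")
  case False
  then obtain A0 where A0: "A0 \<in> T" "card A0 = t + d" by blast
  let ?U = "{U. U \<subseteq> A0 \<and> card U = t}"
  have fU: "finite ?U" using A0 fin by auto
  have "{A \<in> T. card A = t + d} \<subseteq> (\<Union>U\<in>?U. {A \<in> T. card A = t + d \<and> U \<subseteq> A})"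
  proof
    fix A assume A: "A \<in> {A \<in> T. card A = t + d}"
    have "t \<le> card (A \<inter> A0)" using A A0 int unfolding t_intersecting_def by blast
    then obtain U where "U \<subseteq> A \<inter> A0" "card U = t" by (meson obtain_subset_with_card_n)
    thus "A \<in> (\<Union>U\<in>?U. {A \<in> T. card A = t + d \<and> U \<subseteq> A})" using A by blast
  qed
  hence "card {A \<in> T. card A = t + d} \<le> card (\<Union>U\<in>?U. {A \<in> T. card A = t + d \<and> U \<subseteq> A})"
    using fU fin by (intro card_mono) auto
  also have "\<dots> \<le> (\<Sum>U\<in>?U. card {A \<in> T. card A = t + d \<and> U \<subseteq> A})"
    by (rule card_UN_le[OF fU])
  also have "\<dots> \<le> (\<Sum>U\<in>?U. (d + 1) ^ d)"
    using card_supersets_reduced[OF fin int red small] by (intro sum_mono) fastforce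
  also have "\<dots> = (t + d choose t) * (d + 1) ^ d"
    using n_subsets[of A0 t] A0 fin by simp
  finally show ?thesis .
next
  case True
  show ?thesis unfolding True by simp
qed

text \<open>Going down from size \<open>j\<close>: reduce, remove the members of size exactly
  \<open>j\<close>, repeat until size \<open>t + 1\<close>. \<open>W d\<close> is the layer removed
  at size \<open>t + d\<close>. The last clause is what the counting needs: two sets either both
  contain survivors, or one contains a removed set \<open>C\<close> of which the other contains at
  least \<open>t\<close> points.\<close>

lemma peel:
  assumes "0 < t" "finite T" "\<And>A. A \<in> T \<Longrightarrow> finite A" "t_intersecting t T"
    "\<And>A. A \<in> T \<Longrightarrow> card A \<le> j"
  obtains T' W where "t_intersecting t T'" "\<And>A. A \<in> T' \<Longrightarrow> \<exists>B\<in>T. A \<subseteq> B"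
    "\<And>A. A \<in> T' \<Longrightarrow> card A \<le> t + 1"
    "\<And>d. finite (W d)" "\<And>d. card (W d) \<le> (t + d choose t) * (d + 1) ^ d"
    "\<And>d A. A \<in> W d \<Longrightarrow> finite A \<and> card A = t + d"
    "\<And>A B. A \<in> T \<Longrightarrow> B \<in> T \<Longrightarrow> (\<exists>A'\<in>T'. \<exists>B'\<in>T'. A' \<subseteq> A \<and> B' \<subseteq> B) \<or>
      (\<exists>d. 2 \<le> d \<and> t + d \<le> j \<and> (\<exists>C\<in>W d. C \<subseteq> A \<and> t \<le> card (C \<inter> B) \<or> C \<subseteq> B \<and> t \<le> card (C \<inter> A)))"
proof -
  have "\<exists>T' W. t_intersecting t T' \<and> (\<forall>A\<in>T'. \<exists>B\<in>T. A \<subseteq> B) \<and> (\<forall>A\<in>T'. card A \<le> t + 1) \<and>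
    (\<forall>d. finite (W d) \<and> card (W d) \<le> (t + d choose t) * (d + 1) ^ d \<and>
      (\<forall>A\<in>W d. finite A \<and> card A = t + d)) \<and>
    (\<forall>A\<in>T. \<forall>B\<in>T. (\<exists>A'\<in>T'. \<exists>B'\<in>T'. A' \<subseteq> A \<and> B' \<subseteq> B) \<or>
      (\<exists>d. 2 \<le> d \<and> t + d \<le> j \<and> (\<exists>C\<in>W d. C \<subseteq> A \<and> t \<le> card (C \<inter> B) \<or> C \<subseteq> B \<and> t \<le> card (C \<inter> A))))"
    (is "?P T j")
    using assms(2-)
  proof (induction j arbitrary: T)
    case 0
    show ?case
      by (rule exI[of _ T], rule exI[of _ "\<lambda>_. {}"]) (use 0 in \<open>force intro: le_SucI\<close>)
  next
    case (Suc j)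
    show ?case
    proof (cases "Suc j \<le> t + 1")
      case True
      have "card A \<le> t + 1" if "A \<in> T" for A using Suc.prems(4)[OF that] True by simp
      thus ?thesis
        by (intro exI[of _ T] exI[of _ "\<lambda>_. {}"]) (use Suc.prems(3) in auto)
    next
      case False
      define d where "d = Suc j - t"
      have d: "Suc j = t + d" "2 \<le> d" using False by (auto simp: d_def)
      obtain R where R: "finite R" "t_intersecting t R" "reduced t R"
        "\<And>A. A \<in> R \<Longrightarrow> \<exists>B\<in>T. A \<subseteq> B" "\<And>A. A \<in> T \<Longrightarrow> \<exists>B\<in>R. B \<subseteq> A"
        by (rule t_intersecting_reduce[OF Suc.prems(1,3,2)]) (assumption+, rule that, assumption+)
      have finR: "finite A" if "A \<in> R" for A using R(4)[OF that] Suc.prems(2) finite_subset by blast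
      have cR: "card A \<le> t + d" if A: "A \<in> R" for A
      proof -
        obtain B where "B \<in> T" "A \<subseteq> B" using R(4)[OF A] by blast
        thus ?thesis using Suc.prems(2,4) d card_mono order_trans by metis
      qed
      define V where "V = {A \<in> R. card A = t + d}"
      have IHp: "finite (R - V)" "\<And>A. A \<in> R - V \<Longrightarrow> finite A" "t_intersecting t (R - V)"
        using R finR unfolding t_intersecting_def by auto
      have IHc: "card A \<le> j" if "A \<in> R - V" for A
        using that cR[of A] d unfolding V_def by fastforce
      have IH: "?P (R - V) j" by (rule Suc.IH) (use IHp IHc in blast)+
      obtain T' W where TW: "t_intersecting t T'" "\<forall>A\<in>T'. \<exists>B\<in>R-V. A \<subseteq> B" "\<forall>A\<in>T'. card A \<le> t + 1"
        "\<forall>d. finite (W d) \<and> card (W d) \<le> (t + d choose t) * (d + 1) ^ d \<and> (\<forall>A\<in>W d. finite A \<and> card A = t + d)"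
        "\<forall>A\<in>R-V. \<forall>B\<in>R-V. (\<exists>A'\<in>T'. \<exists>B'\<in>T'. A' \<subseteq> A \<and> B' \<subseteq> B) \<or>
          (\<exists>d. 2 \<le> d \<and> t + d \<le> j \<and> (\<exists>C\<in>W d. C \<subseteq> A \<and> t \<le> card (C \<inter> B) \<or> C \<subseteq> B \<and> t \<le> card (C \<inter> A)))"
        using IH by - (elim exE conjE, rule that)
      \<comment> \<open>Overwriting index \<open>d\<close> is harmless: the induction hypothesis
        refers only to layers \<open>d'\<close> with \<open>t + d' \<le> j\<close>, and
        \<open>t + d = Suc j\<close>.\<close>
      define W' where "W' = W(d := V)"
      have cV: "card V \<le> (t + d choose t) * (d + 1) ^ d"
        unfolding V_def by (rule card_top_reduced[OF R(1) finR R(2,3) cR])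
      have W': "\<forall>d. finite (W' d) \<and> card (W' d) \<le> (t + d choose t) * (d + 1) ^ d \<and> (\<forall>A\<in>W' d. finite A \<and> card A = t + d)"
        using TW(4) cV R(1) finR unfolding W'_def by (auto simp: V_def)
      have mono: "t \<le> card (C \<inter> B)" if "t \<le> card (C \<inter> B1)" "B1 \<subseteq> B" "finite C" for C B B1 :: "'a set"
        using that card_mono[of "C \<inter> B" "C \<inter> B1"] by (meson Int_mono finite_Int order_refl order_trans)
      have pair: "(\<exists>A'\<in>T'. \<exists>B'\<in>T'. A' \<subseteq> A \<and> B' \<subseteq> B) \<or>
          (\<exists>d. 2 \<le> d \<and> t + d \<le> Suc j \<and> (\<exists>C\<in>W' d. C \<subseteq> A \<and> t \<le> card (C \<inter> B) \<or> C \<subseteq> B \<and> t \<le> card (C \<inter> A)))"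
        if AB: "A \<in> T" "B \<in> T" for A B
      proof -
        obtain A1 B1 where 1: "A1 \<in> R" "A1 \<subseteq> A" "B1 \<in> R" "B1 \<subseteq> B" using R(5) AB by meson
        have t1: "t \<le> card (A1 \<inter> B1)" "t \<le> card (B1 \<inter> A1)"
          using R(2) 1 unfolding t_intersecting_def by blast+
        consider "A1 \<in> V" | "B1 \<in> V" | "A1 \<in> R - V" "B1 \<in> R - V" using 1 by blast
        thus ?thesis
        proof cases
          case a: 1
          have "t \<le> card (A1 \<inter> B)" using mono[OF t1(1) 1(4)] finR 1 by blast
          thus ?thesis using a 1 d by (intro disjI2 exI[of _ d]) (auto simp: W'_def)
        next
          case b: 2
          have "t \<le> card (B1 \<inter> A)" using mono[OF t1(2) 1(2)] finR 1 by blast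
          thus ?thesis using b 1 d by (intro disjI2 exI[of _ d]) (auto simp: W'_def)
        next
          case c: 3
          consider A' B' where "A' \<in> T'" "B' \<in> T'" "A' \<subseteq> A1" "B' \<subseteq> B1"
            | d' C where "2 \<le> d'" "t + d' \<le> j" "C \<in> W d'"
              "C \<subseteq> A1 \<and> t \<le> card (C \<inter> B1) \<or> C \<subseteq> B1 \<and> t \<le> card (C \<inter> A1)"
            using TW(5) c by meson
          thus ?thesis
          proof cases
            case x: 1
            have "A' \<subseteq> A" "B' \<subseteq> B" using x 1 by auto
            thus ?thesis using x(1,2) by (intro disjI1) blast
          next
            case y: 2
            have fC: "finite C" using TW(4) y by blast
            have "C \<in> W' d'" using y d by (auto simp: W'_def)
            moreover have "C \<subseteq> A \<and> t \<le> card (C \<inter> B) \<or> C \<subseteq> B \<and> t \<le> card (C \<inter> A)"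
              using y(4)
            proof
              assume "C \<subseteq> A1 \<and> t \<le> card (C \<inter> B1)"
              thus ?thesis using mono[OF _ 1(4) fC] 1(2) by (intro disjI1) auto
            next
              assume "C \<subseteq> B1 \<and> t \<le> card (C \<inter> A1)"
              thus ?thesis using mono[OF _ 1(2) fC] 1(4) by (intro disjI2) auto
            qed
            ultimately have "\<exists>C\<in>W' d'. C \<subseteq> A \<and> t \<le> card (C \<inter> B) \<or> C \<subseteq> B \<and> t \<le> card (C \<inter> A)"
              by (rule rev_bexI)
            moreover have "t + d' \<le> Suc j" using y(2) by simp
            ultimately show ?thesis using y(1) by (intro disjI2) (rule exI[of _ d'], simp)
          qed
        qed
      qed
      have "\<forall>A\<in>T'. \<exists>B\<in>T. A \<subseteq> B"
      proof
        fix A assume "A \<in> T'"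
        then obtain B where "B \<in> R" "A \<subseteq> B" using TW(2) by blast
        moreover obtain B' where "B' \<in> T" "B \<subseteq> B'" using R(4) \<open>B \<in> R\<close> by blast
        ultimately show "\<exists>B\<in>T. A \<subseteq> B" by (meson order_trans)
      qed
      with TW(1) TW(3) W' ballI[OF ballI[OF pair]] show ?thesis
        by (intro exI[of _ T'] exI[of _ W'] conjI) assumption+
    qed
  qed
  then obtain T' W where TW: "t_intersecting t T'" "\<forall>A\<in>T'. \<exists>B\<in>T. A \<subseteq> B" "\<forall>A\<in>T'. card A \<le> t + 1"
    "\<forall>d. finite (W d) \<and> card (W d) \<le> (t + d choose t) * (d + 1) ^ d \<and>
      (\<forall>A\<in>W d. finite A \<and> card A = t + d)"
    "\<forall>A\<in>T. \<forall>B\<in>T. (\<exists>A'\<in>T'. \<exists>B'\<in>T'. A' \<subseteq> A \<and> B' \<subseteq> B) \<or>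
      (\<exists>d. 2 \<le> d \<and> t + d \<le> j \<and> (\<exists>C\<in>W d. C \<subseteq> A \<and> t \<le> card (C \<inter> B) \<or> C \<subseteq> B \<and> t \<le> card (C \<inter> A)))"
    by - (elim exE conjE, rule that)
  have W: "finite (W d)" "card (W d) \<le> (t + d choose t) * (d + 1) ^ d"
    "A \<in> W d \<Longrightarrow> finite A \<and> card A = t + d" for d A
    using TW(4) by blast+
  show ?thesis
    by (rule that[OF TW(1) bspec[OF TW(2)] bspec[OF TW(3)] W bspec[OF bspec[OF TW(5)]]])
qed

text \<open>A member of size \<open>t\<close> lies in all others. Otherwise take distinct
  \<open>A = K \<union> {a}\<close> and \<open>B = K \<union> {b}\<close>: a member that omits a
  point of \<open>K\<close> needs both \<open>a\<close> and \<open>b\<close> and then lies in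
  \<open>A \<union> B\<close>. If there is such a member, every member through \<open>K\<close> must
  take its extra point from it, so all lie in \<open>A \<union> B\<close>. Families with at most one
  member count as stars.\<close>

lemma t_intersecting_small_cases:
  assumes int: "t_intersecting t T" and small: "\<And>A. A \<in> T \<Longrightarrow> card A \<le> t + 1"
    and X: "finite X" "t \<le> card X" "\<And>A. A \<in> T \<Longrightarrow> A \<subseteq> X"
  obtains (star) K where "K \<subseteq> X" "card K = t" "\<And>A. A \<in> T \<Longrightarrow> K \<subseteq> A"
    | (triangle) Y where "Y \<subseteq> X" "card Y = t + 2" "\<And>A. A \<in> T \<Longrightarrow> A \<subseteq> Y \<and> card A = t + 1"
proof -
  have fin: "finite A" if "A \<in> T" for A using X that finite_subset by blast
  have ge: "t \<le> card (A \<inter> B)" if "A \<in> T" "B \<in> T" for A B using int that unfolding t_intersecting_def by blast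
  have geA: "t \<le> card A" if "A \<in> T" for A using ge[OF that that] by simp
  show ?thesis
  proof (cases "\<exists>K\<in>T. card K = t")
    case True
    then obtain K where K: "K \<in> T" "card K = t" by blast
    have "K \<subseteq> A" if "A \<in> T" for A
    proof -
      have "K \<inter> A = K" using ge[OF K(1) that] K fin by (intro card_seteq) auto
      thus ?thesis by blast
    qed
    thus ?thesis using star[of K] K X by blast
  next
    case False
    have c1: "card A = t + 1" if "A \<in> T" for A
      using geA[OF that] small[OF that] False that by (metis Suc_eq_plus1 le_SucE le_antisym)
    show ?thesis
    proof (cases "\<exists>A\<in>T. \<exists>B\<in>T. A \<noteq> B")
      case no: False
      show ?thesis
      proof (cases "T = {}")
        case True
        obtain K where "K \<subseteq> X" "card K = t" using X by (meson obtain_subset_with_card_n)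
        thus ?thesis using star[of K] True by blast
      next
        case ne: False
        then obtain A where A: "A \<in> T" by blast
        obtain K where "K \<subseteq> A" "card K = t" using c1[OF A] obtain_subset_with_card_n[of t A] by auto
        thus ?thesis using star[of K] A no X by (metis order_trans)
      qed
    next
      case True
      then obtain A B where AB: "A \<in> T" "B \<in> T" "A \<noteq> B" by blast
      define K where "K = A \<inter> B"
      have "card K \<noteq> t + 1"
      proof
        assume "card K = t + 1"
        hence "K = A" "K = B"
          using c1 AB fin card_subset_eq[of A K] card_subset_eq[of B K] by (auto simp: K_def)
        thus False using AB by blast
      qed
      moreover have "card K \<le> card A" unfolding K_def using AB fin by (intro card_mono) auto
      ultimately have cK: "card K = t" using ge[OF AB(1,2)] c1[OF AB(1)] by (simp add: K_def)
      have cU: "card (A \<union> B) = t + 2"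
        using card_Un_Int[of A B] fin AB c1 cK by (simp add: K_def)
      obtain a where a: "A = insert a K" "a \<notin> K"
      proof -
        have "card (A - K) = 1" using cK c1 AB fin by (simp add: K_def card_Diff_subset_Int)
        then obtain a where "A - K = {a}" by (auto simp: card_1_singleton_iff)
        thus ?thesis using that[of a] by (auto simp: K_def)
      qed
      obtain b where b: "B = insert b K" "b \<notin> K"
      proof -
        have "card (B - K) = 1" using cK c1[OF AB(2)] fin[OF AB(2)] card_Diff_subset[of K B] finite_subset[of K B]
          by (simp add: K_def)
        then obtain b where "B - K = {b}" by (auto simp: card_1_singleton_iff)
        thus ?thesis using that[of b] by (auto simp: K_def)
      qed
      have fK: "finite K" using fin AB by (auto simp: K_def)
      have dich: "C \<subseteq> A \<union> B" if C: "C \<in> T" "\<not> K \<subseteq> C" for C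
      proof -
        have lt: "card (K \<inter> C) < t" using C fK cK psubset_card_mono[of K "K \<inter> C"] by blast
        have aC: "a \<in> C"
        proof (rule ccontr)
          assume "a \<notin> C"
          hence "A \<inter> C = K \<inter> C" using a by auto
          thus False using ge[OF AB(1) C(1)] lt by simp
        qed
        have bC: "b \<in> C"
        proof (rule ccontr)
          assume "b \<notin> C"
          hence "B \<inter> C = K \<inter> C" using b by auto
          thus False using ge[OF AB(2) C(1)] lt by simp
        qed
        have "A \<inter> C = insert a (K \<inter> C)" using a aC by auto
        hence "t \<le> Suc (card (K \<inter> C))" using ge[OF AB(1) C(1)] a fK by simp
        moreover have "(A \<union> B) \<inter> C = insert a (insert b (K \<inter> C))" using a b aC bC by auto
        moreover have "a \<noteq> b" using a b AB by auto
        ultimately have "card C \<le> card ((A \<union> B) \<inter> C)" using c1[OF C(1)] a b fK by simp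
        hence "(A \<union> B) \<inter> C = C" using fin[OF C(1)] by (intro card_seteq) auto
        thus ?thesis by blast
      qed
      show ?thesis
      proof (cases "\<forall>C\<in>T. K \<subseteq> C")
        case True
        thus ?thesis using star[of K] cK X AB by (auto simp: K_def)
      next
        case nstar: False
        then obtain C0 where C0: "C0 \<in> T" "\<not> K \<subseteq> C0" by blast
        have C0s: "C0 \<subseteq> A \<union> B" using dich C0 by blast
        have sub: "C \<subseteq> A \<union> B" if C: "C \<in> T" for C
        proof (cases "K \<subseteq> C")
          case KC: True
          have "card (C - K) = 1" using KC c1[OF C] cK fK by (simp add: card_Diff_subset)
          then obtain x where x: "C - K = {x}" by (auto simp: card_1_singleton_iff)
          have "x \<in> C0"
          proof (rule ccontr)
            assume "x \<notin> C0"
            moreover have "C \<subseteq> insert x K" using x by auto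
            ultimately have "C \<inter> C0 \<subseteq> K" by auto
            moreover have "C \<inter> C0 \<noteq> K" using C0(2) by auto
            ultimately have "C \<inter> C0 \<subset> K" by (rule psubsetI)
            hence "card (C \<inter> C0) < t" using fK cK psubset_card_mono by metis
            thus False using ge[OF C C0(1)] by simp
          qed
          thus ?thesis using x C0s by (auto simp: K_def)
        next
          case False
          thus ?thesis by (rule dich[OF C])
        qed
        have "A \<union> B \<subseteq> X" using X(3) AB by simp
        thus ?thesis by (rule triangle[OF _ cU]) (simp add: sub c1)
      qed
    qed
  qed
qed

section \<open>Intersections of the Frankl family\<close>

lemma obtain_permutation_image:
  assumes "finite X" "A \<subseteq> X" "B \<subseteq> X" "card A = card B"
  obtains h where "bij_betw h X X" "h ` A = B"
proof -
  have fA: "finite A" "finite B" using assms finite_subset by blast+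
  obtain f where f: "bij_betw f A B" using assms fA finite_same_card_bij by blast
  have "card (X - A) = card (X - B)" using assms fA by (simp add: card_Diff_subset)
  then obtain g where g: "bij_betw g (X - A) (X - B)" using assms finite_same_card_bij by blast
  define h where "h = (\<lambda>x. if x \<in> A then f x else g x)"
  have hA: "bij_betw h A B" using f by (simp add: h_def cong: bij_betw_cong)
  have "bij_betw h (X - A) (X - B)" using g by (rule bij_betw_cong[THEN iffD1, rotated]) (auto simp: h_def)
  hence "bij_betw h (A \<union> (X - A)) (B \<union> (X - B))" by (intro bij_betw_combine[OF hA]) auto
  moreover have "A \<union> (X - A) = X" "B \<union> (X - B) = X" using assms by auto
  ultimately have "bij_betw h X X" by simp
  moreover have "h ` A = B" using hA by (simp add: bij_betw_def)
  ultimately show ?thesis by (rule that)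
qed

text \<open>An explicit form of the intersections of distinct members of the Frankl family built on
  \<open>Y\<close>: they always have this shape, and every set of this shape occurs once the ground
  set is large. \<open>Y\<close> is a parameter because the comparison uses the
  \<open>(t + 2)\<close>-set produced by peeling.\<close>

definition frankl_intersections :: "'a set \<Rightarrow> 'a set \<Rightarrow> nat \<Rightarrow> nat \<Rightarrow> 'a set set" where
  "frankl_intersections X Y k t = {I. I \<subseteq> X \<and> t \<le> card (I \<inter> Y) \<and> card I < k}"

lemma finite_frankl_intersections: "finite X \<Longrightarrow> finite (frankl_intersections X Y k t)"
  by (rule finite_subset[of _ "Pow X"]) (auto simp: frankl_intersections_def)

text \<open>A permutation of \<open>X\<close> carries \<open>Y\<close> to \<open>Y'\<close>. This
  allows the \<open>(t + 2)\<close>-set that arises in the argument to be exchanged for the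
  prescribed one.\<close>

lemma card_frankl_intersections_le:
  assumes fX: "finite X" and "Y \<subseteq> X" "Y' \<subseteq> X" "card Y = card Y'"
  shows "card (frankl_intersections X Y k t) \<le> card (frankl_intersections X Y' k t)"
proof -
  obtain h where h: "bij_betw h X X" "h ` Y = Y'" using obtain_permutation_image[OF assms] .
  have inj: "inj_on h X" and img: "h ` X = X" using h(1) by (auto simp: bij_betw_def)
  have "inj_on (image h) (frankl_intersections X Y k t)"
    by (rule inj_on_subset[OF inj_on_image_Pow[OF inj]]) (auto simp: frankl_intersections_def)
  moreover have "image h ` frankl_intersections X Y k t \<subseteq> frankl_intersections X Y' k t"
  proof (rule image_subsetI)
    fix I assume I: "I \<in> frankl_intersections X Y k t"
    hence IX: "I \<subseteq> X" by (simp add: frankl_intersections_def)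
    have "h ` I \<inter> Y' = h ` (I \<inter> Y)"
      using inj_on_image_Int[OF inj IX assms(2)] h(2) by simp
    moreover have "card (h ` (I \<inter> Y)) = card (I \<inter> Y)" "card (h ` I) = card I"
      using inj IX by (auto intro!: card_image intro: inj_on_subset)
    moreover have "h ` I \<subseteq> X" using IX img by blast
    ultimately show "h ` I \<in> frankl_intersections X Y' k t" using I by (simp add: frankl_intersections_def)
  qed
  ultimately show ?thesis using finite_frankl_intersections[OF fX] by (rule card_inj_on_le)
qed

text \<open>Add to \<open>I\<close> two different points \<open>x\<close> and \<open>y\<close>, each
  bringing the trace on \<open>Y\<close> to at least \<open>t + 1\<close>; if \<open>I\<close> has
  exactly \<open>t\<close> points in \<open>Y\<close>, these are the two missing ones. Disjoint sets
  of fresh points then fill both sets up to size \<open>k\<close>.\<close>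

lemma frankl_intersections_attained:
  assumes fX: "finite X" and Y: "Y \<subseteq> X" "card Y = t + 2" and big: "2 * k + t + 2 \<le> card X"
    and I: "I \<in> frankl_intersections X Y k t"
  shows "I \<in> distinct_intersections {A \<in> nsets X k. t + 1 \<le> card (A \<inter> Y)}"
proof -
  have IX: "I \<subseteq> X" "t \<le> card (I \<inter> Y)" "card I < k" using I by (auto simp: frankl_intersections_def)
  have fI: "finite I" "finite Y" using IX Y fX finite_subset by blast+
  obtain x y where xy: "x \<in> X - I" "y \<in> X - I" "x \<noteq> y" "t + 1 \<le> card (insert x I \<inter> Y)" "t + 1 \<le> card (insert y I \<inter> Y)"
  proof (cases "card (I \<inter> Y) = t")
    case True
    have "card (Y - I) = 2" using True Y fI by (simp add: card_Diff_subset_Int Int_commute)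
    then obtain x y where "Y - I = {x, y}" "x \<noteq> y" by (auto simp: card_2_iff)
    moreover from this have "insert x I \<inter> Y = insert x (I \<inter> Y)" "insert y I \<inter> Y = insert y (I \<inter> Y)"
      "x \<notin> I" "y \<notin> I" by auto
    ultimately show ?thesis using that[of x y] True Y fI by auto
  next
    case False
    have "card (X - I) = card X - card I" using IX fI by (simp add: card_Diff_subset)
    hence "2 \<le> card (X - I)" using big IX(3) by simp
    then obtain V where V: "V \<subseteq> X - I" "card V = 2" by (meson obtain_subset_with_card_n)
    then obtain x y where "V = {x, y}" "x \<noteq> y" by (auto simp: card_2_iff)
    moreover have "t + 1 \<le> card (insert z I \<inter> Y)" for z
    proof -
      have "card (I \<inter> Y) \<le> card (insert z I \<inter> Y)" using fI by (intro card_mono) auto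
      thus ?thesis using False IX by simp
    qed
    ultimately show ?thesis using that[of x y] V by auto
  qed
  define R where "R = X - I - Y - {x, y}"
  define s where "s = k - 1 - card I"
  have "card X \<le> card R + card (I \<union> Y \<union> {x, y})"
    using fX fI card_mono[of "R \<union> (I \<union> Y \<union> {x, y})" X] card_Un_le[of R "I \<union> Y \<union> {x, y}"]
    by (fastforce simp: R_def)
  also have "card (I \<union> Y \<union> {x, y}) \<le> card I + (t + 2) + 2"
    using card_Un_le[of "I \<union> Y" "{x, y}"] card_Un_le[of I Y] Y xy(3) by simp
  finally have "2 * s \<le> card R" using big IX(3) by (simp add: s_def)
  then obtain E where E: "E \<subseteq> R" "card E = 2 * s" by (meson obtain_subset_with_card_n)
  obtain E1 where E1: "E1 \<subseteq> E" "card E1 = s" using E obtain_subset_with_card_n[of s E] by auto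
  define E2 where "E2 = E - E1"
  have fE: "finite E" by (rule finite_subset[OF E(1)]) (simp add: R_def fX)
  have fE1: "finite E1" using E1 fE finite_subset by blast
  have cE2: "card E2 = s" using E E1 fE1 by (simp add: E2_def card_Diff_subset)
  define F where "F = insert x I \<union> E1"
  define G where "G = insert y I \<union> E2"
  have ER: "E1 \<inter> (insert x (insert y I)) = {}" "E2 \<inter> (insert x (insert y I)) = {}" "E1 \<inter> E2 = {}" "E1 \<subseteq> X" "E2 \<subseteq> X"
    using E E1 by (auto simp: R_def E2_def)
  have FX: "F \<in> nsets X k"
  proof -
    have "card F = card (insert x I) + card E1" unfolding F_def using fI fE1 ER by (intro card_Un_disjoint) auto
    also have "\<dots> = k" using xy E1 fI IX(3) by (simp add: s_def)
    finally show ?thesis using fI fE1 IX xy ER by (auto simp: nsets_def F_def)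
  qed
  have GX: "G \<in> nsets X k"
  proof -
    have "card G = card (insert y I) + card E2" unfolding G_def using fI fE ER
      by (intro card_Un_disjoint) (auto simp: E2_def)
    also have "\<dots> = k" using xy cE2 fI IX(3) by (simp add: s_def)
    finally show ?thesis using fI fE IX xy ER by (auto simp: nsets_def G_def E2_def)
  qed
  have ge: "t + 1 \<le> card (F \<inter> Y)" "t + 1 \<le> card (G \<inter> Y)"
    using xy(4,5) fI card_mono[of "F \<inter> Y" "insert x I \<inter> Y"] card_mono[of "G \<inter> Y" "insert y I \<inter> Y"]
    by (auto simp: F_def G_def intro: order_trans)
  have FG: "F \<inter> G = I" using ER xy by (auto simp: F_def G_def)
  have "x \<in> F" "x \<notin> G" using ER xy by (auto simp: F_def G_def)
  hence "F \<noteq> G" by blast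
  thus ?thesis using FX GX ge FG unfolding distinct_intersections_def by blast
qed

lemma card_Int_Int_ge:
  assumes "finite Y" "card Y = t + 2" "t + 1 \<le> card (F \<inter> Y)" "t + 1 \<le> card (G \<inter> Y)"
  shows "t \<le> card (F \<inter> G \<inter> Y)"
proof -
  have "card (F \<inter> Y) + card (G \<inter> Y) = card ((F \<inter> Y) \<union> (G \<inter> Y)) + card ((F \<inter> Y) \<inter> (G \<inter> Y))"
    using assms by (intro card_Un_Int) auto
  moreover have "card ((F \<inter> Y) \<union> (G \<inter> Y)) \<le> card Y" using assms by (intro card_mono) auto
  moreover have "(F \<inter> Y) \<inter> (G \<inter> Y) = F \<inter> G \<inter> Y" by auto
  ultimately show ?thesis using assms by simp
qed

lemma card_Int_less:
  assumes "F \<in> nsets X k" "G \<in> nsets X k" "F \<noteq> G"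
  shows "card (F \<inter> G) < k"
proof -
  have f: "finite F" "finite G" "card F = k" "card G = k" using assms by (auto simp: nsets_def)
  have "F \<inter> G \<noteq> F" using assms(3) f card_subset_eq[of G F] by auto
  hence "F \<inter> G \<subset> F" by blast
  thus ?thesis using f psubset_card_mono by metis
qed

lemma distinct_intersections_frankl_subset:
  assumes fX: "finite X" and Y: "Y \<subseteq> X" "card Y = t + 2" and A: "\<A> \<subseteq> nsets X k"
    and ge: "\<And>F. F \<in> \<A> \<Longrightarrow> t + 1 \<le> card (F \<inter> Y)"
  shows "distinct_intersections \<A> \<subseteq> frankl_intersections X Y k t"
proof
  fix I assume "I \<in> distinct_intersections \<A>"
  then obtain F G where FG: "I = F \<inter> G" "F \<in> \<A>" "G \<in> \<A>" "F \<noteq> G" by (auto simp: distinct_intersections_def)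
  have "finite Y" using Y fX finite_subset by blast
  hence "t \<le> card (I \<inter> Y)" using card_Int_Int_ge[of Y t F G] Y ge FG by blast
  moreover have "card I < k" using card_Int_less[of F X k G] FG A by blast
  moreover have "I \<subseteq> X" using FG A by (auto simp: nsets_def)
  ultimately show "I \<in> frankl_intersections X Y k t" by (simp add: frankl_intersections_def)
qed

lemma inj_on_Un_disjoint:
  assumes "\<And>p. p \<in> S \<Longrightarrow> fst p \<subseteq> A" "\<And>p. p \<in> S \<Longrightarrow> snd p \<subseteq> B" "A \<inter> B = {}"
  shows "inj_on (\<lambda>p. fst p \<union> snd p) S"
proof (rule inj_onI)
  fix p q assume pq: "p \<in> S" "q \<in> S" "fst p \<union> snd p = fst q \<union> snd q"
  have "fst r = (fst r \<union> snd r) \<inter> A \<and> snd r = (fst r \<union> snd r) \<inter> B" if "r \<in> S" for r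
    using assms(1)[OF that] assms(2)[OF that] assms(3) by blast
  from this[OF pq(1)] this[OF pq(2)] pq(3) have "fst p = fst q \<and> snd p = snd q" by metis
  thus "p = q" by (simp add: prod_eq_iff)
qed

text \<open>Only the main term is counted: intersections of maximal size \<open>k - 1\<close> that
  consist of \<open>t\<close> points of \<open>Y\<close> and \<open>m\<close> points
  outside.\<close>

lemma card_frankl_intersections_ge:
  assumes fX: "finite X" and Y: "Y \<subseteq> X" "card Y = t + 2" and k: "k = t + 1 + m"
  shows "((t + 2) choose 2) * ((card X - (t + 2)) choose m) \<le> card (frankl_intersections X Y k t)"
proof -
  have fY: "finite Y" using Y fX finite_subset by blast
  let ?S = "nsets Y t \<times> nsets (X - Y) m"
  have inj: "inj_on (\<lambda>p. fst p \<union> snd p) ?S"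
    by (rule inj_on_Un_disjoint[of _ Y "X - Y"]) (auto simp: nsets_def)
  have "(\<lambda>p. fst p \<union> snd p) ` ?S \<subseteq> frankl_intersections X Y k t"
  proof (rule image_subsetI)
    fix p assume p: "p \<in> ?S"
    define T P where "T = fst p" and "P = snd p"
    have TP: "T \<subseteq> Y" "finite T" "card T = t" "P \<subseteq> X - Y" "finite P" "card P = m"
      using p by (auto simp: nsets_def T_def P_def)
    have "(T \<union> P) \<inter> Y = T" using TP by auto
    moreover have "card (T \<union> P) = t + m" using TP by (subst card_Un_disjoint) auto
    ultimately have "T \<union> P \<in> frankl_intersections X Y k t"
      using TP Y k by (auto simp: frankl_intersections_def)
    thus "fst p \<union> snd p \<in> frankl_intersections X Y k t" by (simp add: T_def P_def)
  qed
  hence "card ?S \<le> card (frankl_intersections X Y k t)"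
    by (rule card_inj_on_le[OF inj _ finite_frankl_intersections[OF fX]])
  moreover have "(t + 2) choose t = (t + 2) choose 2" using binomial_symmetric[of t "t + 2"] by simp
  ultimately show ?thesis
    using fX fY Y by (simp add: card_cartesian_product card_nsets card_Diff_subset)
qed

text \<open>A random \<open>a\<close>-set can be sampled by drawing \<open>M\<close> independent \<open>m\<close>-sets and then an \<open>a\<close>-set
  disjoint from all of them. If the \<open>a\<close>-set is in \<open>Q\<close>, all the \<open>m\<close>-sets are in \<open>D\<close>.\<close>

lemma card_disjoint_family_power:
  fixes Q D :: "'a set set"
  assumes fX: "finite X" and Q: "Q \<subseteq> nsets X a"
    and D: "\<And>P G. P \<in> nsets X m \<Longrightarrow> G \<in> Q \<Longrightarrow> P \<inter> G = {} \<Longrightarrow> P \<in> D" and DX: "D \<subseteq> nsets X m"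
    and M: "M * m + a \<le> card X"
  shows "real (card Q) * real (card X choose m) ^ M \<le> real (card D) ^ M * real (card X choose a)"
proof -
  let ?N = "nsets X m"
  define L where "L = {xs. set xs \<subseteq> ?N \<and> length xs = M}"
  define w :: "'a set list \<Rightarrow> real" where "w = (\<lambda>xs. 1 / real ((card X - card (\<Union>(set xs))) choose a))"
  define A where "A = (\<lambda>G. {xs \<in> L. G \<inter> \<Union>(set xs) = {}})"
  \<comment> \<open>Up to the factor \<open>card L\<close>, this is the probability that the sampled
    \<open>a\<close>-set is \<open>G\<close>: after the list \<open>xs\<close>, each admissible set
    has probability \<open>w xs\<close>.\<close>
  define g where "g = (\<lambda>G. \<Sum>xs\<in>A G. w xs)"
  have fN: "finite ?N" by (rule finite_nsets[OF fX])
  have fL: "finite L" unfolding L_def by (rule finite_lists_length_eq[OF fN])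
  have fA: "finite (A G)" for G using fL by (simp add: A_def)
  have w0: "0 \<le> w xs" for xs by (simp add: w_def)
  have UX: "\<Union>(set xs) \<subseteq> X" if "xs \<in> L" for xs using that by (auto simp: L_def nsets_def)
  have cU: "card (\<Union>(set xs)) + a \<le> card X" if xs: "xs \<in> L" for xs
  proof -
    have "card (\<Union>(set xs)) \<le> (\<Sum>P\<in>set xs. card P)" using card_UN_le[of "set xs" "\<lambda>x. x"] by simp
    also have "\<dots> \<le> (\<Sum>P\<in>set xs. m)" using xs by (intro sum_mono) (auto simp: L_def nsets_def)
    also have "\<dots> = card (set xs) * m" by simp
    also have "\<dots> \<le> M * m" using card_length[of xs] xs by (intro mult_right_mono) (auto simp: L_def)
    finally show ?thesis using M by simp
  qed
  have cnt: "(\<Sum>G | G \<in> nsets X a \<and> G \<inter> \<Union>(set xs) = {}. w xs) = 1" if xs: "xs \<in> L" for xs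
  proof -
    have "{G. G \<in> nsets X a \<and> G \<inter> \<Union>(set xs) = {}} = nsets (X - \<Union>(set xs)) a"
      by (auto simp: nsets_def)
    hence "card {G. G \<in> nsets X a \<and> G \<inter> \<Union>(set xs) = {}} = (card X - card (\<Union>(set xs))) choose a"
      using fX UX[OF xs] by (simp add: card_nsets card_Diff_subset finite_subset)
    moreover have "(card X - card (\<Union>(set xs))) choose a > 0" using cU[OF xs] by (simp add: zero_less_binomial_iff)
    ultimately show ?thesis by (simp add: w_def)
  qed
  \<comment> \<open>A permutation taking \<open>G\<close> to \<open>G'\<close> maps the lists
    avoiding \<open>G\<close> to lists avoiding \<open>G'\<close> and preserves \<open>w\<close>.
    Exchanging the roles gives equality, so the sampled set is uniform.\<close>
  have gle: "g G \<le> g G'" if G: "G \<in> nsets X a" "G' \<in> nsets X a" for G G'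
  proof -
    have GX: "G \<subseteq> X" "G' \<subseteq> X" "card G = card G'" using G by (auto simp: nsets_def)
    obtain h where h: "bij_betw h X X" "h ` G = G'" using obtain_permutation_image[OF fX GX] .
    have inj: "inj_on h X" and img: "h ` X = X" using h(1) by (auto simp: bij_betw_def)
    have injL: "inj_on (map (image h)) (A G)"
    proof (rule inj_on_subset[OF inj_on_mapI])
      show "inj_on (image h) (\<Union>(set ` A G))"
        by (rule inj_on_subset[OF inj_on_image_Pow[OF inj]]) (auto simp: A_def L_def nsets_def)
    qed auto
    have Uh: "\<Union>(set (map (image h) xs)) = h ` \<Union>(set xs)" for xs by auto
    have wh: "w (map (image h) xs) = w xs" if "xs \<in> A G" for xs
    proof -
      have "card (h ` \<Union>(set xs)) = card (\<Union>(set xs))"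
        using UX[of xs] that inj by (intro card_image) (auto simp: A_def intro: inj_on_subset)
      thus ?thesis by (simp only: w_def Uh)
    qed
    have sub: "map (image h) ` A G \<subseteq> A G'"
    proof (rule image_subsetI)
      fix xs assume xs: "xs \<in> A G"
      hence xL: "xs \<in> L" and dis: "G \<inter> \<Union>(set xs) = {}" by (auto simp: A_def)
      have "h ` P \<in> ?N" if "P \<in> set xs" for P
      proof -
        have P: "P \<subseteq> X" "finite P" "card P = m" using xL that by (auto simp: L_def nsets_def)
        have "card (h ` P) = card P" using P inj by (intro card_image) (auto intro: inj_on_subset)
        thus ?thesis using P img by (auto simp: nsets_def)
      qed
      hence "map (image h) xs \<in> L" using xL by (auto simp: L_def)
      moreover have "G' \<inter> h ` \<Union>(set xs) = h ` (G \<inter> \<Union>(set xs))"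
        using inj_on_image_Int[OF inj GX(1) UX[OF xL]] h(2) by simp
      ultimately show "map (image h) xs \<in> A G'" unfolding A_def using dis Uh[of xs] by simp
    qed
    have "g G = (\<Sum>xs\<in>A G. w (map (image h) xs))" unfolding g_def using wh by (intro sum.cong) auto
    also have "\<dots> = (\<Sum>ys\<in>map (image h) ` A G. w ys)" using sum.reindex[OF injL, of w] by simp
    also have "\<dots> \<le> g G'" unfolding g_def using w0 sub fA by (intro sum_mono2) auto
    finally show ?thesis .
  qed
  show ?thesis
  proof (cases "Q = {}")
    case False
    then obtain G0 where G0: "G0 \<in> Q" by blast
    have G0a: "G0 \<in> nsets X a" using G0 Q by blast
    have geq: "g G = g G0" if "G \<in> nsets X a" for G using gle[OF that G0a] gle[OF G0a that] by simp
    have fNa: "finite (nsets X a)" by (rule finite_nsets[OF fX])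
    have swap: "(\<Sum>G\<in>nsets X a. g G) = (\<Sum>xs\<in>L. \<Sum>G | G \<in> nsets X a \<and> G \<inter> \<Union>(set xs) = {}. w xs)"
      unfolding g_def A_def by (rule sum.swap_restrict[OF fNa fL])
    have "real (card X choose a) * g G0 = (\<Sum>G\<in>nsets X a. g G)"
      using geq card_nsets[OF fX, of a] by simp
    also have "\<dots> = (\<Sum>xs\<in>L. 1)" unfolding swap using cnt by (intro sum.cong) auto
    also have "\<dots> = real (card L)" by simp
    also have "card L = (card X choose m) ^ M"
      unfolding L_def using card_lists_length_eq[OF fN, of M] card_nsets[OF fX, of m] by simp
    finally have 1: "real (card X choose a) * g G0 = real (card X choose m) ^ M" by simp
    define LD where "LD = {xs. set xs \<subseteq> D \<and> length xs = M}"
    have fD: "finite D" using DX fN finite_subset by blast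
    have fLD: "finite LD" unfolding LD_def by (rule finite_lists_length_eq[OF fD])
    have LDL: "LD \<subseteq> L" using DX by (auto simp: LD_def L_def)
    \<comment> \<open>For \<open>G\<close> in \<open>Q\<close>, every list that avoids
      \<open>G\<close> consists of members of \<open>D\<close> only. This is where the power
      \<open>M\<close> of the density of \<open>D\<close> comes from.\<close>
    have AQ: "A G = {xs \<in> LD. G \<inter> \<Union>(set xs) = {}}" if G: "G \<in> Q" for G
    proof -
      have "xs \<in> LD" if "xs \<in> A G" for xs
        using that D G unfolding A_def LD_def L_def by blast
      thus ?thesis using LDL by (auto simp: A_def)
    qed
    have fQ: "finite Q" using Q fNa finite_subset by blast
    have "real (card Q) * g G0 = (\<Sum>G\<in>Q. g G)" using geq Q by (simp add: subset_iff)
    also have "\<dots> = (\<Sum>G\<in>Q. \<Sum>xs | xs \<in> LD \<and> G \<inter> \<Union>(set xs) = {}. w xs)"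
      unfolding g_def using AQ by (intro sum.cong) auto
    also have "\<dots> = (\<Sum>xs\<in>LD. \<Sum>G | G \<in> Q \<and> G \<inter> \<Union>(set xs) = {}. w xs)"
      by (rule sum.swap_restrict[OF fQ fLD])
    also have "\<dots> \<le> (\<Sum>xs\<in>LD. \<Sum>G | G \<in> nsets X a \<and> G \<inter> \<Union>(set xs) = {}. w xs)"
      using Q w0 fNa by (intro sum_mono sum_mono2) auto
    also have "\<dots> = (\<Sum>xs\<in>LD. 1)" using cnt LDL by (intro sum.cong) auto
    also have "\<dots> = real (card LD)" by simp
    also have "card LD = card D ^ M" unfolding LD_def by (rule card_lists_length_eq[OF fD])
    finally have 2: "real (card Q) * g G0 \<le> real (card D) ^ M" by simp
    have "real (card Q) * real (card X choose m) ^ M = real (card X choose a) * (real (card Q) * g G0)"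
      unfolding 1[symmetric] by simp
    also have "\<dots> \<le> real (card X choose a) * real (card D) ^ M" by (intro mult_left_mono 2) simp
    finally show ?thesis by (simp add: mult.commute)
  qed simp
qed

section \<open>Losses and counting\<close>

text \<open>Since \<open>P \<union> T\<close> has \<open>k - 1\<close> elements, it can only be the
  intersection of \<open>P \<union> T \<union> {x}\<close> and
  \<open>P \<union> T \<union> {y}\<close>, where \<open>x\<close> and \<open>y\<close> are the two
  points of \<open>Y - T\<close>. Both sets must share \<open>t\<close> points with the outside
  member \<open>G\<close>, which avoids \<open>P\<close> and has at most \<open>t\<close> points in
  \<open>Y\<close>. This forces \<open>T = G \<inter> Y\<close>, the single exception.\<close>

lemma frankl_loss:
  assumes fX: "finite X" and Y: "Y \<subseteq> X" "card Y = t + 2" and F: "\<F> \<subseteq> nsets X k"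
    and int: "t_intersecting t \<F>" and k: "k = t + 1 + m"
  defines "D \<equiv> {P \<in> nsets (X - Y) m. \<exists>G\<in>\<F>. card (G \<inter> Y) \<le> t \<and> P \<inter> G = {}}"
  shows "card (distinct_intersections {F \<in> \<F>. t + 1 \<le> card (F \<inter> Y)}) + (((t + 2) choose 2) - 1) * card D
    \<le> card (frankl_intersections X Y k t)"
proof -
  let ?A = "{F \<in> \<F>. t + 1 \<le> card (F \<inter> Y)}"
  let ?J = "frankl_intersections X Y k t"
  have fY: "finite Y" using Y fX finite_subset by blast
  have fJ: "finite ?J" by (rule finite_frankl_intersections[OF fX])
  have sub: "distinct_intersections ?A \<subseteq> ?J"
    using F by (intro distinct_intersections_frankl_subset[OF fX Y]) auto
  have "\<forall>P\<in>D. \<exists>G. G \<in> \<F> \<and> card (G \<inter> Y) \<le> t \<and> P \<inter> G = {}" by (auto simp: D_def)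
  then obtain g where g: "\<And>P. P \<in> D \<Longrightarrow> g P \<in> \<F> \<and> card (g P \<inter> Y) \<le> t \<and> P \<inter> g P = {}" by metis
  \<comment> \<open>The destroyed intersections, encoded as pairs. If the trace of
    \<open>g P\<close> has fewer than \<open>t\<close> points, nothing is removed from
    \<open>nsets Y t\<close>, so the count below is an inequality.\<close>
  define S where "S = Sigma D (\<lambda>P. nsets Y t - {g P \<inter> Y})"
  have fD: "finite D" unfolding D_def using finite_nsets[of "X - Y" m] fX by simp
  have fN: "finite (nsets Y t)" by (rule finite_nsets[OF fY])
  have cN: "card (nsets Y t) = (t + 2) choose 2"
    using card_nsets[OF fY, of t] Y binomial_symmetric[of t "t + 2"] by simp
  have "(((t + 2) choose 2) - 1) * card D = (\<Sum>P\<in>D. ((t + 2) choose 2) - 1)"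
    by (simp only: sum_constant mult.commute of_nat_id)
  also have "\<dots> \<le> (\<Sum>P\<in>D. card (nsets Y t - {g P \<inter> Y}))"
    unfolding cN[symmetric] by (intro sum_mono) (simp only: card_Diff_singleton_if split: if_splits, simp)
  also have "\<dots> = card S" unfolding S_def using fD fN by (simp add: card_SigmaI)
  finally have cS: "(((t + 2) choose 2) - 1) * card D \<le> card S" .
  have Smem: "fst p \<in> D" "snd p \<in> nsets Y t" "snd p \<noteq> g (fst p) \<inter> Y" if "p \<in> S" for p
    using that by (simp_all add: S_def mem_Sigma_iff[of "fst p" "snd p", simplified])
  have DX: "P \<subseteq> X - Y" "finite P" "card P = m" if "P \<in> D" for P using that by (simp_all add: D_def nsets_def)
  have NY: "T \<subseteq> Y" "finite T" "card T = t" if "T \<in> nsets Y t" for T using that by (simp_all add: nsets_def)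
  have inj: "inj_on (\<lambda>p. fst p \<union> snd p) S"
    by (rule inj_on_Un_disjoint[of _ "X - Y" Y]) (use Smem DX NY in blast)+
  have lost: "fst p \<union> snd p \<in> ?J - distinct_intersections ?A" if p: "p \<in> S" for p
  proof -
    define P T where "P = fst p" and "T = snd p"
    have PT: "P \<in> D" "T \<in> nsets Y t" "T \<noteq> g P \<inter> Y" using Smem[OF p] by (simp_all add: P_def T_def)
    note P = DX[OF PT(1)] and T = NY[OF PT(2)]
    let ?G = "g P"
    have G: "?G \<in> \<F>" "card (?G \<inter> Y) \<le> t" "P \<inter> ?G = {}" using g[OF PT(1)] by auto
    have IY: "(P \<union> T) \<inter> Y = T" using P T by auto
    have cI: "card (P \<union> T) = m + t" using P T by (subst card_Un_disjoint) auto
    have J: "P \<union> T \<in> ?J" using IY cI P T Y k by (auto simp: frankl_intersections_def)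
    have "P \<union> T \<notin> distinct_intersections ?A"
    proof
      assume "P \<union> T \<in> distinct_intersections ?A"
      then obtain F H where FH: "P \<union> T = F \<inter> H" "F \<in> ?A" "H \<in> ?A" "F \<noteq> H"
        by (auto simp: distinct_intersections_def)
      have ext: "\<exists>x\<in>Y - T. K = insert x (P \<union> T)" if K: "K \<in> ?A" "P \<union> T \<subseteq> K" for K
      proof -
        have Kk: "finite K" "card K = k" using K F by (auto simp: nsets_def)
        have "\<not> K \<inter> Y \<subseteq> T"
        proof
          assume "K \<inter> Y \<subseteq> T"
          hence "card (K \<inter> Y) \<le> t" using T card_mono by metis
          thus False using K by simp
        qed
        then obtain x where x: "x \<in> K" "x \<in> Y" "x \<notin> T" by blast
        have "x \<notin> P" using x P by blast
        hence "card (insert x (P \<union> T)) = k" using x P T cI k by simp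
        hence "insert x (P \<union> T) = K" using Kk x K by (intro card_subset_eq) auto
        thus ?thesis using x by blast
      qed
      obtain x where x: "x \<in> Y - T" "F = insert x (P \<union> T)" using ext[OF FH(2)] FH(1) by blast
      obtain y where y: "y \<in> Y - T" "H = insert y (P \<union> T)" using ext[OF FH(3)] FH(1) by blast
      have xy: "x \<noteq> y" using x y FH by blast
      have tF: "t \<le> card (insert x T \<inter> ?G)"
      proof -
        have "t \<le> card (F \<inter> ?G)" using int FH G unfolding t_intersecting_def by blast
        moreover have "F \<inter> ?G = insert x T \<inter> ?G" using x G by blast
        ultimately show ?thesis by simp
      qed
      have tH: "t \<le> card (insert y T \<inter> ?G)"
      proof -
        have "t \<le> card (H \<inter> ?G)" using int FH G unfolding t_intersecting_def by blast
        moreover have "H \<inter> ?G = insert y T \<inter> ?G" using y G by blast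
        ultimately show ?thesis by simp
      qed
      \<comment> \<open>A point \<open>z\<close> of \<open>Y\<close> in the outside member, beyond
        \<open>t\<close> points of \<open>insert w T\<close>, would give that member more than
        \<open>t\<close> points in \<open>Y\<close>.\<close>
      have out: "z \<notin> ?G" if "z \<in> Y" "z \<notin> insert w T" "w \<in> Y" "t \<le> card (insert w T \<inter> ?G)" for z w
      proof
        assume z: "z \<in> ?G"
        have "insert z (insert w T \<inter> ?G) \<subseteq> ?G \<inter> Y" using z that T by blast
        hence "card (insert z (insert w T \<inter> ?G)) \<le> card (?G \<inter> Y)" using fY by (intro card_mono) auto
        thus False using that T G(2) by simp
      qed
      have "y \<notin> ?G" using out[of y x] x y xy tF by blast
      hence "insert y T \<inter> ?G = T \<inter> ?G" by blast
      hence "T \<inter> ?G = T" using tH T by (intro card_seteq) auto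
      hence "T \<subseteq> ?G \<inter> Y" using T by blast
      hence "T = ?G \<inter> Y" using fY G(2) T by (intro card_seteq) auto
      thus False using PT by blast
    qed
    thus ?thesis using J by (simp add: P_def T_def)
  qed
  have "(\<lambda>p. fst p \<union> snd p) ` S \<subseteq> ?J - distinct_intersections ?A"
    by (rule image_subsetI) (rule lost)
  hence "card S \<le> card (?J - distinct_intersections ?A)"
    by (rule card_inj_on_le[OF inj]) (rule finite_Diff[OF fJ])
  also have "\<dots> = card ?J - card (distinct_intersections ?A)"
    by (rule card_Diff_subset[OF finite_subset[OF sub fJ] sub])
  finally show ?thesis using cS card_mono[OF fJ sub] by linarith
qed

section \<open>Counting the intersections that involve few sets\<close>

lemma card_small_subsets:
  assumes "finite A"
  shows "card {U. U \<subseteq> A \<and> card U \<le> b} \<le> (\<Sum>u\<le>b. card A choose u)"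
proof -
  have "{U. U \<subseteq> A \<and> card U \<le> b} = (\<Union>u\<le>b. {U. U \<subseteq> A \<and> card U = u})" by auto
  hence "card {U. U \<subseteq> A \<and> card U \<le> b} \<le> (\<Sum>u\<le>b. card {U. U \<subseteq> A \<and> card U = u})"
    by (simp only:) (rule card_UN_le[OF finite_atMost])
  thus ?thesis using n_subsets[OF assms] by simp
qed

lemma sum_binomial_le_power: "(\<Sum>u\<le>b. k choose u) \<le> (k + 1) ^ b"
proof (induction b)
  case (Suc b)
  have "Suc b * (k choose Suc b) \<le> Suc b * (k * (k choose b))"
  proof -
    have "Suc b * (k choose Suc b) = (k - b) * (k choose b)"
      using binomial_absorb_comp[of k b] binomial_absorption[of b k] by (cases k) auto
    also have "\<dots> \<le> Suc b * (k * (k choose b))"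
      by (simp add: mult_right_mono trans_le_add1)
    finally show ?thesis .
  qed
  hence "(k choose Suc b) \<le> k * (k choose b)" by (subst (asm) mult_le_cancel1) simp
  also have "(k choose b) \<le> (\<Sum>u\<le>b. k choose u)" by (rule member_le_sum) auto
  finally have "(k choose Suc b) \<le> k * (\<Sum>u\<le>b. k choose u)" by simp
  hence "(\<Sum>u\<le>Suc b. k choose u) \<le> (k + 1) * (\<Sum>u\<le>b. k choose u)" by simp
  also have "\<dots> \<le> (k + 1) * (k + 1) ^ b" using Suc by (intro mult_left_mono) auto
  finally show ?case by simp
qed simp

text \<open>A subset of a member either omits at most \<open>b\<close> of its points and is
  described by those, or has fewer than \<open>k - b\<close> points and is counted among all small
  subsets of \<open>X\<close>. The parameter \<open>b\<close> balances the two terms.\<close>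

lemma card_subsets_of_members:
  assumes fX: "finite X" and G: "\<G> \<subseteq> nsets X k"
  shows "card {I. \<exists>G\<in>\<G>. I \<subseteq> G} \<le> card \<G> * (k + 1) ^ b + (\<Sum>e<k - b. card X choose e)"
proof -
  have fG: "finite \<G>" using G fX finite_nsets finite_subset by blast
  have GX: "G \<subseteq> X \<and> finite G \<and> card G = k" if "G \<in> \<G>" for G using that G by (auto simp: nsets_def)
  let ?S = "\<lambda>G. (\<lambda>U. G - U) ` {U. U \<subseteq> G \<and> card U \<le> b}"
  let ?R = "\<Union>e<k - b. {I. I \<subseteq> X \<and> card I = e}"
  have "{I. \<exists>G\<in>\<G>. I \<subseteq> G} \<subseteq> (\<Union>G\<in>\<G>. ?S G) \<union> ?R"
  proof
    fix I assume "I \<in> {I. \<exists>G\<in>\<G>. I \<subseteq> G}"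
    then obtain G where I: "G \<in> \<G>" "I \<subseteq> G" by blast
    show "I \<in> (\<Union>G\<in>\<G>. ?S G) \<union> ?R"
    proof (cases "card I < k - b")
      case True
      moreover have "I \<subseteq> X" using I(2) GX[OF I(1)] by blast
      ultimately show ?thesis by (intro UnI2) simp
    next
      case False
      have "card (G - I) = k - card I" using I GX[OF I(1)] by (simp add: card_Diff_subset finite_subset)
      hence "G - I \<in> {U. U \<subseteq> G \<and> card U \<le> b}" using False by auto
      moreover have "I = G - (G - I)" using I by auto
      ultimately have "I \<in> ?S G" by (rule image_eqI[rotated])
      thus ?thesis using I(1) by (intro UnI1 UN_I)
    qed
  qed
  moreover have "finite (?S G)" if "G \<in> \<G>" for G using GX[OF that] by simp
  hence "finite ((\<Union>G\<in>\<G>. ?S G) \<union> ?R)" using fG fX by simp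
  ultimately have "card {I. \<exists>G\<in>\<G>. I \<subseteq> G} \<le> card ((\<Union>G\<in>\<G>. ?S G) \<union> ?R)" by (rule card_mono[rotated])
  also have "\<dots> \<le> card (\<Union>G\<in>\<G>. ?S G) + card ?R" by (rule card_Un_le)
  also have "card (\<Union>G\<in>\<G>. ?S G) \<le> (\<Sum>G\<in>\<G>. card (?S G))" by (rule card_UN_le[OF fG])
  also have "(\<Sum>G\<in>\<G>. card (?S G)) \<le> (\<Sum>G\<in>\<G>. (k + 1) ^ b)"
  proof (rule sum_mono)
    fix G assume G: "G \<in> \<G>"
    have "card (?S G) \<le> card {U. U \<subseteq> G \<and> card U \<le> b}" using GX[OF G] by (intro card_image_le) auto
    also have "\<dots> \<le> (\<Sum>u\<le>b. k choose u)" using card_small_subsets[of G b] GX[OF G] by simp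
    also have "\<dots> \<le> (k + 1) ^ b" by (rule sum_binomial_le_power)
    finally show "card (?S G) \<le> (k + 1) ^ b" .
  qed
  also have "card ?R \<le> (\<Sum>e<k - b. card {I. I \<subseteq> X \<and> card I = e})" by (rule card_UN_le) simp
  also have "\<dots> = (\<Sum>e<k - b. card X choose e)" using n_subsets[OF fX] by simp
  finally show ?thesis by simp
qed

text \<open>\<open>F \<inter> G\<close> is determined by \<open>C\<close>, by the at most
  \<open>d\<close> points of \<open>C\<close> missing from \<open>G\<close>, and by its part outside
  \<open>C\<close>, which has at most \<open>k - (t + d)\<close> points.\<close>

lemma card_intersections_through:
  assumes fX: "finite X" and W: "finite W" "\<And>C. C \<in> W \<Longrightarrow> finite C \<and> card C = t + d"
  shows "card {F \<inter> G | F G. F \<in> nsets X k \<and> G \<in> nsets X k \<and> (\<exists>C\<in>W. C \<subseteq> F \<and> t \<le> card (C \<inter> G))}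
    \<le> card W * ((\<Sum>u\<le>d. (t + d) choose u) * (\<Sum>e\<le>k - (t + d). card X choose e))"
proof -
  let ?I = "{F \<inter> G | F G. F \<in> nsets X k \<and> G \<in> nsets X k \<and> (\<exists>C\<in>W. C \<subseteq> F \<and> t \<le> card (C \<inter> G))}"
  let ?E = "{E. E \<subseteq> X \<and> card E \<le> k - (t + d)}"
  let ?U = "\<lambda>C. {U. U \<subseteq> C \<and> card U \<le> d}"
  let ?S = "\<lambda>C. (\<lambda>p. (C - fst p) \<union> snd p) ` (?U C \<times> ?E)"
  have fUE: "finite (?U C \<times> ?E)" if "C \<in> W" for C using W(2)[OF that] fX by simp
  have "?I \<subseteq> (\<Union>C\<in>W. ?S C)"
  proof
    fix I assume "I \<in> ?I"
    then obtain F G C where I: "I = F \<inter> G" "F \<in> nsets X k" "C \<in> W" "C \<subseteq> F" "t \<le> card (C \<inter> G)" by blast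
    have F: "F \<subseteq> X" "finite F" "card F = k" using I by (auto simp: nsets_def)
    have C: "finite C" "card C = t + d" using W I by auto
    have "card (C - G) = card C - card (C \<inter> G)" using C by (simp add: card_Diff_subset_Int)
    hence 1: "C - G \<in> ?U C" using I C by auto
    have "card (I - C) \<le> card (F - C)" using I F by (intro card_mono) auto
    also have "\<dots> = k - (t + d)" using I F C by (simp add: card_Diff_subset)
    finally have 2: "I - C \<in> ?E" using I F by auto
    have "I = (C - (C - G)) \<union> (I - C)" using I by auto
    hence "I \<in> ?S C" using 1 2 by (intro image_eqI[of _ _ "(C - G, I - C)"]) auto
    thus "I \<in> (\<Union>C\<in>W. ?S C)" using I by blast
  qed
  hence "card ?I \<le> card (\<Union>C\<in>W. ?S C)" using W fUE by (intro card_mono) auto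
  also have "\<dots> \<le> (\<Sum>C\<in>W. card (?S C))" by (rule card_UN_le[OF W(1)])
  also have "\<dots> \<le> (\<Sum>C\<in>W. (\<Sum>u\<le>d. (t + d) choose u) * (\<Sum>e\<le>k - (t + d). card X choose e))"
  proof (rule sum_mono)
    fix C assume C: "C \<in> W"
    have "card (?S C) \<le> card (?U C \<times> ?E)" by (rule card_image_le[OF fUE[OF C]])
    also have "\<dots> = card (?U C) * card ?E" by (rule card_cartesian_product)
    also have "\<dots> \<le> (\<Sum>u\<le>d. (t + d) choose u) * (\<Sum>e\<le>k - (t + d). card X choose e)"
      using card_small_subsets[of C d] card_small_subsets[OF fX, of "k - (t + d)"] W(2)[OF C]
      by (intro mult_mono) auto
    finally show "card (?S C) \<le> (\<Sum>u\<le>d. (t + d) choose u) * (\<Sum>e\<le>k - (t + d). card X choose e)" .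
  qed
  finally show ?thesis by simp
qed

lemma card_star_intersections:
  assumes fX: "finite X" and K: "K \<subseteq> X" "card K = t"
  shows "card {I. K \<subseteq> I \<and> I \<subseteq> X \<and> card I < t + 1 + m} \<le> (\<Sum>e\<le>m. card X choose e)"
proof -
  let ?S = "{I. K \<subseteq> I \<and> I \<subseteq> X \<and> card I < t + 1 + m}"
  have fK: "finite K" using K fX finite_subset by blast
  have inj: "inj_on (\<lambda>I. I - K) ?S" by (rule inj_onI) blast
  have "(\<lambda>I. I - K) ` ?S \<subseteq> {E. E \<subseteq> X \<and> card E \<le> m}"
    using fK K by (auto simp: card_Diff_subset)
  hence "card ?S \<le> card {E. E \<subseteq> X \<and> card E \<le> m}" using fX by (intro card_inj_on_le[OF inj]) auto
  thus ?thesis using card_small_subsets[OF fX, of m] by simp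
qed

section \<open>Estimates for large ground sets\<close>

lemma self_power_le_fact: "real d ^ d \<le> 3 ^ d * fact d"
proof (induction d)
  case (Suc d)
  have "real (Suc d) ^ d \<le> 3 * real d ^ d"
  proof (cases "d = 0")
    case False
    have "(1 + 1 / real d) ^ d \<le> exp (1 / real d * real d)" by (rule one_plus_power_le_exp) simp
    also have "\<dots> \<le> 3" using False exp_le by simp
    finally have "(1 + 1 / real d) ^ d * real d ^ d \<le> 3 * real d ^ d" by (intro mult_right_mono) auto
    moreover have "(1 + 1 / real d) ^ d * real d ^ d = real (Suc d) ^ d"
      using False by (simp add: power_mult_distrib[symmetric] field_simps)
    ultimately show ?thesis by simp
  qed simp
  hence "real (Suc d) ^ d \<le> 3 * (3 ^ d * fact d)" using Suc by linarith
  hence "real (Suc d) * real (Suc d) ^ d \<le> real (Suc d) * (3 * (3 ^ d * fact d))"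
    by (intro mult_left_mono) auto
  thus ?case by (simp add: mult_ac)
qed simp

lemma binomial_self_power: "real (a choose d) * real d ^ d \<le> (3 * real a) ^ d"
proof -
  have "(a choose d) * fact d \<le> a ^ d" by (rule binomial_fact_pow)
  hence f: "real (a choose d) * fact d \<le> real a ^ d"
    by (metis of_nat_fact of_nat_le_iff of_nat_mult of_nat_power)
  have "real (a choose d) * real d ^ d \<le> real (a choose d) * (3 ^ d * fact d)"
    by (intro mult_left_mono self_power_le_fact) simp
  also have "\<dots> = 3 ^ d * (real (a choose d) * fact d)" by simp
  also have "\<dots> \<le> 3 ^ d * real a ^ d" using f by (intro mult_left_mono) auto
  finally show ?thesis by (simp add: power_mult_distrib)
qed

text \<open>Vandermonde's identity, after multiplying each term by a coefficient that is at least
  1.\<close>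

lemma sum_binomial_le_binomial: "(\<Sum>u\<le>d. (a choose u)) \<le> (a + d) choose d"
proof -
  have "(\<Sum>u\<le>d. (a choose u)) \<le> (\<Sum>u\<le>d. (a choose u) * (d choose (d - u)))"
  proof (rule sum_mono)
    fix u assume "u \<in> {..d}"
    have "1 \<le> d choose (d - u)" by (simp add: Suc_le_eq zero_less_binomial_iff)
    thus "(a choose u) \<le> (a choose u) * (d choose (d - u))" by simp
  qed
  thus ?thesis by (simp only: vandermonde)
qed

text \<open>This bounds the size of layer \<open>d\<close> times the number of ways to omit up to
  \<open>d\<close> points of one of its sets. Multiplied by \<open>d ^ d\<close>, both binomial
  coefficients take the form \<open>binomial_self_power\<close>, since
  \<open>(d + 1) ^ d \<le> (2 * d) ^ d\<close> supplies the second power of \<open>d\<close>. What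
  remains is the \<open>d\<close>-th power of
  \<open>18 * (t + d) * (t + 2 * d) \<le> 72 * (t^2 + d) * d\<close>; its term in \<open>t^2\<close>
  alone gains from \<open>d \<ge> 2\<close>.\<close>

lemma peel_coefficient_bound:
  assumes "2 \<le> d"
  shows "real ((t + d choose t) * (d + 1) ^ d) * real (\<Sum>u\<le>d. (t + d) choose u) \<le> (72 * (real t ^ 2 + real d)) ^ d"
proof -
  have "real (t + d choose t) = real (t + d choose d)" using binomial_symmetric[of t "t + d"] by simp
  hence "real ((t + d choose t) * (d + 1) ^ d) * real (\<Sum>u\<le>d. (t + d) choose u)
      = real (t + d choose d) * (real d + 1) ^ d * real (\<Sum>u\<le>d. (t + d) choose u)"
    by (simp add: add.commute)
  also have "\<dots> \<le> real (t + d choose d) * (real d + 1) ^ d * real ((t + d + d) choose d)"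
    by (intro mult_left_mono of_nat_mono sum_binomial_le_binomial) auto
  also have "\<dots> \<le> real (t + d choose d) * (2 * real d) ^ d * real ((t + d + d) choose d)"
    using assms by (intro mult_right_mono mult_left_mono power_mono) auto
  finally have "real ((t + d choose t) * (d + 1) ^ d) * real (\<Sum>u\<le>d. (t + d) choose u) * real d ^ d
      \<le> real (t + d choose d) * (2 * real d) ^ d * real ((t + d + d) choose d) * real d ^ d"
    by (intro mult_right_mono) auto
  also have "\<dots> = 2 ^ d * ((real (t + d choose d) * real d ^ d) * (real ((t + d + d) choose d) * real d ^ d))"
    by (simp add: power_mult_distrib mult_ac)
  also have "\<dots> \<le> 2 ^ d * ((3 * real (t + d)) ^ d * (3 * real (t + d + d)) ^ d)"
    by (intro mult_left_mono mult_mono binomial_self_power) auto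
  also have "\<dots> = (2 * ((3 * real (t + d)) * (3 * real (t + d + d)))) ^ d"
    by (simp only: power_mult_distrib)
  also have "\<dots> \<le> ((72 * (real t ^ 2 + real d)) * real d) ^ d"
  proof (rule power_mono)
    have tt: "real t \<le> real t ^ 2"
      by (metis le_square of_nat_mono of_nat_mult power2_eq_square)
    have "real t ^ 2 * 2 \<le> real t ^ 2 * real d" using assms by (intro mult_left_mono) auto
    moreover have "real t * real d \<le> real t ^ 2 * real d"
      by (intro mult_right_mono tt) simp
    moreover have "0 \<le> real d * real d" "0 \<le> real t ^ 2 * real d" by simp_all
    moreover have "2 * ((3 * real (t + d)) * (3 * real (t + d + d)))
        = 18 * real t ^ 2 + 54 * (real t * real d) + 36 * (real d * real d)"
      by (simp add: power2_eq_square algebra_simps)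
    moreover have "72 * (real t ^ 2 + real d) * real d = 72 * (real t ^ 2 * real d) + 72 * (real d * real d)"
      by (simp add: algebra_simps)
    ultimately show "2 * ((3 * real (t + d)) * (3 * real (t + d + d))) \<le> 72 * (real t ^ 2 + real d) * real d"
      by linarith
  qed simp
  finally show ?thesis using assms by (simp add: power_mult_distrib)
qed

text \<open>Divided by powers of \<open>k\<close>, the last two assumptions read
  \<open>v \<ge> 10 ^ 14 * sqrt k\<close> and \<open>v \<ge> 10 ^ 14 * t^2\<close>; the first is
  squared to avoid roots.\<close>

locale large_ground =
  fixes n k t m :: nat
  assumes t0: "0 < t" and k: "k = t + 1 + m"
    and n_sqrt: "10 ^ 28 * real k ^ 3 \<le> real n ^ 2" and n_t: "10 ^ 14 * (real k * real t ^ 2) \<le> real n"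
begin

definition v :: real where "v = real n / real k"
text \<open>This number serves both as the spread parameter, where \<open>2 * k \<le> x * n\<close>
  holds with equality, and as a bound for the ratio of consecutive binomial coefficients up to index
  \<open>k\<close>, where the factor 2 covers \<open>n - e \<ge> n / 2\<close>.\<close>

definition x :: real where "x = 2 * real k / real n"
text \<open>Small enough for kernels to be avoided (\<open>2 * (q * x) \<le> 1\<close>) and for the
  peeling terms to decay, yet of order \<open>v\<close>.\<close>

definition q :: nat where "q = nat \<lfloor>v / 10 ^ 4\<rfloor>"

lemma k0: "real k > 0" and k1: "real k \<ge> 2" using k t0 by auto

lemma v_ge_t: "10 ^ 14 * real t ^ 2 \<le> v"
  using n_t k0 by (simp add: v_def field_simps)

lemma v_ge: "10 ^ 14 \<le> v"
proof -
  have "1 \<le> real t ^ 2" using t0 by simp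
  hence "(10 :: real) ^ 14 * 1 \<le> 10 ^ 14 * real t ^ 2" by (intro mult_left_mono) auto
  from order_trans[OF this v_ge_t] show ?thesis by simp
qed

lemma n_eq: "real n = v * real k" using k0 by (simp add: v_def)

lemma n0: "real n > 0" using n_eq v_ge k0 by simp

lemma v_ge_k: "10 ^ 28 * real k \<le> v ^ 2"
proof -
  have "10 ^ 28 * real k * real k ^ 2 \<le> v ^ 2 * real k ^ 2"
    using n_sqrt unfolding n_eq by (simp add: power_mult_distrib power3_eq_cube power2_eq_square mult_ac)
  thus ?thesis using k0 by simp
qed

lemma x_eq: "x = 2 / v" using k0 n0 by (simp add: x_def v_def)

lemma x0: "0 < x" and x_small: "x \<le> 1 / 10 ^ 13"
  using v_ge by (auto simp: x_eq field_simps)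

lemma q_ge: "v / 10 ^ 4 - 1 \<le> real q" and q_le: "real q \<le> v / 10 ^ 4"
  using v_ge unfolding q_def by (auto simp: of_nat_nat floor_le_iff) linarith+

lemma n_le_v: "real n \<le> v ^ 3"
proof -
  have "v * real k \<le> v * v ^ 2" using v_ge_k v_ge k0 by (intro mult_left_mono) auto
  thus ?thesis by (simp add: n_eq power3_eq_cube power2_eq_square)
qed

text \<open>From \<open>n \<le> v ^ 3\<close> the logarithm of the left side is at most
  \<open>ln 100 + 12 * t * ln v\<close>. As \<open>t \<le> sqrt v / 10 ^ 7\<close> and
  \<open>ln v \<le> 2 * sqrt v\<close>, this is a tiny multiple of \<open>v\<close> plus a constant.
  The exponent \<open>2 * t + 2\<close> covers \<open>n ^ (t + 1)\<close> for passing from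
  \<open>n choose k\<close> to \<open>n choose m\<close> and a second one bounding
  \<open>(k + 1) ^ (t + 1)\<close>.\<close>

lemma q_large: "100 * real n ^ (2 * t + 2) \<le> 2 ^ q"
proof -
  have v0: "v > 0" "v \<ge> 1" using v_ge by auto
  have tv: "10 ^ 7 * real t \<le> sqrt v"
    by (rule real_le_rsqrt) (use v_ge_t in \<open>simp add: power_mult_distrib\<close>)
  have "real n ^ (2 * t + 2) \<le> (v ^ 3) ^ (2 * t + 2)" using n_le_v by (intro power_mono) auto
  also have "\<dots> = v ^ (3 * (2 * t + 2))" by (rule power_mult[symmetric])
  also have "\<dots> \<le> v ^ (12 * t)" using v0 t0 by (intro power_increasing) auto
  finally have "100 * real n ^ (2 * t + 2) \<le> 100 * v ^ (12 * t)" by simp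
  also have "100 * v ^ (12 * t) = exp (ln 100 + 12 * real t * ln v)"
    using v0 exp_of_nat_mult[of "12 * t" "ln v"] by (simp add: exp_add)
  also have "\<dots> \<le> exp (real q * ln 2)"
  proof -
    have "ln (sqrt v) \<le> sqrt v - 1" using v0 by (intro ln_le_minus_one) simp
    hence "ln v \<le> 2 * sqrt v" using v0 by (simp add: ln_sqrt)
    hence "12 * real t * ln v \<le> 12 * real t * (2 * sqrt v)" by (intro mult_left_mono) auto
    also have "\<dots> = 24 / 10 ^ 7 * (10 ^ 7 * real t * sqrt v)" by simp
    also have "\<dots> \<le> 24 / 10 ^ 7 * (sqrt v * sqrt v)"
      using v0 by (intro mult_left_mono mult_right_mono tv) auto
    also have "sqrt v * sqrt v = v" using v0 by simp
    finally have 1: "12 * real t * ln v \<le> 24 / 10 ^ 7 * v" .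
    have 2: "ln (100::real) \<le> 99" using ln_le_minus_one[of 100] by simp
    have "1/2 \<le> ln (2::real)" by (subst ln_ge_iff) (use exp_half_le2 in auto)
    hence "(v / 10 ^ 4 - 1) * (1/2) \<le> real q * ln 2"
      using q_ge v_ge by (intro mult_mono) auto
    thus ?thesis using 1 2 v_ge by simp
  qed
  also have "\<dots> = 2 ^ q" by (simp add: exp_of_nat_mult)
  finally show ?thesis .
qed

lemma q_room: "(q + 3) * m + k + t + 2 \<le> n" "2 * k + t + 2 \<le> n"
proof -
  have mk: "real m \<le> real k" "real t + 2 \<le> 2 * real k" using k t0 by auto
  have "real (q + 3) * real m \<le> real (q + 3) * real k" using mk by (intro mult_left_mono) auto
  hence "real ((q + 3) * m + k + t + 2) \<le> (real q + 6) * real k" using mk by (simp add: algebra_simps)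
  also have "\<dots> \<le> v * real k" using q_le v_ge k0 by (intro mult_right_mono) auto
  finally show "(q + 3) * m + k + t + 2 \<le> n" unfolding n_eq[symmetric] by (simp only: of_nat_le_iff)
  have "real (2 * k + t + 2) \<le> 4 * real k" using mk by simp
  also have "\<dots> \<le> v * real k" using v_ge k0 by (intro mult_right_mono) auto
  finally show "2 * k + t + 2 \<le> n" unfolding n_eq[symmetric] by (simp only: of_nat_le_iff)
qed

section \<open>Ratios and sums of binomial coefficients\<close>

lemma binomial_pred: assumes "Suc e \<le> k" shows "real (n choose e) \<le> x * real (n choose Suc e)"
proof -
  have en: "real e + 1 \<le> real k" "e \<le> n" "real (n - e) = real n - real e" using assms q_room(2) by auto
  have "real (Suc e) * real (n choose Suc e) = real (n - e) * real (n choose e)"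
    using binomial_absorption[of e n] binomial_absorb_comp[of n e] by (metis of_nat_mult)
  moreover have "real n / 2 \<le> real (n - e)" using en q_room(2) assms by simp
  hence "real n / 2 * real (n choose e) \<le> real (n - e) * real (n choose e)" by (intro mult_right_mono) auto
  moreover have "real (Suc e) * real (n choose Suc e) \<le> real k * real (n choose Suc e)"
    using assms by (intro mult_right_mono) auto
  ultimately have "real n / 2 * real (n choose e) \<le> real k * real (n choose Suc e)" by linarith
  thus ?thesis using n0 by (simp add: x_def field_simps)
qed

lemma binomial_shift: assumes "e + j \<le> k" shows "real (n choose e) \<le> x ^ j * real (n choose (e + j))"
  using assms
proof (induction j)
  case (Suc j)
  have "real (n choose e) \<le> x ^ j * real (n choose (e + j))" using Suc by simp
  also have "\<dots> \<le> x ^ j * (x * real (n choose Suc (e + j)))"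
    using Suc.prems x0 by (intro mult_left_mono binomial_pred) auto
  finally show ?case by (simp add: mult_ac)
qed simp

lemma sum_binomial: assumes "e \<le> k" shows "(\<Sum>i\<le>e. real (n choose i)) \<le> (1 + 2 * x) * real (n choose e)"
  using assms
proof (induction e)
  case (Suc e)
  have xs: "(1 + 2 * x) * x \<le> 2 * x" using x0 x_small by (intro mult_right_mono) auto
  have "(\<Sum>i\<le>Suc e. real (n choose i)) \<le> real (n choose Suc e) + (1 + 2 * x) * real (n choose e)"
    using Suc by simp
  also have "\<dots> \<le> real (n choose Suc e) + (1 + 2 * x) * (x * real (n choose Suc e))"
    using binomial_pred[OF Suc.prems] x0 by (intro add_left_mono mult_left_mono) auto
  also have "\<dots> = (1 + (1 + 2 * x) * x) * real (n choose Suc e)" by (simp add: algebra_simps)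
  also have "\<dots> \<le> (1 + 2 * x) * real (n choose Suc e)" using xs by (intro mult_right_mono) auto
  finally show ?case .
qed (use x0 in simp)

lemma sum_binomial_below: "(\<Sum>e<m - L. real (n choose e)) \<le> 2 * x ^ (L + 1) * real (n choose m)"
proof (cases "L < m")
  case True
  have e: "{..<m - L} = {..m - L - 1}" using True by auto
  have "(\<Sum>e<m - L. real (n choose e)) \<le> (1 + 2 * x) * real (n choose (m - L - 1))"
    unfolding e using k by (intro sum_binomial) auto
  also have "\<dots> \<le> 2 * (x ^ (L + 1) * real (n choose (m - L - 1 + (L + 1))))"
    using x_small x0 k True by (intro mult_mono binomial_shift) auto
  finally show ?thesis using True by simp
qed (use x0 in simp)

text \<open>Deleting one point of the ground set costs at most a factor \<open>1 - x\<close>, and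
  \<open>(t + 2) * x \<le> 1 / 100\<close> because \<open>v\<close> dominates
  \<open>t^2\<close>.\<close>

lemma binomial_reduced: "99 / 100 * real (n choose m) \<le> real ((n - (t + 2)) choose m)"
proof -
  have nm: "m + (t + 2) + k \<le> n" using q_room(2) k by simp
  have "(1 - real s * x) * real (n choose m) \<le> real ((n - s) choose m)" if "s \<le> t + 2" for s
    using that
  proof (induction s)
    case (Suc s)
    define a where "a = n - Suc s"
    have a: "n - s = Suc a" "m \<le> a" "real n / 2 \<le> real (Suc a)"
      using Suc.prems nm q_room(2) k by (auto simp: a_def)
    have "real (Suc a) * real (a choose m) = (real (Suc a) - real m) * real (Suc a choose m)"
      using binomial_absorb_comp[of "Suc a" m] a by (metis diff_Suc_1 le_SucI of_nat_diff of_nat_mult)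
    hence e: "real (a choose m) = (1 - real m / real (Suc a)) * real (Suc a choose m)"
      by (simp add: field_simps)
    have "real m / real (Suc a) \<le> real k / (real n / 2)"
      using a n0 k by (intro frac_le) auto
    moreover have "real k / (real n / 2) = x" by (simp add: x_def)
    ultimately have mx: "1 - x \<le> 1 - real m / real (Suc a)" by linarith
    have x1: "0 \<le> 1 - x" using x_small by simp
    have "(1 - real (Suc s) * x) * real (n choose m) \<le> (1 - x) * ((1 - real s * x) * real (n choose m))"
    proof -
      have "1 - real (Suc s) * x \<le> (1 - x) * (1 - real s * x)" using x0 by (simp add: algebra_simps)
      thus ?thesis by (metis mult.assoc mult_right_mono of_nat_0_le_iff)
    qed
    also have "\<dots> \<le> (1 - x) * real (Suc a choose m)"
      using Suc x1 a by (intro mult_left_mono) auto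
    also have "\<dots> \<le> real (a choose m)" unfolding e using mx by (intro mult_right_mono) auto
    finally show ?case by (simp add: a_def)
  qed simp
  from this[of "t + 2"] have 1: "(1 - real (t + 2) * x) * real (n choose m) \<le> real ((n - (t + 2)) choose m)" by simp
  have "100 * (r + 2) \<le> 300 * r ^ 2" if "1 \<le> r" for r :: real
    using self_le_power[OF that, of 2] that by simp
  from this[of "real t"] have "100 * real (t + 2) \<le> 300 * real t ^ 2" using t0 by simp
  also have "\<dots> \<le> v / 2" using v_ge_t v_ge by simp
  finally have "real (t + 2) * x \<le> 1 / 100" using v_ge by (simp add: x_eq field_simps)
  hence "99 / 100 * real (n choose m) \<le> (1 - real (t + 2) * x) * real (n choose m)"
    by (intro mult_right_mono) auto
  thus ?thesis using 1 by simp
qed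

lemma binomial_up: "real (n choose (e + j)) \<le> real n ^ j * real (n choose e)"
proof (induction j)
  case (Suc j)
  have "real (n choose Suc (e + j)) \<le> real n * real (n choose (e + j))"
  proof -
    have "real (Suc (e + j)) * real (n choose Suc (e + j)) = real (n - (e + j)) * real (n choose (e + j))"
      using binomial_absorption[of "e + j" n] binomial_absorb_comp[of n "e + j"] by (metis of_nat_mult)
    also have "\<dots> \<le> real n * real (n choose (e + j))" by (intro mult_right_mono) auto
    finally have "real (Suc (e + j)) * real (n choose Suc (e + j)) \<le> real n * real (n choose (e + j))" .
    moreover have "1 * real (n choose Suc (e + j)) \<le> real (Suc (e + j)) * real (n choose Suc (e + j))"
      by (intro mult_right_mono) auto
    ultimately show ?thesis by linarith
  qed
  also have "\<dots> \<le> real n * (real n ^ j * real (n choose e))" using Suc by (intro mult_left_mono) auto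
  finally show ?case by (simp add: mult_ac)
qed simp

lemma choose_two_bounds: "real ((t + 2) choose 2) \<ge> 3" "real t ^ 2 \<le> 2 * real ((t + 2) choose 2)"
proof -
  have "2 * ((t + 2) choose 2) = (t + 2) * (t + 1)"
    using Suc_times_binomial[of 1 "t + 1"] by (simp add: numeral_2_eq_2)
  hence "2 * real ((t + 2) choose 2) = real (t + 2) * real (t + 1)"
    by (metis of_nat_mult of_nat_numeral)
  hence "real ((t + 2) choose 2) = real (t + 2) * real (t + 1) / 2" by simp
  moreover have "1 \<le> real t" using t0 by simp
  hence "3 * 2 \<le> real (t + 2) * real (t + 1)" by (intro mult_mono) auto
  ultimately show "real ((t + 2) choose 2) \<ge> 3" "real t ^ 2 \<le> 2 * real ((t + 2) choose 2)"
    by (auto simp: power2_eq_square algebra_simps)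
qed

text \<open>With \<open>b = 72 * (t^2 + d)\<close>, layer \<open>d\<close> contributes at most
  \<open>2 * b ^ d * x ^ (d - 1)\<close> times \<open>n choose m\<close>. Since
  \<open>b * x \<le> 1 / 8\<close>, and \<open>b^2\<close> grows by at most a factor 4 per step from
  order \<open>t^4\<close>, the terms halve, and the sum has order \<open>t^4 * x\<close>, small
  against \<open>t^2\<close>. At \<open>d = 1\<close> no power of \<open>x\<close> would be left,
  which is why peeling stops at size \<open>t + 1\<close>.\<close>

lemma peel_total:
  "(\<Sum>d\<in>{d. 2 \<le> d \<and> t + d \<le> min q k}. real ((t + d choose t) * (d + 1) ^ d) *
      (real (\<Sum>u\<le>d. (t + d) choose u) * (\<Sum>e\<le>k - (t + d). real (n choose e))))
    \<le> real t ^ 2 / 100 * real (n choose m)" (is "(\<Sum>d\<in>?D. ?f d) \<le> _")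
proof -
  have v0: "v > 0" using v_ge by simp
  have fD: "finite ?D" by (rule finite_subset[of _ "{..k}"]) auto
  have tb: "?f d \<le> 10 ^ 6 * real t ^ 4 / v * (1/2) ^ (d - 2) * real (n choose m)" if d: "d \<in> ?D" for d
  proof -
    obtain c where c: "d = c + 2" using d by (metis (lifting) add.commute le_Suc_ex mem_Collect_eq)
    have dk: "t + d \<le> k" "real d \<le> real q" "2 \<le> d" using d by auto
    have "(\<Sum>e\<le>k - (t + d). real (n choose e)) \<le> (1 + 2 * x) * real (n choose (k - (t + d)))"
      by (intro sum_binomial) auto
    also have "\<dots> \<le> 2 * (x ^ (d - 1) * real (n choose (k - (t + d) + (d - 1))))"
      using x_small x0 dk by (intro mult_mono binomial_shift) auto
    also have "k - (t + d) + (d - 1) = m" using dk k by simp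
    finally have s: "(\<Sum>e\<le>k - (t + d). real (n choose e)) \<le> 2 * (x ^ (d - 1) * real (n choose m))" .
    define b where "b = 72 * (real t ^ 2 + real d)"
    have b0: "0 \<le> b" by (simp add: b_def)
    have "?f d = (real ((t + d choose t) * (d + 1) ^ d) * real (\<Sum>u\<le>d. (t + d) choose u)) * (\<Sum>e\<le>k - (t + d). real (n choose e))"
      by simp
    also have "\<dots> \<le> b ^ d * (2 * (x ^ (d - 1) * real (n choose m)))"
      unfolding b_def by (rule mult_mono[OF peel_coefficient_bound[OF dk(3)] s]) (auto intro: sum_nonneg)
    also have "\<dots> = 2 * (b ^ 2 * x) * (b * x) ^ c * real (n choose m)"
      by (simp add: c power_add power_mult_distrib power2_eq_square mult_ac)
    finally have f: "?f d \<le> 2 * (b ^ 2 * x) * (b * x) ^ c * real (n choose m)" .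
    have "b * x = 144 * (real t ^ 2 + real d) / v" by (simp add: b_def x_eq)
    also have "\<dots> \<le> 1 / 8"
    proof -
      have "1152 * (real t ^ 2 + real d) \<le> v" using v_ge_t dk(2) q_le v_ge by simp
      thus ?thesis using v0 by (simp add: field_simps)
    qed
    finally have bx: "b * x \<le> 1 / 8" .
    have t1: "1 \<le> real t ^ 2" using t0 by simp
    have "real d \<le> real t ^ 2 * real d" using mult_right_mono[OF t1, of "real d"] by simp
    hence "b \<le> 72 * (real t ^ 2 * (real c + 3))" unfolding b_def c by (simp add: algebra_simps)
    also have "\<dots> \<le> 72 * (real t ^ 2 * (3 * 2 ^ c))"
    proof -
      have "real c + 1 \<le> 2 ^ c" by (induction c) auto
      hence "real c + 3 \<le> 3 * 2 ^ c" by (smt (verit) of_nat_0_le_iff)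
      thus ?thesis by (intro mult_left_mono) auto
    qed
    finally have "b ^ 2 \<le> (72 * (real t ^ 2 * (3 * 2 ^ c))) ^ 2" using b0 by (intro power_mono)
    also have "\<dots> = 46656 * real t ^ 4 * 4 ^ c"
      by (simp add: power_mult_distrib power_mult[symmetric] mult.commute[of c] power_mult)
    finally have b2: "b ^ 2 \<le> 46656 * real t ^ 4 * 4 ^ c" .
    have "2 * (b ^ 2 * x) * (b * x) ^ c \<le> 2 * ((46656 * real t ^ 4 * 4 ^ c) * x) * (1/8) ^ c"
      using b2 bx b0 x0 by (intro mult_mono power_mono) auto
    also have "\<dots> = (186624 * real t ^ 4 / v) * (1/2) ^ c"
    proof -
      have "(4::real) ^ c * (1/8) ^ c = (1/2) ^ c" by (simp add: power_mult_distrib[symmetric])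
      thus ?thesis by (simp add: x_eq field_simps)
    qed
    also have "\<dots> \<le> (10 ^ 6 * real t ^ 4 / v) * (1/2) ^ c"
      using v0 by (intro mult_right_mono divide_right_mono) auto
    finally have "2 * (b ^ 2 * x) * (b * x) ^ c * real (n choose m) \<le> 10 ^ 6 * real t ^ 4 / v * (1/2) ^ c * real (n choose m)"
      by (intro mult_right_mono) auto
    thus ?thesis using f c by simp
  qed
  have geo: "(\<Sum>d\<in>?D. (1/2 :: real) ^ (d - 2)) \<le> 2"
  proof -
    have "(\<Sum>d\<in>?D. (1/2 :: real) ^ (d - 2)) \<le> (\<Sum>d\<in>(\<lambda>c. c + 2) ` {..k}. (1/2 :: real) ^ (d - 2))"
    proof (rule sum_mono2)
      show "?D \<subseteq> (\<lambda>c. c + 2) ` {..k}"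
      proof
        fix d assume "d \<in> ?D"
        thus "d \<in> (\<lambda>c. c + 2) ` {..k}" by (intro image_eqI[of _ _ "d - 2"]) auto
      qed
    qed auto
    also have "\<dots> = (\<Sum>c\<le>k. (1/2 :: real) ^ c)" by (subst sum.reindex) (auto simp: inj_on_def)
    also have "\<dots> \<le> 2"
    proof -
      have "(\<Sum>c\<le>k. (1/2 :: real) ^ c) = 2 - (1/2) ^ k" by (induction k) auto
      thus ?thesis by simp
    qed
    finally show ?thesis .
  qed
  have "(\<Sum>d\<in>?D. ?f d) \<le> (\<Sum>d\<in>?D. 10 ^ 6 * real t ^ 4 / v * (1/2) ^ (d - 2) * real (n choose m))"
    by (rule sum_mono[OF tb])
  also have "\<dots> = 10 ^ 6 * real t ^ 4 / v * real (n choose m) * (\<Sum>d\<in>?D. (1/2 :: real) ^ (d - 2))"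
    unfolding sum_distrib_left by (intro sum.cong refl) (simp only: mult_ac)
  also have "\<dots> \<le> 10 ^ 6 * real t ^ 4 / v * real (n choose m) * 2"
    using geo v0 by (intro mult_left_mono) auto
  also have "\<dots> \<le> real t ^ 2 / 100 * real (n choose m)"
  proof -
    have "2 * 10 ^ 8 * real t ^ 2 \<le> 10 ^ 14 * real t ^ 2" by (intro mult_right_mono) auto
    hence "2 * 10 ^ 8 * real t ^ 2 \<le> v" using v_ge_t by (rule order_trans)
    hence "real t ^ 2 * (2 * 10 ^ 8 * real t ^ 2) \<le> real t ^ 2 * v" by (intro mult_left_mono) auto
    hence "2 * 10 ^ 6 * real t ^ 4 / v \<le> real t ^ 2 / 100"
      using v0 by (simp add: field_simps power2_eq_square power4_eq_xxxx)
    hence "2 * 10 ^ 6 * real t ^ 4 / v * real (n choose m) \<le> real t ^ 2 / 100 * real (n choose m)"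
      by (intro mult_right_mono) auto
    thus ?thesis by simp
  qed
  finally show ?thesis .
qed

end

text \<open>The outside members are split by their trace \<open>S\<close> on \<open>Y\<close>.
  Removing the trace leaves \<open>(k - card S)\<close>-sets in \<open>X - Y\<close>, to which the
  sampling bound applies with the same \<open>D\<close>. Summed over \<open>S\<close>, the numbers
  of all such sets stay below \<open>n choose k\<close>, since gluing trace and rest back together
  is injective.\<close>

lemma card_outside_power:
  fixes \<F> :: "'a set set"
  assumes fX: "finite X" and Y: "Y \<subseteq> X" "card Y = t + 2" and F: "\<F> \<subseteq> nsets X k" and tk: "t \<le> k"
    and M: "M * m + k + t + 2 \<le> card X"
  defines "G \<equiv> {F \<in> \<F>. card (F \<inter> Y) \<le> t}"
  defines "D \<equiv> {P \<in> nsets (X - Y) m. \<exists>F\<in>\<F>. card (F \<inter> Y) \<le> t \<and> P \<inter> F = {}}"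
  shows "real (card G) * real ((card X - (t + 2)) choose m) ^ M \<le> real (card D) ^ M * real (card X choose k)"
proof -
  have fY: "finite Y" using Y fX finite_subset by blast
  have fXY: "finite (X - Y)" using fX by simp
  have cXY: "card (X - Y) = card X - (t + 2)" using Y fY by (simp add: card_Diff_subset)
  have fG: "finite G" unfolding G_def using finite_subset[OF F finite_nsets[OF fX]] by simp
  have GX: "F \<subseteq> X" "finite F" "card F = k" "card (F \<inter> Y) \<le> t" "F \<in> \<F>" if "F \<in> G" for F
    using that F by (auto simp: G_def nsets_def)
  define Z where "Z = {S. S \<subseteq> Y \<and> card S \<le> t}"
  have fZ: "finite Z" unfolding Z_def using fY by simp
  let ?B = "real ((card X - (t + 2)) choose m)"
  have each: "real (card {F \<in> G. F \<inter> Y = S}) * ?B ^ M \<le> real (card D) ^ M * real (card (nsets (X - Y) (k - card S)))"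
    if S: "S \<in> Z" for S
  proof -
    define Q where "Q = (\<lambda>F. F - Y) ` {F \<in> G. F \<inter> Y = S}"
    have "inj_on (\<lambda>F. F - Y) {F \<in> G. F \<inter> Y = S}" by (rule inj_onI) blast
    hence cQ: "card Q = card {F \<in> G. F \<inter> Y = S}" unfolding Q_def by (rule card_image)
    have Qn: "Q \<subseteq> nsets (X - Y) (k - card S)"
    proof (unfold Q_def, rule image_subsetI)
      fix F assume A: "F \<in> {F \<in> G. F \<inter> Y = S}"
      hence FG: "F \<in> G" by simp
      have "card (F - Y) = card F - card (F \<inter> Y)" using GX(2)[OF FG] by (intro card_Diff_subset_Int) simp
      hence "card (F - Y) = k - card S" using GX(3)[OF FG] A by simp
      thus "F - Y \<in> nsets (X - Y) (k - card S)" using GX(1,2)[OF FG] by (auto simp: nsets_def)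
    qed
    have DQ: "P \<in> D" if PH: "P \<in> nsets (X - Y) m" "H \<in> Q" "P \<inter> H = {}" for P H
    proof -
      obtain F where F: "F \<in> G" "H = F - Y" using PH(2) by (auto simp: Q_def)
      have "P \<subseteq> X - Y" using PH(1) by (simp add: nsets_def)
      hence "P \<inter> F = {}" using PH(3) F(2) by blast
      thus ?thesis using PH(1) GX(4,5)[OF F(1)] unfolding D_def by blast
    qed
    have DX: "D \<subseteq> nsets (X - Y) m" by (auto simp: D_def)
    have "M * m + (k - card S) \<le> card (X - Y)" using M by (simp add: cXY)
    from card_disjoint_family_power[OF fXY Qn DQ DX this]
    show ?thesis by (simp add: cQ cXY card_nsets[OF fXY])
  qed
  have "card G = card (\<Union>S\<in>Z. {F \<in> G. F \<inter> Y = S})"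
  proof (rule arg_cong[where f = card])
    have "F \<in> (\<Union>S\<in>Z. {F \<in> G. F \<inter> Y = S})" if "F \<in> G" for F using that GX(4)[OF that] by (auto simp: Z_def)
    thus "G = (\<Union>S\<in>Z. {F \<in> G. F \<inter> Y = S})" by auto
  qed
  also have "\<dots> \<le> (\<Sum>S\<in>Z. card {F \<in> G. F \<inter> Y = S})" by (rule card_UN_le[OF fZ])
  finally have "real (card G) \<le> (\<Sum>S\<in>Z. real (card {F \<in> G. F \<inter> Y = S}))"
    using of_nat_mono by fastforce
  hence "real (card G) * ?B ^ M \<le> (\<Sum>S\<in>Z. real (card {F \<in> G. F \<inter> Y = S})) * ?B ^ M"
    by (intro mult_right_mono) auto
  also have "\<dots> \<le> (\<Sum>S\<in>Z. real (card D) ^ M * real (card (nsets (X - Y) (k - card S))))"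
    unfolding sum_distrib_right by (intro sum_mono each)
  also have "\<dots> = real (card D) ^ M * real (\<Sum>S\<in>Z. card (nsets (X - Y) (k - card S)))"
    by (simp add: sum_distrib_left)
  also have "(\<Sum>S\<in>Z. card (nsets (X - Y) (k - card S))) = card (Sigma Z (\<lambda>S. nsets (X - Y) (k - card S)))"
    using fZ finite_nsets[OF fXY] by (simp add: card_SigmaI)
  also have "card (Sigma Z (\<lambda>S. nsets (X - Y) (k - card S))) \<le> card (nsets X k)"
  proof (rule card_inj_on_le[OF inj_on_Un_disjoint[of _ Y "X - Y"]])
    show "(\<lambda>p. fst p \<union> snd p) ` Sigma Z (\<lambda>S. nsets (X - Y) (k - card S)) \<subseteq> nsets X k"
    proof (rule image_subsetI)
      fix p assume p: "p \<in> Sigma Z (\<lambda>S. nsets (X - Y) (k - card S))"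
      obtain S E where SE: "p = (S, E)" by (cases p)
      have S: "S \<subseteq> Y" "card S \<le> t" and E: "E \<subseteq> X - Y" "finite E" "card E = k - card S"
        using p by (auto simp: SE Z_def nsets_def)
      have "finite S" using S fY finite_subset by blast
      hence "card (S \<union> E) = card S + card E" using S E by (intro card_Un_disjoint) auto
      hence "S \<union> E \<in> nsets X k" using S E Y tk \<open>finite S\<close> by (auto simp: nsets_def)
      thus "fst p \<union> snd p \<in> nsets X k" by (simp add: SE)
    qed
  qed (auto simp: Z_def nsets_def finite_nsets[OF fX, unfolded nsets_def])
  also have "card (nsets X k) = card X choose k" by (rule card_nsets[OF fX])
  finally show ?thesis by (simp add: mult_left_mono)
qed

context large_ground
begin

text \<open>Let \<open>d = \<delta> / B\<close>, with \<open>B\<close> the binomial coefficient in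
  the second assumption, so that \<open>c \<le> d ^ (q + 3) * (n choose k)\<close>. Both terms must
  be linear in \<open>d\<close>. For \<open>b = t + 1 + L\<close>, two of the three extra factors
  \<open>d\<close> pay for \<open>(k + 1) ^ L\<close>, the third is kept, and
  \<open>d ^ q \<le> 2 ^ (- q)\<close> absorbs the powers of \<open>n\<close>.\<close>

lemma gains_numeric:
  assumes d: "0 < \<delta>" "10 * \<delta> \<le> real ((n - (t + 2)) choose m)"
    and c: "c * real ((n - (t + 2)) choose m) ^ (q + 3) \<le> \<delta> ^ (q + 3) * real (n choose k)"
  obtains b where "c * (real k + 1) ^ b + (\<Sum>e<k - b. real (n choose e)) \<le> \<delta>"
proof -
  define B where "B = real ((n - (t + 2)) choose m)"
  define U where "U = real (n choose m)"
  have dB: "10 * \<delta> \<le> B" unfolding B_def by (rule assms(2))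
  have B0: "B > 0" using assms(1) dB by linarith
  have UB: "99 / 100 * U \<le> B" using binomial_reduced by (simp add: U_def B_def)
  define d where "d = \<delta> / B"
  have d01: "0 < d" "d \<le> 1 / 10" using assms(1) dB B0 by (auto simp: d_def field_simps)
  have delta: "\<delta> = d * B" using B0 by (simp add: d_def)
  have U0: "0 \<le> U" by (simp add: U_def)
  have "c * B ^ (q + 3) \<le> d ^ (q + 3) * real (n choose k) * B ^ (q + 3)"
    using c unfolding B_def[symmetric] delta by (simp add: power_mult_distrib mult_ac)
  hence c1: "c \<le> d ^ (q + 3) * real (n choose k)" using B0 by simp
  have "real (n choose k) \<le> real n ^ (t + 1) * U"
    unfolding U_def using binomial_up[of m "t + 1"] k by (simp add: add_ac)
  hence "d ^ (q + 3) * real (n choose k) \<le> d ^ (q + 3) * (real n ^ (t + 1) * U)"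
    using d01 by (intro mult_left_mono) auto
  with c1 have c2: "c \<le> d ^ (q + 3) * (real n ^ (t + 1) * U)" by linarith
  have x1: "x < 1" using x_small by simp
  obtain N0 where "x ^ N0 < d / 4" using real_arch_pow_inv[of "d / 4" x] d01 x1 by auto
  hence ex: "x ^ (Suc N0) \<le> d / 4" using x0 x1 by (smt (verit) mult_left_le_one_le power_Suc zero_le_power)
  \<comment> \<open>The least \<open>L\<close> for which the sets of size below \<open>m - L\<close>
    number at most \<open>d / 2\<close> times \<open>n choose m\<close>. Leastness gives
    \<open>d / 4 \<le> x ^ L\<close>, and with \<open>(k + 1) * x^2 \<le> 1\<close>, where
    \<open>v\<close> beats \<open>sqrt k\<close> again, also
    \<open>(k + 1) ^ L * d^2 \<le> 16\<close>.\<close>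
  define L where "L = (LEAST L. x ^ (Suc L) \<le> d / 4)"
  have L1: "x ^ (Suc L) \<le> d / 4" unfolding L_def by (rule LeastI[of "\<lambda>L. x ^ (Suc L) \<le> d / 4", OF ex])
  have L2: "d / 4 \<le> x ^ L"
  proof (cases L)
    case (Suc L')
    hence "\<not> x ^ (Suc L') \<le> d / 4" using not_less_Least[of L' "\<lambda>L. x ^ (Suc L) \<le> d / 4"] by (simp add: L_def)
    thus ?thesis using Suc by simp
  qed (use d01 in simp)
  have kx: "(real k + 1) * x ^ 2 \<le> 1"
  proof -
    have "4 * (real k + 1) \<le> 10 ^ 28 * real k" using k1 by simp
    also have "\<dots> \<le> v ^ 2" by (rule v_ge_k)
    finally show ?thesis using v_ge by (simp add: x_eq power_divide field_simps)
  qed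
  have kL: "(real k + 1) ^ L * d ^ 2 \<le> 16"
  proof -
    have "(d / 4) ^ 2 \<le> (x ^ L) ^ 2" using L2 d01 by (intro power_mono) auto
    hence "d ^ 2 \<le> 16 * (x ^ L) ^ 2" by (simp add: power_divide)
    hence "(real k + 1) ^ L * d ^ 2 \<le> (real k + 1) ^ L * (16 * (x ^ L) ^ 2)" by (intro mult_left_mono) auto
    also have "\<dots> = 16 * ((real k + 1) * x ^ 2) ^ L"
      by (simp add: power_mult_distrib power_mult[symmetric] mult_ac)
    also have "\<dots> \<le> 16 * 1" using kx by (intro mult_left_mono power_le_one) auto
    finally show ?thesis by simp
  qed
  define b where "b = t + 1 + L"
  have "real k + 1 \<le> real n" using q_room(2) by simp
  hence kt: "(real k + 1) ^ (t + 1) \<le> real n ^ (t + 1)" by (intro power_mono) auto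
  have "c * (real k + 1) ^ b \<le> d ^ (q + 3) * (real n ^ (t + 1) * U) * (real k + 1) ^ b"
    using c2 by (intro mult_right_mono) auto
  also have "\<dots> = (d ^ (q + 1) * (real n ^ (t + 1) * U)) * ((real k + 1) ^ (t + 1) * ((real k + 1) ^ L * d ^ 2))"
    by (simp add: b_def power_add power2_eq_square power3_eq_cube mult_ac)
  also have "\<dots> \<le> (d ^ (q + 1) * (real n ^ (t + 1) * U)) * (real n ^ (t + 1) * 16)"
    using kt kL d01 U0 by (intro mult_left_mono mult_mono) auto
  also have "\<dots> = 16 * d * U * (d ^ q * real n ^ (2 * t + 2))"
    by (simp add: power_add power_mult mult_ac power2_eq_square mult_2)
  also have "\<dots> \<le> 16 * d * U * (1 / 100)"
  proof (rule mult_left_mono)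
    have "d ^ q * real n ^ (2 * t + 2) \<le> (1 / 2) ^ q * real n ^ (2 * t + 2)"
      using d01 by (intro mult_right_mono power_mono) auto
    also have "\<dots> \<le> 1 / 100" using q_large by (simp add: power_divide field_simps)
    finally show "d ^ q * real n ^ (2 * t + 2) \<le> 1 / 100" .
  qed (use d01 U0 in auto)
  finally have p1: "c * (real k + 1) ^ b \<le> 16 / 100 * (d * U)" by (simp add: mult_ac)
  have "k - b = m - L" using k by (simp add: b_def)
  hence "(\<Sum>e<k - b. real (n choose e)) \<le> 2 * x ^ (Suc L) * U"
    using sum_binomial_below[of L] by (simp add: U_def)
  also have "\<dots> \<le> 2 * (d / 4) * U" using L1 U0 by (intro mult_right_mono mult_left_mono) auto
  finally have p2: "(\<Sum>e<k - b. real (n choose e)) \<le> 1 / 2 * (d * U)" by simp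
  have "99 / 100 * (d * U) \<le> d * B" using mult_left_mono[OF UB, of d] d01 by simp
  moreover have "0 \<le> d * U" using d01 U0 by simp
  ultimately have "c * (real k + 1) ^ b + (\<Sum>e<k - b. real (n choose e)) \<le> \<delta>"
    using p1 p2 unfolding delta by linarith
  thus ?thesis by (rule that)
qed

text \<open>With \<open>b = t + 1\<close> the small subsets have size below \<open>m\<close>, so
  they number \<open>O(x)\<close> times \<open>n choose m\<close>, while \<open>2 ^ q\<close> beats
  the count of the others.\<close>

lemma remainder_numeric:
  assumes "2 ^ q * r \<le> real (n choose k)"
  shows "r * (real k + 1) ^ (t + 1) + (\<Sum>e<k - (t + 1). real (n choose e)) \<le> 1 / 50 * real (n choose m)"
proof -
  let ?U = "real (n choose m)"
  have "real k + 1 \<le> real n" using q_room(2) by simp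
  hence kt: "(real k + 1) ^ (t + 1) \<le> real n ^ (t + 1)" by (intro power_mono) auto
  have "2 ^ q * (r * (real k + 1) ^ (t + 1)) \<le> real (n choose k) * (real k + 1) ^ (t + 1)"
    using mult_right_mono[OF assms, of "(real k + 1) ^ (t + 1)"] by (simp add: mult_ac)
  also have "\<dots> \<le> (real n ^ (t + 1) * ?U) * real n ^ (t + 1)"
  proof -
    have "real (n choose k) \<le> real n ^ (t + 1) * ?U"
      using binomial_up[of m "t + 1"] k by (simp add: add_ac)
    thus ?thesis using kt by (intro mult_mono) auto
  qed
  also have "\<dots> = real n ^ (2 * t + 2) * ?U"
  proof -
    have "2 * t + 2 = (t + 1) + (t + 1)" by simp
    thus ?thesis by (simp only: power_add mult_ac)
  qed
  also have "\<dots> \<le> 2 ^ q * (1 / 100 * ?U)"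
    using mult_right_mono[OF q_large, of ?U] by (simp add: mult_ac)
  finally have 1: "r * (real k + 1) ^ (t + 1) \<le> 1 / 100 * ?U" by simp
  have "(\<Sum>e<k - (t + 1). real (n choose e)) \<le> 2 * x * ?U"
    using sum_binomial_below[of 0] k by simp
  also have "\<dots> \<le> 1 / 100 * ?U" using x_small by (intro mult_right_mono) auto
  finally show ?thesis using 1 by simp
qed

end

section \<open>Comparison with the Frankl family\<close>

context large_ground
begin

text \<open>\<open>E\<close> collects the intersections that involve a peeled layer or the
  remainder. In the star case, and in the triangle case when \<open>D\<close> is large, comparing
  main terms with \<open>E\<close> suffices. When \<open>D\<close> is small, \<open>E\<close> is too
  coarse: the pairs are divided instead into those inside the Frankl family on \<open>Y\<close> and
  those that involve a member of \<open>G\<close>.\<close>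

lemma card_intersections_le:
  fixes X :: "'a set"
  assumes fX: "finite X" "card X = n" and F: "\<F> \<subseteq> nsets X k" and int: "t_intersecting t \<F>"
    and Y0: "Y0 \<subseteq> X" "card Y0 = t + 2"
  shows "card (distinct_intersections \<F>) \<le> card (frankl_intersections X Y0 k t)"
proof -
  let ?U = "real (n choose m)" and ?N = "n - (t + 2)"
  let ?B = "real (?N choose m)" and ?C = "real ((t + 2) choose 2)"
  have U0: "0 \<le> ?U" by simp
  have y: "2 * real k \<le> x * real (card X)" "2 * x \<le> 1/1000" "real k * (2 * x)\<^sup>2 \<le> 1/10000"
    "2 * (real q * x) \<le> 1"
  proof -
    show "2 * real k \<le> x * real (card X)" using n0 fX by (simp add: x_def)
    show "2 * x \<le> 1/1000" using x_small by simp
    show "real k * (2 * x)\<^sup>2 \<le> 1/10000"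
      using v_ge_k v_ge by (simp add: x_eq power_divide field_simps)
    show "2 * (real q * x) \<le> 1" using q_le v_ge by (simp add: x_eq field_simps)
  qed
  obtain S where S: "t_intersecting t S" "\<And>A. A \<in> S \<Longrightarrow> \<exists>F\<in>\<F>. A \<subseteq> F" "\<And>A. A \<in> S \<Longrightarrow> card A \<le> q"
    "2 ^ q * real (card {F \<in> \<F>. \<forall>A\<in>S. \<not> A \<subseteq> F}) \<le> real (card X choose k)"
    by (rule spread_approximation[OF fX(1) F int x0 y], rule that)
  have FX: "F \<subseteq> X" "finite F" "card F = k" if "F \<in> \<F>" for F
    using subsetD[OF F that] by (simp_all add: nsets_def)
  have SX: "A \<subseteq> X" if "A \<in> S" for A using S(2)[OF that] FX(1) by blast
  have fS: "finite S" by (rule finite_subset[of _ "Pow X"]) (use SX fX in auto)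
  have fA: "finite A" if "A \<in> S" for A using finite_subset[OF SX[OF that] fX(1)] .
  have cA: "card A \<le> min q k" if A: "A \<in> S" for A
  proof -
    obtain F where "F \<in> \<F>" "A \<subseteq> F" using S(2)[OF A] by blast
    hence "card A \<le> k" using FX card_mono by metis
    thus ?thesis using S(3)[OF A] by simp
  qed
  obtain T W where T: "t_intersecting t T" "\<And>A. A \<in> T \<Longrightarrow> \<exists>B\<in>S. A \<subseteq> B" "\<And>A. A \<in> T \<Longrightarrow> card A \<le> t + 1"
    and W: "\<And>d. finite (W d)" "\<And>d. card (W d) \<le> (t + d choose t) * (d + 1) ^ d"
      "\<And>d A. A \<in> W d \<Longrightarrow> finite A \<and> card A = t + d"
    and TW: "\<And>A B. A \<in> S \<Longrightarrow> B \<in> S \<Longrightarrow> (\<exists>A'\<in>T. \<exists>B'\<in>T. A' \<subseteq> A \<and> B' \<subseteq> B) \<or>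
      (\<exists>d. 2 \<le> d \<and> t + d \<le> min q k \<and> (\<exists>C\<in>W d. C \<subseteq> A \<and> t \<le> card (C \<inter> B) \<or> C \<subseteq> B \<and> t \<le> card (C \<inter> A)))"
    by (rule peel[OF t0 fS fA S(1) cA]) (assumption+, rule that)
  have TX: "A \<subseteq> X" if "A \<in> T" for A using T(2)[OF that] SX by blast
  define F0 where "F0 = {F \<in> \<F>. \<forall>A\<in>S. \<not> A \<subseteq> F}"
  define R where "R = (\<lambda>d. {F \<inter> G | F G. F \<in> nsets X k \<and> G \<in> nsets X k \<and> (\<exists>C\<in>W d. C \<subseteq> F \<and> t \<le> card (C \<inter> G))})"
  define Ds where "Ds = {d. 2 \<le> d \<and> t + d \<le> min q k}"
  define E where "E = (\<Union>d\<in>Ds. R d) \<union> {I. \<exists>G\<in>F0. I \<subseteq> G}"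
  define both where "both = (\<lambda>F G. \<exists>A\<in>T. \<exists>B\<in>T. A \<subseteq> F \<and> B \<subseteq> G)"
  have pair: "both F G \<or> F \<inter> G \<in> E" if FG: "F \<in> \<F>" "G \<in> \<F>" for F G
  proof (cases "F \<in> F0 \<or> G \<in> F0")
    case True
    hence "F \<inter> G \<in> {I. \<exists>G\<in>F0. I \<subseteq> G}" by blast
    thus ?thesis unfolding E_def by blast
  next
    case False
    obtain A where A: "A \<in> S" "A \<subseteq> F" using False FG by (auto simp: F0_def)
    obtain B where B: "B \<in> S" "B \<subseteq> G" using False FG by (auto simp: F0_def)
    have FGk: "F \<in> nsets X k" "G \<in> nsets X k" using FG F by blast+
    have mono: "t \<le> card (C \<inter> H)" if C: "C \<in> W d" and H: "A' \<subseteq> H" "t \<le> card (C \<inter> A')" for C H A' d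
    proof -
      have "card (C \<inter> A') \<le> card (C \<inter> H)" using W(3)[OF C] H(1) by (intro card_mono) auto
      thus ?thesis using H(2) by simp
    qed
    from TW[OF A(1) B(1)] show ?thesis
    proof (elim disjE exE conjE bexE)
      fix A' B' assume "A' \<in> T" "B' \<in> T" "A' \<subseteq> A" "B' \<subseteq> B"
      moreover from this have "A' \<subseteq> F" "B' \<subseteq> G" using A(2) B(2) by auto
      ultimately show ?thesis unfolding both_def by (intro disjI1) blast
    next
      fix d C assume d: "2 \<le> d" "t + d \<le> min q k" and C: "C \<in> W d" "C \<subseteq> A" "t \<le> card (C \<inter> B)"
      have "t \<le> card (C \<inter> G)" by (rule mono[OF C(1) B(2) C(3)])
      moreover have "C \<subseteq> F" using C(2) A(2) by simp
      ultimately have "F \<inter> G \<in> R d" using FGk C(1) unfolding R_def by blast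
      thus ?thesis using d by (auto simp: E_def Ds_def)
    next
      fix d C assume d: "2 \<le> d" "t + d \<le> min q k" and C: "C \<in> W d" "C \<subseteq> B" "t \<le> card (C \<inter> A)"
      have "t \<le> card (C \<inter> F)" by (rule mono[OF C(1) A(2) C(3)])
      moreover have "C \<subseteq> G" using C(2) B(2) by simp
      ultimately have "G \<inter> F \<in> R d" using FGk C(1) unfolding R_def by blast
      thus ?thesis using d by (auto simp: E_def Ds_def Int_commute)
    qed
  qed
  have fE: "finite E"
  proof (rule finite_subset[of _ "Pow X"])
    show "E \<subseteq> Pow X" using FX(1) by (auto simp: E_def R_def F0_def nsets_def)
  qed (use fX in simp)
  have cE: "real (card E) \<le> (real t ^ 2 / 100 + 1 / 50) * ?U"
  proof -
    have fDs: "finite Ds" unfolding Ds_def by (rule finite_subset[of _ "{..k}"]) auto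
    have "card (\<Union>d\<in>Ds. R d) \<le> (\<Sum>d\<in>Ds. card (R d))" by (rule card_UN_le[OF fDs])
    also have "\<dots> \<le> (\<Sum>d\<in>Ds. (t + d choose t) * (d + 1) ^ d * ((\<Sum>u\<le>d. (t + d) choose u) * (\<Sum>e\<le>k - (t + d). n choose e)))"
    proof (rule sum_mono)
      fix d assume "d \<in> Ds"
      have "card (R d) \<le> card (W d) * ((\<Sum>u\<le>d. (t + d) choose u) * (\<Sum>e\<le>k - (t + d). card X choose e))"
        unfolding R_def by (rule card_intersections_through[OF fX(1) W(1) W(3)])
      also have "\<dots> \<le> (t + d choose t) * (d + 1) ^ d * ((\<Sum>u\<le>d. (t + d) choose u) * (\<Sum>e\<le>k - (t + d). card X choose e))"
        by (intro mult_right_mono W(2)) simp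
      finally show "card (R d) \<le> (t + d choose t) * (d + 1) ^ d * ((\<Sum>u\<le>d. (t + d) choose u) * (\<Sum>e\<le>k - (t + d). n choose e))"
        by (simp only: fX(2))
    qed
    finally have "real (card (\<Union>d\<in>Ds. R d)) \<le> real (\<Sum>d\<in>Ds. (t + d choose t) * (d + 1) ^ d * ((\<Sum>u\<le>d. (t + d) choose u) * (\<Sum>e\<le>k - (t + d). n choose e)))"
      by (rule of_nat_mono)
    also have "\<dots> = (\<Sum>d\<in>Ds. real ((t + d choose t) * (d + 1) ^ d) * (real (\<Sum>u\<le>d. (t + d) choose u) * (\<Sum>e\<le>k - (t + d). real (n choose e))))"
      by (simp only: of_nat_sum of_nat_mult)
    also have "\<dots> \<le> real t ^ 2 / 100 * ?U" unfolding Ds_def by (rule peel_total)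
    finally have 1: "real (card (\<Union>d\<in>Ds. R d)) \<le> real t ^ 2 / 100 * ?U" .
    have F0n: "F0 \<subseteq> nsets X k" using F by (auto simp: F0_def)
    have "real (card {I. \<exists>G\<in>F0. I \<subseteq> G}) \<le> real (card F0 * (k + 1) ^ (t + 1) + (\<Sum>e<k - (t + 1). card X choose e))"
      by (intro of_nat_mono card_subsets_of_members[OF fX(1) F0n])
    also have "\<dots> = real (card F0) * (real k + 1) ^ (t + 1) + (\<Sum>e<k - (t + 1). real (n choose e))"
      by (simp only: fX(2) of_nat_add of_nat_mult of_nat_power of_nat_sum of_nat_1)
    also have "\<dots> \<le> 1 / 50 * ?U"
      by (rule remainder_numeric) (use S(4) fX(2) in \<open>simp add: F0_def\<close>)
    finally have 2: "real (card {I. \<exists>G\<in>F0. I \<subseteq> G}) \<le> 1 / 50 * ?U" .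
    have "card E \<le> card (\<Union>d\<in>Ds. R d) + card {I. \<exists>G\<in>F0. I \<subseteq> G}" unfolding E_def by (rule card_Un_le)
    from of_nat_mono[OF this, where 'a = real]
    have "real (card E) \<le> real (card (\<Union>d\<in>Ds. R d)) + real (card {I. \<exists>G\<in>F0. I \<subseteq> G})"
      by (simp only: of_nat_add)
    thus ?thesis using 1 2 by (simp add: algebra_simps)
  qed
  have cE2: "real (card E) \<le> ?C / 30 * ?U"
  proof -
    \<comment> \<open>From \<open>t^2 \<le> 2 * C\<close> and \<open>C \<ge> 3\<close>, with
      \<open>C\<close> the binomial coefficient \<open>t + 2\<close> over 2, the left side is at
      most \<open>C * (1 / 50 + 1 / 150) = 2 * C / 75\<close>.\<close>
    have "real t ^ 2 / 100 + 1 / 50 \<le> ?C / 30" using choose_two_bounds by simp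
    hence "(real t ^ 2 / 100 + 1 / 50) * ?U \<le> ?C / 30 * ?U" using U0 by (rule mult_right_mono)
    thus ?thesis using cE by linarith
  qed
  have CU: "3 * ?U \<le> ?C * ?U" using choose_two_bounds(1) U0 by (rule mult_right_mono)
  have CB: "?C * (99 / 100 * ?U) \<le> ?C * ?B" using binomial_reduced by (intro mult_left_mono) auto
  have tX: "t \<le> card X" using fX q_room(2) by simp
  have Jge: "?C * ?B \<le> real (card (frankl_intersections X Y0 k t))"
  proof -
    have "((t + 2) choose 2) * (?N choose m) \<le> card (frankl_intersections X Y0 k t)"
      using card_frankl_intersections_ge[OF fX(1) Y0 k] fX(2) by simp
    from of_nat_mono[OF this, where 'a = real] show ?thesis by (simp only: of_nat_mult)
  qed
  have lt: "card (F \<inter> G) < k" if "F \<in> \<F>" "G \<in> \<F>" "F \<noteq> G" for F G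
    using card_Int_less[of F X k G] that F by blast
  show ?thesis
  proof (rule t_intersecting_small_cases[OF T(1) T(3) fX(1) tX TX])
    fix K assume K: "K \<subseteq> X" "card K = t" "\<And>A. A \<in> T \<Longrightarrow> K \<subseteq> A"
    let ?I = "{I. K \<subseteq> I \<and> I \<subseteq> X \<and> card I < t + 1 + m}"
    have "distinct_intersections \<F> \<subseteq> ?I \<union> E"
    proof
      fix I assume "I \<in> distinct_intersections \<F>"
      then obtain F G where I: "I = F \<inter> G" "F \<in> \<F>" "G \<in> \<F>" "F \<noteq> G" by (auto simp: distinct_intersections_def)
      show "I \<in> ?I \<union> E"
      proof (cases "both F G")
        case True
        then obtain A B where AB: "A \<in> T" "B \<in> T" "A \<subseteq> F" "B \<subseteq> G" unfolding both_def by blast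
        have "K \<subseteq> I" using K(3)[OF AB(1)] K(3)[OF AB(2)] AB I by blast
        moreover have "I \<subseteq> X" using I FX(1) by blast
        moreover have "card I < t + 1 + m" using lt[OF I(2-4)] I(1) k by simp
        ultimately show ?thesis by blast
      next
        case False
        thus ?thesis using pair[OF I(2,3)] I(1) by blast
      qed
    qed
    moreover have "finite (?I \<union> E)" using fE fX by (auto intro: finite_subset[of _ "Pow X"])
    ultimately have "card (distinct_intersections \<F>) \<le> card (?I \<union> E)" by (rule card_mono[rotated])
    also have "\<dots> \<le> card ?I + card E" by (rule card_Un_le)
    also have "card ?I \<le> (\<Sum>e\<le>m. n choose e)"
      using card_star_intersections[OF fX(1) K(1,2), of m] fX(2) by simp
    finally have "card (distinct_intersections \<F>) \<le> (\<Sum>e\<le>m. n choose e) + card E" by simp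
    from of_nat_mono[OF this, where 'a = real]
    have "real (card (distinct_intersections \<F>)) \<le> (\<Sum>e\<le>m. real (n choose e)) + real (card E)"
      by (simp only: of_nat_add of_nat_sum)
    also have "\<dots> \<le> (1 + 2 * x) * ?U + ?C / 30 * ?U"
      using k by (intro add_mono sum_binomial cE2) simp
    also have "\<dots> \<le> ?C * ?B"
    proof -
      have "(1 + 2 * x) * ?U \<le> 3 / 2 * ?U" using x_small by (intro mult_right_mono) auto
      moreover have "?C * (99 / 100 * ?U) = 99 / 100 * (?C * ?U)" "?C / 30 * ?U = 1 / 30 * (?C * ?U)" by simp_all
      ultimately show ?thesis using CU CB U0 by linarith
    qed
    also note Jge
    finally show ?thesis by simp
  next
    fix Y assume Y: "Y \<subseteq> X" "card Y = t + 2" and TY: "\<And>A. A \<in> T \<Longrightarrow> A \<subseteq> Y \<and> card A = t + 1"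
    have fY: "finite Y" using Y fX finite_subset by blast
    let ?A = "{F \<in> \<F>. t + 1 \<le> card (F \<inter> Y)}"
    define G where "G = {F \<in> \<F>. card (F \<inter> Y) \<le> t}"
    define D where "D = {P \<in> nsets (X - Y) m. \<exists>F\<in>\<F>. card (F \<inter> Y) \<le> t \<and> P \<inter> F = {}}"
    let ?J = "frankl_intersections X Y k t"
    have JJ: "card ?J \<le> card (frankl_intersections X Y0 k t)"
      using Y Y0 by (intro card_frankl_intersections_le[OF fX(1)]) auto
    have sub: "distinct_intersections ?A \<subseteq> ?J"
      using F by (intro distinct_intersections_frankl_subset[OF fX(1) Y]) auto
    have fJ: "finite ?J" by (rule finite_frankl_intersections[OF fX(1)])
    have fA': "finite (distinct_intersections ?A)" by (rule finite_subset[OF sub fJ])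
    have loss: "card (distinct_intersections ?A) + (((t + 2) choose 2) - 1) * card D \<le> card ?J"
      unfolding D_def by (rule frankl_loss[OF fX(1) Y F int k])
    have c3: "3 \<le> (t + 2) choose 2" using choose_two_bounds(1) by linarith
    have lossr: "real (card (distinct_intersections ?A)) + (?C - 1) * real (card D) \<le> real (card ?J)"
    proof -
      have "real (card (distinct_intersections ?A) + (((t + 2) choose 2) - 1) * card D) \<le> real (card ?J)"
        by (rule of_nat_mono[OF loss])
      thus ?thesis using c3 by (simp add: of_nat_diff)
    qed
    have bothA: "F \<in> ?A \<and> H \<in> ?A" if FH: "both F H" "F \<in> \<F>" "H \<in> \<F>" for F H
    proof -
      obtain A B where AB: "A \<in> T" "B \<in> T" "A \<subseteq> F" "B \<subseteq> H" using FH(1) unfolding both_def by blast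
      have "A \<subseteq> F \<inter> Y" "B \<subseteq> H \<inter> Y" using TY[OF AB(1)] TY[OF AB(2)] AB by auto
      hence "card A \<le> card (F \<inter> Y)" "card B \<le> card (H \<inter> Y)"
        using card_mono[of "F \<inter> Y" A] card_mono[of "H \<inter> Y" B] fY by simp_all
      thus ?thesis using TY[OF AB(1)] TY[OF AB(2)] FH by simp
    qed
    \<comment> \<open>When \<open>D\<close> holds more than a tenth of the \<open>m\<close>-sets,
      the loss is at least \<open>2 / 3 * 99 / 1000 = 0.066\<close> times
      \<open>C * (n choose m)\<close>, about twice the bound \<open>1 / 30\<close> for
      \<open>E\<close>. Otherwise the outside members are rare enough for the power bound.\<close>
    have "card (distinct_intersections \<F>) \<le> card ?J"
    proof (cases "10 * real (card D) \<le> ?B")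
      case False
      have "distinct_intersections \<F> \<subseteq> distinct_intersections ?A \<union> E"
      proof
        fix I assume "I \<in> distinct_intersections \<F>"
        then obtain F H where I: "I = F \<inter> H" "F \<in> \<F>" "H \<in> \<F>" "F \<noteq> H" by (auto simp: distinct_intersections_def)
        show "I \<in> distinct_intersections ?A \<union> E"
        proof (cases "both F H")
          case True
          hence "I \<in> distinct_intersections ?A" using bothA[OF True I(2,3)] I unfolding distinct_intersections_def by blast
          thus ?thesis by blast
        next
          case False
          thus ?thesis using pair[OF I(2,3)] I(1) by blast
        qed
      qed
      hence "card (distinct_intersections \<F>) \<le> card (distinct_intersections ?A \<union> E)"
        by (rule card_mono[rotated]) (use fA' fE in simp)
      also have "\<dots> \<le> card (distinct_intersections ?A) + card E" by (rule card_Un_le)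
      finally have "card (distinct_intersections \<F>) \<le> card (distinct_intersections ?A) + card E" .
      from of_nat_mono[OF this, where 'a = real]
      have 1: "real (card (distinct_intersections \<F>)) \<le> real (card (distinct_intersections ?A)) + real (card E)"
        by (simp only: of_nat_add)
      have "?C / 30 * ?U \<le> (?C - 1) * real (card D)"
      proof -
        have "2 / 3 * ?C * (99 / 1000 * ?U) \<le> (?C - 1) * real (card D)"
        proof (rule mult_mono)
          show "2 / 3 * ?C \<le> ?C - 1" using choose_two_bounds(1) by simp
          show "99 / 1000 * ?U \<le> real (card D)" using False binomial_reduced by simp
        qed (use choose_two_bounds(1) in auto)
        moreover have "0 \<le> ?C * ?U" by simp
        moreover have "2 / 3 * ?C * (99 / 1000 * ?U) = 66 / 1000 * (?C * ?U)" "?C / 30 * ?U = 1 / 30 * (?C * ?U)"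
          by simp_all
        ultimately show ?thesis by linarith
      qed
      hence "real (card (distinct_intersections \<F>)) \<le> real (card ?J)" using 1 cE2 lossr by linarith
      thus ?thesis by simp
    next
      case dsmall: True
      show ?thesis
      proof (cases "G = {}")
        case True
        hence "?A = \<F>" by (auto simp: G_def not_less_eq_eq)
        thus ?thesis using card_mono[OF fJ sub] by simp
      next
        case False
        have M: "(q + 3) * m + k + t + 2 \<le> card X" using q_room(1) fX(2) by simp
        have tk: "t \<le> k" using k by simp
        \<comment> \<open>The numeric lemma takes logarithmic scale in \<open>d\<close>, so
          \<open>D\<close> must be nonempty: an outside member \<open>H\<close> and \<open>Y\<close>
          leave room for an \<open>m\<close>-set.\<close>
        have Dpos: "0 < real (card D)"
        proof -
          obtain H where H: "H \<in> \<F>" "card (H \<inter> Y) \<le> t" using False by (auto simp: G_def)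
          have "card X \<le> card (X - (Y \<union> H)) + card (Y \<union> H)"
            using card_Un_le[of "X - (Y \<union> H)" "Y \<union> H"] card_mono[of "(X - (Y \<union> H)) \<union> (Y \<union> H)" X] fX fY FX(2)[OF H(1)]
            by fastforce
          also have "card (Y \<union> H) \<le> (t + 2) + k" using card_Un_le[of Y H] Y FX(3)[OF H(1)] by simp
          finally have "m \<le> card (X - (Y \<union> H))" using q_room(2) fX(2) k by simp
          then obtain P where P: "P \<subseteq> X - (Y \<union> H)" "card P = m" by (meson obtain_subset_with_card_n)
          have fP: "finite P" by (rule finite_subset[OF P(1)]) (use fX in simp)
          have "P \<in> nsets (X - Y) m" "P \<inter> H = {}" using P fP by (auto simp: nsets_def)
          hence "P \<in> D" using H unfolding D_def by blast
          moreover have "finite D" unfolding D_def using finite_nsets[of "X - Y" m] fX by simp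
          ultimately show ?thesis by (auto simp: card_gt_0_iff)
        qed
        have pw: "real (card G) * ?B ^ (q + 3) \<le> real (card D) ^ (q + 3) * real (n choose k)"
          using card_outside_power[OF fX(1) Y F tk M] fX(2) unfolding G_def D_def by simp
        obtain b where b: "real (card G) * (real k + 1) ^ b + (\<Sum>e<k - b. real (n choose e)) \<le> real (card D)"
          by (rule gains_numeric[OF Dpos dsmall pw], rule that)
        have Gn: "G \<subseteq> nsets X k" using F by (auto simp: G_def)
        let ?I = "{I. \<exists>H\<in>G. I \<subseteq> H}"
        have "real (card ?I) \<le> real (card G * (k + 1) ^ b + (\<Sum>e<k - b. card X choose e))"
          by (intro of_nat_mono card_subsets_of_members[OF fX(1) Gn])
        also have "\<dots> = real (card G) * (real k + 1) ^ b + (\<Sum>e<k - b. real (n choose e))"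
          by (simp only: fX(2) of_nat_add of_nat_mult of_nat_power of_nat_sum of_nat_1)
        also note b
        finally have cI: "real (card ?I) \<le> real (card D)" .
        have "distinct_intersections \<F> \<subseteq> distinct_intersections ?A \<union> ?I"
        proof
          fix I assume "I \<in> distinct_intersections \<F>"
          then obtain F H where I: "I = F \<inter> H" "F \<in> \<F>" "H \<in> \<F>" "F \<noteq> H" by (auto simp: distinct_intersections_def)
          show "I \<in> distinct_intersections ?A \<union> ?I"
          proof (cases "F \<in> ?A \<and> H \<in> ?A")
            case True
            hence "I \<in> distinct_intersections ?A" using I unfolding distinct_intersections_def by blast
            thus ?thesis by blast
          next
            case False
            hence "F \<in> G \<or> H \<in> G" using I by (auto simp: G_def)
            hence "I \<in> ?I" using I(1) by blast
            thus ?thesis by blast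
          qed
        qed
        moreover have "finite ?I" by (rule finite_subset[of _ "Pow X"]) (use FX(1) fX in \<open>auto simp: G_def\<close>)
        ultimately have "card (distinct_intersections \<F>) \<le> card (distinct_intersections ?A \<union> ?I)"
          using fA' by (intro card_mono) auto
        also have "\<dots> \<le> card (distinct_intersections ?A) + card ?I" by (rule card_Un_le)
        finally have "card (distinct_intersections \<F>) \<le> card (distinct_intersections ?A) + card ?I" .
        from of_nat_mono[OF this, where 'a = real]
        have "real (card (distinct_intersections \<F>)) \<le> real (card (distinct_intersections ?A)) + real (card ?I)"
          by (simp only: of_nat_add)
        moreover have "1 * real (card D) \<le> (?C - 1) * real (card D)" using choose_two_bounds(1) by (intro mult_right_mono) auto
        ultimately have "real (card (distinct_intersections \<F>)) \<le> real (card ?J)" using cI lossr by linarith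
        thus ?thesis by simp
      qed
    qed
    thus ?thesis using JJ by simp
  qed
qed

end

section \<open>The threshold\<close>

text \<open>For \<open>t < k\<close> the general comparison applies with \<open>{1..t + 2}\<close>,
  whose explicit intersections are all attained. For \<open>k \<le> t\<close> any two members
  coincide, so there are no intersections of distinct members.\<close>

lemma card_distinct_intersections_le_frankl:
  assumes k0: "0 < k" and t0: "0 < t" and n_sqrt: "10 ^ 28 * real k ^ 3 \<le> real n ^ 2"
    and n_t: "10 ^ 14 * (real k * real t ^ 2) \<le> real n"
    and F: "\<F> \<subseteq> nsets {1..n} k" and int: "t_intersecting t \<F>"
  shows "card (distinct_intersections \<F>) \<le> card (distinct_intersections (frankl_family n k t))"
proof (cases "t < k")
  case True
  define m where "m = k - t - 1"
  interpret large_ground n k t m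
    by unfold_locales (use True t0 n_sqrt n_t in \<open>auto simp: m_def\<close>)
  let ?X = "{1..n}" and ?Y = "{1..t + 2}"
  have n: "2 * k + t + 2 \<le> n" by (rule q_room(2))
  have Y: "?Y \<subseteq> ?X" "card ?Y = t + 2" using n by auto
  have "card (distinct_intersections \<F>) \<le> card (frankl_intersections ?X ?Y k t)"
    by (rule card_intersections_le[OF _ _ F int Y]) auto
  also have "\<dots> \<le> card (distinct_intersections (frankl_family n k t))"
  proof (rule card_mono)
    show "frankl_intersections ?X ?Y k t \<subseteq> distinct_intersections (frankl_family n k t)"
      unfolding frankl_family_def
      by (rule subsetI, rule frankl_intersections_attained[OF _ Y]) (use n in auto)
    show "finite (distinct_intersections (frankl_family n k t))"
      by (rule finite_subset[of _ "Pow ?X"])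
        (auto simp: distinct_intersections_def frankl_family_def nsets_def)
  qed
  finally show ?thesis .
next
  case False
  have "F = G" if FG: "F \<in> \<F>" "G \<in> \<F>" for F G
  proof -
    have k: "finite F" "finite G" "card F = k" "card G = k" using FG F by (auto simp: nsets_def)
    have le: "k \<le> card (F \<inter> G)" using int FG False unfolding t_intersecting_def by fastforce
    have "F \<inter> G = F" by (rule card_seteq[OF k(1)]) (use k le in simp_all)
    moreover have "F \<inter> G = G" by (rule card_seteq[OF k(2)]) (use k le in simp_all)
    ultimately show ?thesis by simp
  qed
  hence "distinct_intersections \<F> = {}" by (auto simp: distinct_intersections_def)
  thus ?thesis by simp
qed

text \<open>The cutoff \<open>k powr (1/4) * ln k\<close> exceeds every \<open>O(k powr (1/4))\<close> and lies below every
  larger power, so it separates cases 2(a) and 2(b).\<close>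

definition threshold :: "nat \<Rightarrow> nat \<Rightarrow> real" where
  "threshold k t = 10 ^ 14 * (real k powr (3/2) + real k * real t ^ 2 +
     (if real t \<le> real k powr (1/4) * ln (real k) then real k powr (3/2) * real t else 0))"

lemma threshold_nonneg: "0 \<le> threshold k t"
  by (simp add: threshold_def)

lemma threshold_ge: "10 ^ 14 * real k powr (3/2) \<le> threshold k t" "10 ^ 14 * (real k * real t ^ 2) \<le> threshold k t"
  by (simp_all add: threshold_def)

lemma threshold_le:
  "threshold k t \<le> 10 ^ 14 * (real k powr (3/2) + real k * real t ^ 2 + real k powr (3/2) * real t)"
  by (simp add: threshold_def)

lemma card_distinct_intersections_le_threshold:
  assumes "0 < k" "0 < t" "threshold k t \<le> real n" "\<F> \<subseteq> nsets {1..n} k" "t_intersecting t \<F>"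
  shows "card (distinct_intersections \<F>) \<le> card (distinct_intersections (frankl_family n k t))"
proof (rule card_distinct_intersections_le_frankl[OF assms(1,2) _ _ assms(4,5)])
  have "10 ^ 14 * real k powr (3/2) \<le> real n" using threshold_ge(1) assms(3) by (rule order_trans)
  hence "(10 ^ 14 * real k powr (3/2)) ^ 2 \<le> real n ^ 2" by (intro power_mono) auto
  moreover have "(real k powr (3/2)) ^ 2 = real k ^ 3"
    using assms(1) by (simp add: powr_power powr_numeral)
  ultimately show "10 ^ 28 * real k ^ 3 \<le> real n ^ 2" by (simp add: power_mult_distrib)
  show "10 ^ 14 * (real k * real t ^ 2) \<le> real n" using threshold_ge(2) assms(3) by (rule order_trans)
qed

section \<open>Order of growth of the threshold\<close>

lemma eventually_real_ge: "eventually (\<lambda>k::nat. c \<le> real k) at_top"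
  using filterlim_real_sequentially by (auto simp: filterlim_at_top)

lemma bigtheta_nat_bounds:
  fixes f g :: "nat \<Rightarrow> real"
  assumes "f \<in> \<Theta>(g)" "\<And>k. 0 \<le> f k" "\<And>k. 0 \<le> g k"
  obtains c1 c2 where "0 < c1" "0 < c2" "eventually (\<lambda>k. c1 * g k \<le> f k \<and> f k \<le> c2 * g k) at_top"
proof -
  obtain c2 where c2: "0 < c2" "eventually (\<lambda>k. norm (f k) \<le> c2 * norm (g k)) at_top"
    using landau_o.bigE[OF bigthetaD1[OF assms(1)]] by blast
  obtain c1 where c1: "0 < c1" "eventually (\<lambda>k. norm (f k) \<ge> c1 * norm (g k)) at_top"
    using landau_omega.bigE[OF bigthetaD2[OF assms(1)]] by blast
  have "eventually (\<lambda>k. c1 * g k \<le> f k \<and> f k \<le> c2 * g k) at_top"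
    using c1(2) c2(2) by eventually_elim (use assms(2,3) in simp)
  thus ?thesis using that c1(1) c2(1) by blast
qed

lemma threshold_bigtheta:
  assumes "0 < c1" "eventually (\<lambda>k. c1 * g k \<le> threshold k (\<tau> k) \<and> threshold k (\<tau> k) \<le> c2 * g k) at_top"
    "\<And>k. 0 \<le> g k"
  shows "(\<lambda>k. threshold k (\<tau> k)) \<in> \<Theta>(g)"
proof (rule bigthetaI)
  show "(\<lambda>k. threshold k (\<tau> k)) \<in> O(g)"
    by (rule bigoI[of _ c2]) (use assms(2) in \<open>eventually_elim, use assms(3) threshold_nonneg in auto\<close>)
  show "(\<lambda>k. threshold k (\<tau> k)) \<in> \<Omega>(g)"
    by (rule landau_omega.bigI[OF assms(1)]) (use assms(2) in \<open>eventually_elim, use assms(3) threshold_nonneg in auto\<close>)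
qed

text \<open>For bounded \<open>t\<close> the correction \<open>e\<close> to the exponent is
  \<open>O(1 / k)\<close>, and \<open>ln k \<le> k\<close> keeps \<open>k powr e\<close> between 1
  and a constant. The claimed order is therefore that of \<open>k powr (3/2)\<close>.\<close>

lemma threshold_bounded:
  fixes \<tau> :: "nat \<Rightarrow> nat"
  assumes "(\<lambda>k. real (\<tau> k)) \<in> O(\<lambda>k. 1)"
  shows "(\<lambda>k. threshold k (\<tau> k)) \<in> \<Theta>(\<lambda>k. real k powr (3/2 + (10 + real (\<tau> k)) / (2 * (real k - real (\<tau> k) - 2))))"
proof -
  obtain M where M: "0 < M" "eventually (\<lambda>k. norm (real (\<tau> k)) \<le> M * norm (1::real)) at_top"
    using landau_o.bigE[OF assms] by blast
  show ?thesis
  proof (rule threshold_bigtheta)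
    show "0 < 10 ^ 14 * exp (- (10 + M))" by simp
    show "eventually (\<lambda>k. 10 ^ 14 * exp (- (10 + M)) * real k powr (3/2 + (10 + real (\<tau> k)) / (2 * (real k - real (\<tau> k) - 2)))
        \<le> threshold k (\<tau> k) \<and> threshold k (\<tau> k) \<le> 10 ^ 14 * (1 + M ^ 2 + M) *
          real k powr (3/2 + (10 + real (\<tau> k)) / (2 * (real k - real (\<tau> k) - 2)))) at_top"
      using M(2) eventually_real_ge[of "2 * (M + 3)"]
    proof eventually_elim
      case (elim k)
      define r where "r = real k"
      define s where "s = real (\<tau> k)"
      have rs: "0 \<le> s" "s \<le> M" "2 * (M + 3) \<le> r" "1 \<le> r" using elim M(1) by (auto simp: r_def s_def)
      define e where "e = (10 + s) / (2 * (r - s - 2))"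
      have e0: "0 \<le> e" using rs by (simp add: e_def)
      have "e \<le> (10 + M) / r" unfolding e_def using rs by (intro frac_le) auto
      hence "e * ln r \<le> (10 + M) / r * ln r" using rs by (intro mult_right_mono) auto
      also have "\<dots> \<le> (10 + M) / r * r"
        using rs M(1) ln_le_minus_one[of r] by (intro mult_left_mono) auto
      finally have "e * ln r \<le> 10 + M" using rs by simp
      hence re: "r powr e \<le> exp (10 + M)" using rs by (simp add: powr_def)
      have re1: "1 \<le> r powr e" using rs e0 by (simp add: ge_one_powr_ge_zero)
      have g: "r powr (3/2 + e) = r powr (3/2) * r powr e" by (simp add: powr_add)
      have "exp (- (10 + M)) * r powr e \<le> exp (- (10 + M)) * exp (10 + M)"
        using re by (intro mult_left_mono) auto
      hence le1: "exp (- (10 + M)) * r powr e \<le> 1" by (simp add: exp_add[symmetric])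
      have "10 ^ 14 * exp (- (10 + M)) * r powr (3/2 + e) = 10 ^ 14 * r powr (3/2) * (exp (- (10 + M)) * r powr e)"
        by (simp add: g)
      also have "\<dots> \<le> 10 ^ 14 * r powr (3/2) * 1" by (rule mult_left_mono[OF le1]) simp
      also have "\<dots> \<le> threshold k (\<tau> k)" using threshold_ge(1)[of k "\<tau> k"] by (simp add: r_def)
      finally have low: "10 ^ 14 * exp (- (10 + M)) * r powr (3/2 + e) \<le> threshold k (\<tau> k)" .
      have r32: "r \<le> r powr (3/2)" using rs powr_mono[of 1 "3/2" r] by simp
      have "threshold k (\<tau> k) \<le> 10 ^ 14 * (r powr (3/2) + r * s ^ 2 + r powr (3/2) * s)"
        using threshold_le[of k "\<tau> k"] by (simp add: r_def s_def)
      also have "\<dots> \<le> 10 ^ 14 * (r powr (3/2) + r powr (3/2) * M ^ 2 + r powr (3/2) * M)"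
        using rs r32 by (intro mult_left_mono add_mono mult_mono power_mono) auto
      also have "\<dots> = 10 ^ 14 * (1 + M ^ 2 + M) * (r powr (3/2) * 1)" by (simp add: algebra_simps)
      also have "\<dots> \<le> 10 ^ 14 * (1 + M ^ 2 + M) * (r powr (3/2) * r powr e)"
        using re1 M(1) by (intro mult_left_mono) auto
      finally have "threshold k (\<tau> k) \<le> 10 ^ 14 * (1 + M ^ 2 + M) * r powr (3/2 + e)" by (simp add: g)
      thus ?case using low by (simp add: r_def s_def e_def)
    qed
  qed simp
qed

text \<open>Once \<open>c2 \<le> ln k\<close>, the sequence is below the cutoff and the conditional
  summand \<open>k powr (3/2) * t\<close> is present. It dominates \<open>k powr (3/2)\<close>
  because \<open>t \<ge> 1\<close>, and \<open>k * t^2\<close> because eventually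
  \<open>t \<le> sqrt k\<close>.\<close>

lemma threshold_small_power:
  fixes \<tau> :: "nat \<Rightarrow> nat"
  assumes "\<And>k. 0 < \<tau> k" "(\<lambda>k. real (\<tau> k)) \<in> \<Theta>(\<lambda>k. real k powr \<epsilon>)" "\<epsilon> \<le> 1/4"
  shows "(\<lambda>k. threshold k (\<tau> k)) \<in> \<Theta>(\<lambda>k. real k powr (3/2 + \<epsilon>))"
proof -
  obtain c1 c2 where c: "0 < c1" "0 < c2"
    "eventually (\<lambda>k. c1 * real k powr \<epsilon> \<le> real (\<tau> k) \<and> real (\<tau> k) \<le> c2 * real k powr \<epsilon>) at_top"
    by (rule bigtheta_nat_bounds[OF assms(2)]) (simp, simp, rule that)
  show ?thesis
  proof (rule threshold_bigtheta)
    show "0 < 10 ^ 14 * c1" using c by simp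
    show "eventually (\<lambda>k. 10 ^ 14 * c1 * real k powr (3/2 + \<epsilon>) \<le> threshold k (\<tau> k) \<and>
        threshold k (\<tau> k) \<le> 10 ^ 14 * 3 * c2 * real k powr (3/2 + \<epsilon>)) at_top"
      using c(3) eventually_real_ge[of 1] eventually_real_ge[of "exp c2"] eventually_real_ge[of "c2 powr 4"]
    proof eventually_elim
      case (elim k)
      define r where "r = real k"
      define s where "s = real (\<tau> k)"
      have s1: "1 \<le> s" using assms(1)[of k] by (simp add: s_def)
      have rs: "1 \<le> r" "c1 * r powr \<epsilon> \<le> s" "s \<le> c2 * r powr \<epsilon>" "exp c2 \<le> r" "c2 powr 4 \<le> r"
        using elim by (auto simp: r_def s_def)
      have e4: "r powr \<epsilon> \<le> r powr (1/4)" using rs assms(3) by (intro powr_mono) auto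
      have "c2 \<le> ln r" using rs by (simp add: ln_ge_iff)
      hence "c2 * r powr \<epsilon> \<le> ln r * r powr (1/4)" using e4 c rs by (intro mult_mono) auto
      hence cut: "s \<le> r powr (1/4) * ln r" using rs by (simp add: mult.commute)
      have "c2 = (c2 powr 4) powr (1/4)" by (subst powr_powr) (use c in simp)
      also have "\<dots> \<le> r powr (1/4)" using rs c by (intro powr_mono2) auto
      finally have "c2 * r powr \<epsilon> \<le> r powr (1/4) * r powr (1/4)" using e4 c by (intro mult_mono) auto
      also have "\<dots> = r powr (1/2)" by (simp add: powr_add[symmetric])
      finally have s2: "s \<le> r powr (1/2)" using rs by simp
      have r32: "r * r powr (1/2) = r powr (3/2)" using rs powr_mult_base[of r "1/2"] by simp
      have f: "threshold k (\<tau> k) = 10 ^ 14 * (r powr (3/2) + r * s ^ 2 + r powr (3/2) * s)"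
        using cut by (simp add: threshold_def r_def s_def)
      have g: "r powr (3/2 + \<epsilon>) = r powr (3/2) * r powr \<epsilon>" by (simp add: powr_add)
      have "r powr (3/2) * (c1 * r powr \<epsilon>) \<le> r powr (3/2) * s" by (intro mult_left_mono rs) simp
      moreover have "0 \<le> r powr (3/2) + r * s ^ 2" using rs by simp
      ultimately have low: "10 ^ 14 * c1 * r powr (3/2 + \<epsilon>) \<le> threshold k (\<tau> k)"
        unfolding f g by (simp add: mult_ac)
      have "r powr (3/2) * 1 \<le> r powr (3/2) * s" by (intro mult_left_mono s1) simp
      moreover have "r * s ^ 2 \<le> r powr (3/2) * s"
      proof -
        have "r * s * s \<le> r * r powr (1/2) * s" using s2 rs s1 by (intro mult_right_mono mult_left_mono) auto
        thus ?thesis by (simp add: r32 power2_eq_square mult_ac)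
      qed
      moreover have "r powr (3/2) * s \<le> r powr (3/2) * (c2 * r powr \<epsilon>)" by (intro mult_left_mono rs) simp
      ultimately have "threshold k (\<tau> k) \<le> 10 ^ 14 * (3 * (r powr (3/2) * (c2 * r powr \<epsilon>)))"
        unfolding f by (intro mult_left_mono) auto
      hence "threshold k (\<tau> k) \<le> 10 ^ 14 * 3 * c2 * r powr (3/2 + \<epsilon>)" by (simp add: g mult_ac)
      thus ?case using low by (simp add: r_def)
    qed
  qed simp
qed

text \<open>Any positive power of \<open>k\<close> outgrows \<open>ln k\<close>, so the sequence
  eventually exceeds the cutoff and the conditional summand is 0. Then \<open>k * t^2\<close> has
  the claimed order, which is above \<open>k powr (3/2)\<close> since
  \<open>1 + 2 * \<epsilon> > 3/2\<close>.\<close>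

lemma threshold_large_power:
  fixes \<tau> :: "nat \<Rightarrow> nat"
  assumes "(\<lambda>k. real (\<tau> k)) \<in> \<Theta>(\<lambda>k. real k powr \<epsilon>)" "\<epsilon> > 1/4"
  shows "(\<lambda>k. threshold k (\<tau> k)) \<in> \<Theta>(\<lambda>k. real k powr (1 + 2 * \<epsilon>))"
proof -
  obtain c1 c2 where c: "0 < c1" "0 < c2"
    "eventually (\<lambda>k. c1 * real k powr \<epsilon> \<le> real (\<tau> k) \<and> real (\<tau> k) \<le> c2 * real k powr \<epsilon>) at_top"
    by (rule bigtheta_nat_bounds[OF assms(1)]) (simp, simp, rule that)
  \<comment> \<open>Half of the excess over 1/4: in \<open>ln r \<le> r powr a / a\<close>, a second
    factor \<open>r powr a\<close> outweighs the constant \<open>2 / (a * c1)\<close>.\<close>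
  define a where "a = (\<epsilon> - 1/4) / 2"
  have a: "0 < a" "\<epsilon> - 1/4 = a + a" using assms(2) by (auto simp: a_def)
  show ?thesis
  proof (rule threshold_bigtheta)
    show "0 < 10 ^ 14 * c1 ^ 2" using c by simp
    show "eventually (\<lambda>k. 10 ^ 14 * c1 ^ 2 * real k powr (1 + 2 * \<epsilon>) \<le> threshold k (\<tau> k) \<and>
        threshold k (\<tau> k) \<le> 10 ^ 14 * (1 + c2 ^ 2) * real k powr (1 + 2 * \<epsilon>)) at_top"
      using c(3) eventually_real_ge[of 1] eventually_real_ge[of "(2 / (a * c1)) powr (1 / a)"]
    proof eventually_elim
      case (elim k)
      define r where "r = real k"
      define s where "s = real (\<tau> k)"
      have rs: "1 \<le> r" "c1 * r powr \<epsilon> \<le> s" "s \<le> c2 * r powr \<epsilon>" "0 \<le> s"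
        "(2 / (a * c1)) powr (1 / a) \<le> r"
        using elim by (auto simp: r_def s_def)
      have ln_small: "ln r \<le> c1 / 2 * r powr (\<epsilon> - 1/4)"
      proof -
        have "2 / (a * c1) = ((2 / (a * c1)) powr (1 / a)) powr a" using a c by (simp add: powr_powr)
        also have "\<dots> \<le> r powr a" using rs a by (intro powr_mono2) auto
        finally have "1 / a \<le> c1 / 2 * r powr a" using a c by (simp add: field_simps)
        hence "1 / a * r powr a \<le> c1 / 2 * r powr a * r powr a" by (intro mult_right_mono) auto
        hence "r powr a / a \<le> c1 / 2 * (r powr a * r powr a)" by (simp add: mult.assoc)
        moreover have "ln r \<le> r powr a / a" using rs a by (intro ln_powr_bound) auto
        ultimately have "ln r \<le> c1 / 2 * (r powr a * r powr a)" by linarith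
        thus ?thesis by (simp only: a(2) powr_add)
      qed
      have "r powr (1/4) * ln r \<le> r powr (1/4) * (c1 / 2 * r powr (\<epsilon> - 1/4))"
        by (intro mult_left_mono ln_small) simp
      also have "\<dots> = c1 / 2 * (r powr (1/4) * r powr (\<epsilon> - 1/4))" by simp
      also have "r powr (1/4) * r powr (\<epsilon> - 1/4) = r powr \<epsilon>" by (simp add: powr_add[symmetric])
      also have "c1 / 2 * r powr \<epsilon> < c1 * r powr \<epsilon>" using c rs by simp
      finally have cut: "\<not> s \<le> r powr (1/4) * ln r" using rs(2) by simp
      have f: "threshold k (\<tau> k) = 10 ^ 14 * (r powr (3/2) + r * s ^ 2)"
        using cut by (simp add: threshold_def r_def s_def)
      have "(r powr \<epsilon>) ^ 2 = r powr (2 * \<epsilon>)" by (simp add: power2_eq_square flip: powr_add)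
      hence g: "r powr (1 + 2 * \<epsilon>) = r * (r powr \<epsilon>) ^ 2"
        using rs powr_mult_base[of r "2 * \<epsilon>"] by simp
      have "r * (c1 * r powr \<epsilon>) ^ 2 \<le> r * s ^ 2" using rs c by (intro mult_left_mono power_mono) auto
      hence "10 ^ 14 * (r * (c1 * r powr \<epsilon>) ^ 2) \<le> threshold k (\<tau> k)"
        unfolding f by (intro mult_left_mono[OF add_increasing]) auto
      hence low: "10 ^ 14 * c1 ^ 2 * r powr (1 + 2 * \<epsilon>) \<le> threshold k (\<tau> k)"
        unfolding g by (simp add: power_mult_distrib mult_ac)
      have "r * s ^ 2 \<le> r * (c2 * r powr \<epsilon>) ^ 2" using rs by (intro mult_left_mono power_mono) auto
      moreover have "r powr (3/2) \<le> r powr (1 + 2 * \<epsilon>)" using rs assms(2) by (intro powr_mono) auto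
      ultimately have "threshold k (\<tau> k) \<le> 10 ^ 14 * (r powr (1 + 2 * \<epsilon>) + r * (c2 * r powr \<epsilon>) ^ 2)"
        unfolding f by (intro mult_left_mono[OF add_mono]) auto
      also have "\<dots> = 10 ^ 14 * (1 + c2 ^ 2) * r powr (1 + 2 * \<epsilon>)"
        unfolding g by (simp add: power_mult_distrib algebra_simps)
      finally show ?case using low by (simp add: r_def)
    qed
  qed simp
qed

text \<open>The term \<open>k * t^2\<close> alone gives the lower bound. Above,
  \<open>k powr (3/2) \<le> k^2\<close> makes the crude bound with all three summands
  sufficient.\<close>

lemma threshold_linear:
  fixes \<tau> :: "nat \<Rightarrow> nat"
  assumes "(\<lambda>k. real (\<tau> k)) \<in> \<Theta>(\<lambda>k. real k)"
  shows "(\<lambda>k. threshold k (\<tau> k)) \<in> \<Theta>(\<lambda>k. real k ^ 3)"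
proof -
  obtain c1 c2 where c: "0 < c1" "0 < c2"
    "eventually (\<lambda>k. c1 * real k \<le> real (\<tau> k) \<and> real (\<tau> k) \<le> c2 * real k) at_top"
    by (rule bigtheta_nat_bounds[OF assms(1)]) (simp, simp, rule that)
  show ?thesis
  proof (rule threshold_bigtheta)
    show "0 < 10 ^ 14 * c1 ^ 2" using c by simp
    show "eventually (\<lambda>k. 10 ^ 14 * c1 ^ 2 * real k ^ 3 \<le> threshold k (\<tau> k) \<and>
        threshold k (\<tau> k) \<le> 10 ^ 14 * (1 + c2 ^ 2 + c2) * real k ^ 3) at_top"
      using c(3) eventually_real_ge[of 1]
    proof eventually_elim
      case (elim k)
      define r where "r = real k"
      define s where "s = real (\<tau> k)"
      have rs: "1 \<le> r" "c1 * r \<le> s" "s \<le> c2 * r" "0 \<le> s" using elim by (auto simp: r_def s_def)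
      have "r * (c1 * r) ^ 2 \<le> r * s ^ 2" using rs c by (intro mult_left_mono power_mono) auto
      hence "10 ^ 14 * (r * (c1 * r) ^ 2) \<le> 10 ^ 14 * (r * s ^ 2)" by (rule mult_left_mono) simp
      also have "\<dots> \<le> threshold k (\<tau> k)" using threshold_ge(2)[of k "\<tau> k"] by (simp add: r_def s_def)
      finally have low: "10 ^ 14 * c1 ^ 2 * r ^ 3 \<le> threshold k (\<tau> k)"
        by (simp add: power2_eq_square power3_eq_cube mult_ac)
      have p: "r powr (3/2) \<le> r ^ 2" "r ^ 2 \<le> r ^ 3"
        using rs powr_mono[of "3/2" 2 r] by (auto simp: powr_numeral intro: power_increasing)
      have "threshold k (\<tau> k) \<le> 10 ^ 14 * (r powr (3/2) + r * s ^ 2 + r powr (3/2) * s)"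
        using threshold_le[of k "\<tau> k"] by (simp add: r_def s_def)
      also have "\<dots> \<le> 10 ^ 14 * (r ^ 3 + r * (c2 * r) ^ 2 + r ^ 2 * (c2 * r))"
        using p rs by (intro mult_left_mono add_mono mult_mono power_mono) auto
      also have "\<dots> = 10 ^ 14 * (1 + c2 ^ 2 + c2) * r ^ 3"
        by (simp add: power2_eq_square power3_eq_cube algebra_simps)
      finally show ?case using low by (simp add: r_def)
    qed
  qed simp
qed

text \<open>The growth regimes of \<open>t\<close> are expressed by sequences with
  \<open>t = \<tau> k\<close>. As \<open>f\<close> is chosen before \<open>\<tau>\<close>, one
  function of \<open>k\<close> and \<open>t\<close> meets all of them at once.\<close>

theorem theorem3:
  "\<exists>f :: nat \<Rightarrow> nat \<Rightarrow> real.
     (\<forall>k t. 0 \<le> f k t) \<and>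
     (\<forall>k t n \<F>. 0 < k \<longrightarrow> 0 < t \<longrightarrow> f k t \<le> real n \<longrightarrow>
        \<F> \<subseteq> nsets {1..n} k \<longrightarrow> t_intersecting t \<F> \<longrightarrow>
        card (distinct_intersections \<F>) \<le> card (distinct_intersections (frankl_family n k t))) \<and>
     (\<forall>\<tau> :: nat \<Rightarrow> nat. (\<forall>k. 0 < \<tau> k) \<longrightarrow>
        ((\<lambda>k. real (\<tau> k)) \<in> O(\<lambda>k. 1) \<longrightarrow>
           (\<lambda>k. f k (\<tau> k)) \<in>
             \<Theta>(\<lambda>k. real k powr (3 / 2 + (10 + real (\<tau> k)) / (2 * (real k - real (\<tau> k) - 2))))) \<and>
        ((\<lambda>k. real (\<tau> k)) \<in> o(\<lambda>k. real k) \<longrightarrow>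
           (\<forall>\<epsilon>' :: real. (\<lambda>k. real (\<tau> k)) \<in> \<Theta>(\<lambda>k. real k powr \<epsilon>') \<longrightarrow>
              (\<epsilon>' \<le> 1 / 4 \<longrightarrow> (\<lambda>k. f k (\<tau> k)) \<in> \<Theta>(\<lambda>k. real k powr (3 / 2 + \<epsilon>'))) \<and>
              (\<epsilon>' > 1 / 4 \<longrightarrow> (\<lambda>k. f k (\<tau> k)) \<in> \<Theta>(\<lambda>k. real k powr (1 + 2 * \<epsilon>'))))) \<and>
        ((\<lambda>k. real (\<tau> k)) \<in> \<Theta>(\<lambda>k. real k) \<longrightarrow>
           (\<lambda>k. f k (\<tau> k)) \<in> \<Theta>(\<lambda>k. real k ^ 3)))"
proof (intro exI[of _ threshold] conjI allI impI)
  show "0 \<le> threshold k t" for k t by (rule threshold_nonneg)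
qed (rule card_distinct_intersections_le_threshold threshold_bounded threshold_small_power
  threshold_large_power threshold_linear; blast)+

end
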